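(* Let $\gamma\in\mathcal{A}^{m+1}$ be fixed. The reduced exponential map $\exp_\gamma\colon\Omega\subset T_\gamma\mathcal{A}^m\to\mathcal{A}^m$ is not a $C^1$ map on $T_\gamma\mathcal{A}^m$ (that is, on its domain $\Omega$ there) for any $m\ge 3$.
   Context: Fix $N\ge 2$. For integers $j,k\ge 0$ and $\eta\colon[-1,1]\to\mathbb{R}^N$ put $\lVert \eta\rVert_{j,k}^2=\int_{-1}^1(1-s^2)^j\lvert\partial_s^k\eta(s)\rvert^2\,ds$. $\mathcal{K}^m$ is the Hilbert space of odd curves $\eta\colon[-1,1]\to\mathbb{R}^N$ ($\eta(-s)=-\eta(s)$) with $\lVert\eta\rVert_{j,j}<\infty$ for $0\le j\le m$, with squared norm $\sum_{j=0}^m\lVert\eta\rVert_{j,j}^2$. Put $\mathcal{A}^m=\{\eta\in\mathcal{K}^m:\lvert\eta'\rvert\equiv1\}$ and $T_\gamma\mathcal{A}^m=\{v\in\mathcal{K}^m:\langle v',\gamma'\rangle\equiv0\}$. Consider the system $$\eta_{tt}=\partial_s(\sigma\eta_s),\qquad \sigma_{ss}-\lvert\eta_{ss}\rvert^2\sigma=-\lvert\eta_{st}\rvert^2,\qquad \sigma(t,\pm1)=0,$$ with $\eta(0,s)=\gamma(s)$, $\eta_t(0,s)=w(s)$. It is known that for $m\ge3$, $\gamma\in\mathcal{A}^{m+1}$ and $w\in T_\gamma\mathcal{A}^m$ there are $T>0$ and a unique solution $\eta\colon(-T,T)\to\mathcal{A}^{m+1}$ with $\dot\eta(t)\in T_{\eta(t)}\mathcal{A}^m$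 for all $t$. For a fixed initial configuration $\gamma\in\mathcal{A}^{m+1}$, the reduced exponential map at $\gamma$ is $\exp_\gamma\colon\Omega\subset T_\gamma\mathcal{A}^m\to\mathcal{A}^m$, $\exp_\gamma(w)=\eta(1)$, defined on some open neighborhood $\Omega$ of $0$, where $\eta$ is the solution with $\eta(0)=\gamma$ and $\dot\eta(0)=w$. *)

theory Defs
  imports "HOL-Analysis.Analysis" "HOL-Library.Function_Algebras"
begin

text \<open>
  Curves on \<open>[-1,1]\<close> are functions on \<open>real\<close> that vanish outside \<open>[-1,1]\<close>; sums, differences and
  the zero curve are the pointwise ones of \<^theory>\<open>HOL-Library.Function_Algebras\<close>.
\<close>

text \<open>
  On an interval a locally integrable \<open>g\<close> is the weak derivative of \<open>f\<close> iff (the continuous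
  representative of) \<open>f\<close> is locally absolutely continuous with primitive property as below.
  \<open>g\<close> is determined almost everywhere.
\<close>
definition is_primitive :: "(real \<Rightarrow> real ^ 'n) \<Rightarrow> (real \<Rightarrow> real ^ 'n) \<Rightarrow> bool" where
  "is_primitive f g \<longleftrightarrow>
     (\<forall>a b. -1 < a \<longrightarrow> a \<le> b \<longrightarrow> b < 1 \<longrightarrow>
        g absolutely_integrable_on {a..b} \<and> (g has_integral (f b - f a)) {a..b})"

text \<open>\<open>has_weak_deriv k f g\<close>: \<open>g\<close> is a \<open>k\<close>-th weak derivative of \<open>f\<close> on \<open>(-1,1)\<close>.\<close>
primrec has_weak_deriv :: "nat \<Rightarrow> (real \<Rightarrow> real ^ 'n) \<Rightarrow> (real \<Rightarrow> real ^ 'n) \<Rightarrow> bool" where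
  "has_weak_deriv 0 f g \<longleftrightarrow> (\<forall>s\<in>{-1<..<1}. g s = f s)"
| "has_weak_deriv (Suc k) f g \<longleftrightarrow> (\<exists>h. has_weak_deriv k f h \<and> is_primitive h g)"

definition weak_deriv :: "nat \<Rightarrow> (real \<Rightarrow> real ^ 'n) \<Rightarrow> real \<Rightarrow> real ^ 'n" where
  "weak_deriv k f = (SOME g. has_weak_deriv k f g)"

definition wdensity :: "nat \<Rightarrow> nat \<Rightarrow> (real \<Rightarrow> real ^ 'n) \<Rightarrow> real \<Rightarrow> real" where
  "wdensity j k f s = (1 - s\<^sup>2) ^ j * (norm (weak_deriv k f s))\<^sup>2"

definition wnorm_sq :: "nat \<Rightarrow> nat \<Rightarrow> (real \<Rightarrow> real ^ 'n) \<Rightarrow> real" where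
  "wnorm_sq j k f = integral {-1..1} (wdensity j k f)"

text \<open>
  The space \<open>K\<^sup>m\<close>. Only \<open>m \<ge> 2\<close> is used below. For such \<open>m\<close>, finiteness of the
  norms forces \<open>|\<eta>'(s)| \<le> C (1 - s\<^sup>2) powr (-1/2)\<close>, so every class of almost everywhere equal
  functions has exactly one representative that is continuous on the closed interval; that
  representative is the element of the space.
\<close>
definition Kspace :: "nat \<Rightarrow> (real \<Rightarrow> real ^ 'n) set" where
  "Kspace m = {\<eta>. (\<forall>s. s \<notin> {-1..1} \<longrightarrow> \<eta> s = 0) \<and> continuous_on {-1..1} \<eta> \<and>
     (\<forall>s. \<eta> (- s) = - \<eta> s) \<and>
     (\<forall>j\<le>m. (\<exists>g. has_weak_deriv j \<eta> g) \<and> wdensity j j \<eta> integrable_on {-1..1})}"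

definition Knorm :: "nat \<Rightarrow> (real \<Rightarrow> real ^ 'n) \<Rightarrow> real" where
  "Knorm m \<eta> = sqrt (\<Sum>j\<le>m. wnorm_sq j j \<eta>)"

text \<open>
  For \<open>m \<ge> 2\<close> elements of \<open>K\<^sup>m\<close> are of class \<open>C\<^sup>m\<^sup>-\<^sup>1\<close> on the open interval, so there the classical
  derivative may be used pointwise. (At \<open>\<plusminus>1\<close> the derivative of an element of \<open>K\<^sup>3\<close> need not exist.)
\<close>
definition arcs :: "nat \<Rightarrow> (real \<Rightarrow> real ^ 'n) set" where
  "arcs m = {\<eta> \<in> Kspace m. \<forall>s\<in>{-1<..<1}. norm (vector_derivative \<eta> (at s)) = 1}"

definition tangent :: "nat \<Rightarrow> (real \<Rightarrow> real ^ 'n) \<Rightarrow> (real \<Rightarrow> real ^ 'n) set" where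
  "tangent m \<gamma> = {v \<in> Kspace m. \<forall>s\<in>{-1<..<1}.
     vector_derivative v (at s) \<bullet> vector_derivative \<gamma> (at s) = 0}"

text \<open>
  The tension \<open>\<sigma>\<close> solves the boundary value problem in the classical sense: continuous on \<open>[-1,1]\<close>
  and twice differentiable inside; \<open>\<rho>\<close> is \<open>\<sigma>\<^sub>s\<close>. \<open>\<eta>\<close> and \<open>v\<close> are the position and velocity at one time.
\<close>
definition is_tension ::
    "(real \<Rightarrow> real ^ 'n) \<Rightarrow> (real \<Rightarrow> real ^ 'n) \<Rightarrow> (real \<Rightarrow> real) \<Rightarrow> bool" where
  "is_tension \<eta> v \<sigma> \<longleftrightarrow>
     continuous_on {-1..1} \<sigma> \<and> \<sigma> (-1) = 0 \<and> \<sigma> 1 = 0 \<and>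
     (\<exists>\<rho>. \<forall>s\<in>{-1<..<1}.
        (\<sigma> has_real_derivative \<rho> s) (at s) \<and>
        (\<rho> has_real_derivative
           ((norm (vector_derivative (\<lambda>r. vector_derivative \<eta> (at r)) (at s)))\<^sup>2 * \<sigma> s
             - (norm (vector_derivative v (at s)))\<^sup>2)) (at s))"

text \<open>
  Solutions on \<open>(-T,T)\<close>: \<open>\<eta>\<close> is a continuous curve in \<open>K\<^sup>m\<^sup>+\<^sup>1\<close> with values in \<open>arcs (m + 1)\<close> and a
  \<open>C\<^sup>1\<close> curve in \<open>K\<^sup>m\<close>, with velocity \<open>v\<close>; the wave equation holds pointwise on \<open>(-1,1)\<close>.
\<close>
definition whip_solution ::
    "nat \<Rightarrow> (real \<Rightarrow> real ^ 'n) \<Rightarrow> (real \<Rightarrow> real ^ 'n) \<Rightarrow> real \<Rightarrow> (real \<Rightarrow> real \<Rightarrow> real ^ 'n) \<Rightarrow> bool" where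
  "whip_solution m \<gamma> w T \<eta> \<longleftrightarrow>
     (\<exists>v \<sigma>. \<eta> 0 = \<gamma> \<and> v 0 = w \<and>
       (\<forall>t\<in>{-T<..<T}.
          \<eta> t \<in> arcs (m + 1) \<and> v t \<in> tangent m (\<eta> t) \<and>
          ((\<lambda>r. Knorm (m + 1) (\<eta> r - \<eta> t)) \<longlongrightarrow> 0) (at t) \<and>
          ((\<lambda>h. Knorm m (\<lambda>s. (\<eta> (t + h) s - \<eta> t s) /\<^sub>R h - v t s)) \<longlongrightarrow> 0) (at 0) \<and>
          ((\<lambda>r. Knorm m (v r - v t)) \<longlongrightarrow> 0) (at t) \<and>
          is_tension (\<eta> t) (v t) (\<sigma> t) \<and>
          (\<forall>s\<in>{-1<..<1}. \<exists>a.
             ((\<lambda>r. v r s) has_vector_derivative a) (at t) \<and>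
             ((\<lambda>r. \<sigma> t r *\<^sub>R vector_derivative (\<eta> t) (at r)) has_vector_derivative a) (at s))))"

definition reaches ::
    "nat \<Rightarrow> (real \<Rightarrow> real ^ 'n) \<Rightarrow> (real \<Rightarrow> real ^ 'n) \<Rightarrow> (real \<Rightarrow> real ^ 'n) \<Rightarrow> bool" where
  "reaches m \<gamma> w \<zeta> \<longleftrightarrow> (\<exists>T \<eta>. T > 1 \<and> whip_solution m \<gamma> w T \<eta> \<and> \<eta> 1 = \<zeta>)"

text \<open>
  The velocities at which \<open>exp\<^sub>\<gamma>\<close> is defined; solutions being unique, this is the set of all \<open>w\<close>
  whose solution exists on an open interval containing \<open>[-1,1]\<close>.
\<close>
definition exp_dom :: "nat \<Rightarrow> (real \<Rightarrow> real ^ 'n) \<Rightarrow> (real \<Rightarrow> real ^ 'n) set" where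
  "exp_dom m \<gamma> = {w \<in> tangent m \<gamma>. \<exists>!\<zeta>. reaches m \<gamma> w \<zeta>}"

definition reduced_exp :: "nat \<Rightarrow> (real \<Rightarrow> real ^ 'n) \<Rightarrow> (real \<Rightarrow> real ^ 'n) \<Rightarrow> (real \<Rightarrow> real ^ 'n)" where
  "reduced_exp m \<gamma> w = (THE \<zeta>. reaches m \<gamma> w \<zeta>)"

text \<open>
  The following notions concern a linear space \<open>V\<close> of curves with norm \<open>Knorm m\<close>; they are used for
  \<open>V = tangent m \<gamma>\<close>.
\<close>
definition open_in_K :: "nat \<Rightarrow> (real \<Rightarrow> real ^ 'n) set \<Rightarrow> (real \<Rightarrow> real ^ 'n) set \<Rightarrow> bool" where
  "open_in_K m V U \<longleftrightarrow>
     U \<subseteq> V \<and> (\<forall>x\<in>U. \<exists>\<delta>>0. \<forall>y\<in>V. Knorm m (y - x) < \<delta> \<longrightarrow> y \<in> U)"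

definition bounded_linear_K ::
    "nat \<Rightarrow> (real \<Rightarrow> real ^ 'n) set \<Rightarrow> ((real \<Rightarrow> real ^ 'n) \<Rightarrow> (real \<Rightarrow> real ^ 'n)) \<Rightarrow> bool" where
  "bounded_linear_K m V L \<longleftrightarrow>
     (\<forall>x\<in>V. L x \<in> Kspace m) \<and>
     (\<forall>x\<in>V. \<forall>y\<in>V. L (x + y) = L x + L y) \<and>
     (\<forall>c. \<forall>x\<in>V. L (\<lambda>s. c *\<^sub>R x s) = (\<lambda>s. c *\<^sub>R L x s)) \<and>
     (\<exists>C. \<forall>x\<in>V. Knorm m (L x) \<le> C * Knorm m x)"

definition frechet_deriv_K ::
    "nat \<Rightarrow> (real \<Rightarrow> real ^ 'n) set \<Rightarrow> (real \<Rightarrow> real ^ 'n) set \<Rightarrow>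
     ((real \<Rightarrow> real ^ 'n) \<Rightarrow> (real \<Rightarrow> real ^ 'n)) \<Rightarrow> (real \<Rightarrow> real ^ 'n) \<Rightarrow>
     ((real \<Rightarrow> real ^ 'n) \<Rightarrow> (real \<Rightarrow> real ^ 'n)) \<Rightarrow> bool" where
  "frechet_deriv_K m V U F x L \<longleftrightarrow>
     bounded_linear_K m V L \<and>
     (\<forall>\<epsilon>>0. \<exists>\<delta>>0. \<forall>h\<in>V. x + h \<in> U \<longrightarrow> Knorm m h < \<delta> \<longrightarrow>
        Knorm m (F (x + h) - F x - L h) \<le> \<epsilon> * Knorm m h)"

text \<open>
  Continuity of \<open>D\<close> is with respect to the operator norm. \<open>arcs m\<close> is a submanifold of \<open>K\<^sup>m\<close>, so a map
  into it is \<open>C\<^sup>1\<close> iff it is \<open>C\<^sup>1\<close> as a map into \<open>K\<^sup>m\<close>.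
\<close>
definition C1_on_K ::
    "nat \<Rightarrow> (real \<Rightarrow> real ^ 'n) set \<Rightarrow> (real \<Rightarrow> real ^ 'n) set \<Rightarrow>
     ((real \<Rightarrow> real ^ 'n) \<Rightarrow> (real \<Rightarrow> real ^ 'n)) \<Rightarrow> bool" where
  "C1_on_K m V U F \<longleftrightarrow>
     (\<exists>D. (\<forall>x\<in>U. frechet_deriv_K m V U F x (D x)) \<and>
       (\<forall>x\<in>U. \<forall>\<epsilon>>0. \<exists>\<delta>>0. \<forall>y\<in>U. Knorm m (y - x) < \<delta> \<longrightarrow>
          (\<forall>h\<in>V. Knorm m (D y h - D x h) \<le> \<epsilon> * Knorm m h)))"

end

theory Submission
  imports Defs
begin

text \<open>
  By definition of a solution, the exponential map \<open>F\<close> takes values in \<open>K\<^sup>m\<^sup>+\<^sup>1\<close>, whereas its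
  domain is open in the \<open>K\<^sup>m\<close> topology. If \<open>\<eta>\<close> is a solution then so is \<open>t \<mapsto> \<eta>(ct)\<close>, with initial
  velocity scaled by \<open>c\<close>; hence \<open>F(cw) = \<eta>(c)\<close>, and a derivative of \<open>F\<close> at \<open>0\<close> must be the identity.
  If \<open>F\<close> were \<open>C\<^sup>1\<close>, then \<open>F(x) - F(y)\<close> would be \<open>x - y\<close> up to a small multiple of \<open>\<parallel>x - y\<parallel>\<close> near \<open>0\<close>,
  so \<open>F\<close> could not smooth: a gliding hump along high-frequency tangent vectors produces a \<open>w\<close> with
  \<open>F(w) \<notin> K\<^sup>m\<^sup>+\<^sup>1\<close>. The tangent vectors are the odd primitives of \<open>\<phi> B\<gamma>'\<close> with \<open>\<phi>\<close> a trigonometric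
  series and \<open>B\<close> a constant antisymmetric matrix. Roughness is detected by functionals that
  pair the \<open>m\<close>-th derivative with a square wave; they are bounded on \<open>K\<^sup>m\<close> uniformly in the frequency,
  and decay on each fixed element of \<open>K\<^sup>m\<^sup>+\<^sup>1\<close>.
\<close>

subsection \<open>Weak derivatives on the open interval\<close>

text \<open>A rough tangent vector \<open>w\<close> alone proves nothing: \<open>F(w)\<close> agrees
  with \<open>\<gamma> + w\<close> only up to an error that is small relative to
  \<open>Knorm m w\<close>, and such an error can still cancel the roughness of \<open>w\<close>.
  Hence the coefficients are chosen adaptively. At each frequency, either the functional already
  responds to the image of the vector built so far, or it does so after one more hump is added,
  since the hump changes the response by more than the error; the later humps are together too small
  to undo this. The order of the choices matters. The ratio \<open>\<theta>\<close> of successive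
  humps depends only on bounds that are uniform in the frequency. The frequencies can therefore be
  fixed after \<open>\<theta>\<close>, so high that the decay of the functionals on a single element
  of the smoother space beats \<open>\<theta> ^ n\<close>. Testing with scalar functionals replaces
  differentiation between function spaces by that of real functions of one variable.\<close>

abbreviation unit_ival :: "real set" where
  "unit_ival \<equiv> {-1<..<1}"

lemma is_primitive_cong:
  assumes "is_primitive f g" "\<And>s. s \<in> unit_ival \<Longrightarrow> f s = f' s"
  shows "is_primitive f' g"
  using assms unfolding is_primitive_def by fastforce

lemma is_primitive_add:
  assumes "is_primitive f g" "is_primitive f' g'"
  shows "is_primitive (\<lambda>s. f s + f' s) (\<lambda>s. g s + g' s)"
  unfolding is_primitive_def
proof (intro allI impI conjI)
  fix a b :: real assume ab: "-1 < a" "a \<le> b" "b < 1"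
  show "(\<lambda>s. g s + g' s) absolutely_integrable_on {a..b}"
    using assms ab unfolding is_primitive_def by (intro set_integral_add) auto
  have "((\<lambda>s. g s + g' s) has_integral ((f b - f a) + (f' b - f' a))) {a..b}"
    using assms ab unfolding is_primitive_def by (intro has_integral_add) auto
  then show "((\<lambda>s. g s + g' s) has_integral (f b + f' b - (f a + f' a))) {a..b}"
    by (simp add: algebra_simps)
qed

lemma is_primitive_scaleR:
  assumes "is_primitive f g"
  shows "is_primitive (\<lambda>s. c *\<^sub>R f s) (\<lambda>s. c *\<^sub>R g s)"
  unfolding is_primitive_def
proof (intro allI impI conjI)
  fix a b :: real assume ab: "-1 < a" "a \<le> b" "b < 1"
  show "(\<lambda>s. c *\<^sub>R g s) absolutely_integrable_on {a..b}"
    using assms ab unfolding is_primitive_def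
    by (intro absolutely_integrable_scaleR_left) auto
  have "((\<lambda>s. c *\<^sub>R g s) has_integral (c *\<^sub>R (f b - f a))) {a..b}"
    using assms ab unfolding is_primitive_def by (intro has_integral_cmul) auto
  then show "((\<lambda>s. c *\<^sub>R g s) has_integral (c *\<^sub>R f b - c *\<^sub>R f a)) {a..b}"
    by (simp add: algebra_simps)
qed

lemma is_primitive_eq_integral:
  assumes "is_primitive f g" "-1 < a" "a \<le> x" "x < 1"
  shows "f x = f a + integral {a..x} g"
proof -
  have "(g has_integral f x - f a) {a..x}"
    using assms unfolding is_primitive_def by auto
  then show ?thesis
    by (simp add: integral_unique)
qed

lemma is_primitive_integrable:
  assumes "is_primitive f g" "-1 < a" "b < 1"
  shows "g integrable_on {a..b}"
  using assms unfolding is_primitive_def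
  by (cases "a \<le> b") (auto intro: has_integral_integrable)

lemma is_primitive_continuous:
  assumes "is_primitive f g"
  shows "continuous_on unit_ival f"
proof (rule continuous_at_imp_continuous_on, rule ballI)
  fix s :: real assume s: "s \<in> unit_ival"
  \<comment> \<open>Halfway from \<open>s\<close> to the endpoints: the primitive property speaks
    only of compact subintervals of the open interval, and \<open>s\<close> has to be interior to
    one.\<close>
  define a b where "a = (s - 1) / 2" and "b = (s + 1) / 2"
  have ab: "-1 < a" "a < s" "s < b" "b < 1"
    using s by (auto simp: a_def b_def field_simps)
  have "continuous_on {a..b} (\<lambda>x. f a + integral {a..x} g)"
    by (intro continuous_intros indefinite_integral_continuous_1
        is_primitive_integrable[OF assms]) (use ab in auto)
  then have "continuous_on {a..b} f"
    by (rule continuous_on_eq)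
       (use ab in \<open>auto intro!: is_primitive_eq_integral[OF assms, symmetric]\<close>)
  then show "isCont f s"
    using ab by (intro continuous_on_interior) (auto simp: interior_atLeastAtMost_real)
qed

lemma is_primitive_has_vector_derivative:
  assumes "is_primitive f g" "continuous_on unit_ival g" "s \<in> unit_ival"
  shows "(f has_vector_derivative g s) (at s)"
proof -
  define a b where "a = (s - 1) / 2" and "b = (s + 1) / 2"
  have ab: "-1 < a" "a < s" "s < b" "b < 1"
    using assms(3) by (auto simp: a_def b_def field_simps)
  have "continuous_on {a..b} g"
    by (rule continuous_on_subset[OF assms(2)]) (use ab in auto)
  then have "((\<lambda>x. integral {a..x} g) has_vector_derivative g s) (at s within {a..b})"
    using ab by (intro integral_has_vector_derivative) auto
  then have "((\<lambda>x. f a + integral {a..x} g) has_vector_derivative (0 + g s)) (at s within {a..b})"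
    by (intro has_vector_derivative_add has_vector_derivative_const)
  then have der: "((\<lambda>x. f a + integral {a..x} g) has_vector_derivative g s) (at s within {a..b})"
    by simp
  have eq: "f x = f a + integral {a..x} g" if "x \<in> {a..b}" for x
    by (rule is_primitive_eq_integral[OF assms(1)]) (use ab that in auto)
  have "s \<in> {a..b}"
    using ab by simp
  then have "(f has_vector_derivative g s) (at s within {a..b})"
    using eq der by (rule has_vector_derivative_transform)
  moreover have "at s within {a..b} = at s"
    using ab by (intro at_within_interior) (auto simp: interior_atLeastAtMost_real)
  ultimately show ?thesis
    by (simp only:)
qed

lemma is_primitiveI:
  assumes "\<And>s. s \<in> unit_ival \<Longrightarrow> (f has_vector_derivative g s) (at s)"
    and "continuous_on unit_ival g"
  shows "is_primitive f g"
  unfolding is_primitive_def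
proof (intro allI impI conjI)
  fix a b :: real assume ab: "-1 < a" "a \<le> b" "b < 1"
  have "continuous_on {a..b} g"
    by (rule continuous_on_subset[OF assms(2)]) (use ab in auto)
  then show "g absolutely_integrable_on {a..b}"
    by (rule absolutely_integrable_continuous_real)
  show "(g has_integral f b - f a) {a..b}"
    using ab assms(1)
    by (intro fundamental_theorem_of_calculus)
       (auto intro: has_vector_derivative_at_within)
qed

text \<open>Lebesgue differentiation: off a null set, \<open>g x\<close> is the limit of the
  averages of \<open>g\<close> over short intervals to the right of \<open>x\<close>, and all these
  averages vanish.\<close>

lemma negligible_if_integral_zero:
  fixes g :: "real \<Rightarrow> real ^ 'n"
  assumes g: "g integrable_on {a..b}"
    and zero: "\<And>c d. a < c \<Longrightarrow> c \<le> d \<Longrightarrow> d < b \<Longrightarrow> integral {c..d} g = 0"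
  shows "negligible {s \<in> {a<..<b}. g s \<noteq> 0}"
proof -
  define f where "f x = (if x \<in> {a..b} then g x else 0)" for x
  have "f integrable_on UNIV"
    using g unfolding f_def by (simp only: integrable_restrict_UNIV)
  then have f: "f integrable_on cbox c d" for c d
    by (rule integrable_on_subcbox) auto
  obtain N where N: "negligible N"
    "\<And>x e. x \<notin> N \<Longrightarrow> 0 < e \<Longrightarrow>
       \<exists>d>0. \<forall>h. 0 < h \<and> h < d \<longrightarrow>
          norm (integral (cbox x (x + h *\<^sub>R One)) f /\<^sub>R h ^ DIM(real) - f x) < e"
    using integrable_ccontinuous_explicit[of f, OF f] by metis
  have "g x = 0" if x: "x \<in> {a<..<b}" "x \<notin> N" for x
  proof (rule ccontr)
    assume "g x \<noteq> 0"
    then have "norm (f x) > 0"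
      using x by (auto simp: f_def)
    then obtain d where d: "d > 0" "\<And>h. 0 < h \<Longrightarrow> h < d \<Longrightarrow>
        norm (integral {x..x+h} f /\<^sub>R h - f x) < norm (f x)"
      using N(2)[OF x(2), of "norm (f x)"] by (auto simp: cbox_interval)
    define h where "h = min d (b - x) / 2"
    have h: "0 < h" "h < d" "x + h < b"
      using x d(1) by (auto simp: h_def min_def field_simps)
    have "integral {x..x+h} f = integral {x..x+h} g"
      by (rule integral_cong) (use x h in \<open>auto simp: f_def\<close>)
    also have "\<dots> = 0"
      using zero x h by auto
    finally show False
      using d(2)[OF h(1,2)] by simp
  qed
  then have "{s \<in> {a<..<b}. g s \<noteq> 0} \<subseteq> N"
    by auto
  then show ?thesis
    using N(1) negligible_subset by blast
qed

text \<open>Weak derivatives are integrable only on compact subintervals. A countable exhaustion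
  carries null sets and measurability over to the whole open interval.\<close>

lemma unit_ival_exhaust:
  "unit_ival = (\<Union>n. {- 1 + 1 / real (Suc n) <..< 1 - 1 / real (Suc n)})"
proof (intro equalityI subsetI)
  fix x :: real assume x: "x \<in> unit_ival"
  then obtain n where "inverse (real (Suc n)) < min (1 - x) (1 + x)"
    using reals_Archimedean[of "min (1 - x) (1 + x)"] by auto
  then have "x \<in> {- 1 + 1 / real (Suc n) <..< 1 - 1 / real (Suc n)}"
    by (auto simp: inverse_eq_divide)
  then show "x \<in> (\<Union>n. {- 1 + 1 / real (Suc n) <..< 1 - 1 / real (Suc n)})"
    by blast
next
  fix x :: real assume "x \<in> (\<Union>n. {- 1 + 1 / real (Suc n) <..< 1 - 1 / real (Suc n)})"
  then obtain n where "- 1 + 1 / real (Suc n) < x" "x < 1 - 1 / real (Suc n)"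
    by auto
  moreover have "1 / real (Suc n) > 0"
    by simp
  ultimately show "x \<in> unit_ival"
    unfolding greaterThanLessThan_iff by linarith
qed

text \<open>On each interval of the exhaustion the difference of the two derivatives has zero
  integral over every subinterval, so it vanishes almost everywhere there.\<close>

lemma is_primitive_unique:
  fixes f :: "real \<Rightarrow> real ^ 'n"
  assumes "is_primitive f g" "is_primitive f g'"
  shows "negligible {s \<in> unit_ival. g s \<noteq> g' s}"
proof -
  define a where "a n = - 1 + 1 / real (Suc n)" for n
  define b where "b n = 1 - 1 / real (Suc n)" for n
  have ab: "- 1 < a n" "b n < 1" for n
    by (auto simp: a_def b_def)
  have "negligible {s \<in> {a n <..< b n}. g s - g' s \<noteq> 0}" for n
  proof (rule negligible_if_integral_zero)
    show "(\<lambda>s. g s - g' s) integrable_on {a n..b n}"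
      using assms ab by (intro integrable_diff is_primitive_integrable)
    fix c d assume "a n < c" "c \<le> d" "d < b n"
    then have cd: "- 1 < c" "c \<le> d" "d < 1"
      using ab[of n] by auto
    have "((\<lambda>s. g s - g' s) has_integral ((f d - f c) - (f d - f c))) {c..d}"
      using assms cd unfolding is_primitive_def by (intro has_integral_diff) auto
    then show "integral {c..d} (\<lambda>s. g s - g' s) = 0"
      by (simp add: integral_unique)
  qed
  then have "negligible (\<Union>n. {s \<in> {a n <..< b n}. g s - g' s \<noteq> 0})"
    by (rule negligible_Union_nat)
  moreover have "{s \<in> unit_ival. g s \<noteq> g' s} = (\<Union>n. {s \<in> {a n <..< b n}. g s - g' s \<noteq> 0})"
    unfolding a_def b_def by (subst unit_ival_exhaust) auto
  ultimately show ?thesis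
    by simp
qed

text \<open>\<open>g\<close> need not be integrable up to the endpoints, so it is obtained as the
  pointwise limit of its truncations to compact subintervals.\<close>

lemma is_primitive_measurable:
  fixes f :: "real \<Rightarrow> real ^ 'n"
  assumes "is_primitive f g"
  shows "(\<lambda>s. if s \<in> unit_ival then g s else 0) \<in> borel_measurable lebesgue"
proof -
  define a where "a n = - 1 + 1 / real (Suc n)" for n
  define b where "b n = 1 - 1 / real (Suc n)" for n
  have ab: "- 1 < a n" "b n < 1" for n
    by (auto simp: a_def b_def)
  have "(\<lambda>s. if s \<in> {a n..b n} then g s else 0) \<in> borel_measurable lebesgue" for n
  proof (cases "a n \<le> b n")
    case True
    then have "g absolutely_integrable_on {a n..b n}"
      using assms ab unfolding is_primitive_def by auto
    then have "g \<in> borel_measurable (lebesgue_on {a n..b n})"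
      by (intro absolutely_integrable_imp_borel_measurable) auto
    then show ?thesis
      by (subst borel_measurable_if) auto
  qed auto
  then show ?thesis
  proof (rule borel_measurable_LIMSEQ_metric)
    fix s :: real
    show "(\<lambda>n. if s \<in> {a n..b n} then g s else 0)
        \<longlonglongrightarrow> (if s \<in> unit_ival then g s else 0)"
    proof (cases "s \<in> unit_ival")
      case True
      then have pos: "min (1 - s) (1 + s) > 0"
        by auto
      have "eventually (\<lambda>n. 1 / real (Suc n) < min (1 - s) (1 + s)) sequentially"
        using order_tendstoD(2)[OF LIMSEQ_inverse_real_of_nat pos]
        by (simp add: inverse_eq_divide)
      then have "eventually (\<lambda>n. (if s \<in> {a n..b n} then g s else 0) = g s) sequentially"
        by eventually_elim (auto simp: a_def b_def)
      with True show ?thesis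
        by (simp add: tendsto_eventually)
    next
      case False
      then have "s \<notin> {a n..b n}" for n
        using ab[of n] by auto
      then have "(\<lambda>n. if s \<in> {a n..b n} then g s else 0) = (\<lambda>n. 0)"
        by (simp only: if_False)
      with False show ?thesis
        by (simp only: if_False tendsto_const)
    qed
  qed
qed

section \<open>Linearity of weak derivatives and their relation to classical ones\<close>

lemma has_weak_deriv_add:
  assumes "has_weak_deriv k f g" "has_weak_deriv k f' g'"
  shows "has_weak_deriv k (\<lambda>s. f s + f' s) (\<lambda>s. g s + g' s)"
  using assms
proof (induction k arbitrary: g g')
  case (Suc k)
  then obtain h h' where "has_weak_deriv k f h" "is_primitive h g"
    "has_weak_deriv k f' h'" "is_primitive h' g'"
    by auto
  then have "has_weak_deriv k (\<lambda>s. f s + f' s) (\<lambda>s. h s + h' s)"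
    "is_primitive (\<lambda>s. h s + h' s) (\<lambda>s. g s + g' s)"
    by (auto intro: Suc.IH is_primitive_add)
  then show ?case
    by auto
qed auto

lemma has_weak_deriv_scaleR:
  assumes "has_weak_deriv k f g"
  shows "has_weak_deriv k (\<lambda>s. c *\<^sub>R f s) (\<lambda>s. c *\<^sub>R g s)"
  using assms
proof (induction k arbitrary: g)
  case (Suc k)
  then obtain h where "has_weak_deriv k f h" "is_primitive h g"
    by auto
  then have "has_weak_deriv k (\<lambda>s. c *\<^sub>R f s) (\<lambda>s. c *\<^sub>R h s)"
    "is_primitive (\<lambda>s. c *\<^sub>R h s) (\<lambda>s. c *\<^sub>R g s)"
    by (auto intro: Suc.IH is_primitive_scaleR)
  then show ?case
    by auto
qed auto

text \<open>Unlike \<open>weak_deriv\<close>, which is determined only up to null sets, this has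
  meaningful values at single points. It is used for orders at which the derivative is known to
  exist on \<open>unit_ival\<close>.\<close>

definition cderiv :: "nat \<Rightarrow> (real \<Rightarrow> real ^ 'n) \<Rightarrow> real \<Rightarrow> real ^ 'n" where
  "cderiv k f = ((\<lambda>h s. vector_derivative h (at s)) ^^ k) f"

lemma cderiv_0 [simp]: "cderiv 0 f = f"
  by (simp add: cderiv_def)

lemma cderiv_Suc: "cderiv (Suc k) f s = vector_derivative (cderiv k f) (at s)"
  by (simp add: cderiv_def)

text \<open>Every weak derivative below the top order is itself a primitive, hence continuous, hence
  a classical derivative of the preceding one. Only the top order remains weak.\<close>

lemma has_weak_deriv_SucD:
  assumes "has_weak_deriv (Suc k) f g"
  shows "is_primitive (cderiv k f) g"
    and "i < k \<Longrightarrow> s \<in> unit_ival \<Longrightarrow> (cderiv i f has_vector_derivative cderiv (Suc i) f s) (at s)"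
proof -
  have "is_primitive (cderiv k f) g \<and>
    (\<forall>i<k. \<forall>s\<in>unit_ival. (cderiv i f has_vector_derivative cderiv (Suc i) f s) (at s))"
    using assms
  proof (induction k arbitrary: g)
    case 0
    then show ?case
      by (auto intro: is_primitive_cong)
  next
    case (Suc k)
    then obtain h where h: "has_weak_deriv (Suc k) f h" "is_primitive h g"
      by auto
    have deriv: "(cderiv k f has_vector_derivative h s) (at s)" if "s \<in> unit_ival" for s
      using Suc.IH[OF h(1)] is_primitive_continuous[OF h(2)] that
      by (auto intro: is_primitive_has_vector_derivative)
    then have eq: "cderiv (Suc k) f s = h s" if "s \<in> unit_ival" for s
      using that by (simp add: cderiv_Suc vector_derivative_at)
    have "is_primitive (cderiv (Suc k) f) g"
      using h(2) by (rule is_primitive_cong) (simp add: eq)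
    then show ?case
      using Suc.IH[OF h(1)] deriv eq by (auto simp: less_Suc_eq)
  qed
  then show "is_primitive (cderiv k f) g"
    and "i < k \<Longrightarrow> s \<in> unit_ival \<Longrightarrow> (cderiv i f has_vector_derivative cderiv (Suc i) f s) (at s)"
    by auto
qed

text \<open>The converse direction: a chain of explicit formulas, each the classical derivative of
  the one before, yields a weak derivative. With \<open>cderiv_chain\<close> it serves to compute
  derivatives of concrete curves.\<close>

lemma has_weak_deriv_chain:
  assumes "\<And>s. s \<in> unit_ival \<Longrightarrow> u 0 s = f s"
    and "\<And>i s. i < k \<Longrightarrow> s \<in> unit_ival \<Longrightarrow> (u i has_vector_derivative u (Suc i) s) (at s)"
    and "continuous_on unit_ival (u k)"
  shows "has_weak_deriv k f (u k)"
  using assms(2,3)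
proof (induction k)
  case 0
  then show ?case
    using assms(1) by simp
next
  case (Suc k)
  have "continuous_on unit_ival (u k)"
    using Suc.prems(1)[of k]
    by (intro continuous_at_imp_continuous_on ballI has_vector_derivative_continuous) auto
  then have "has_weak_deriv k f (u k)"
    using Suc by auto
  moreover have "is_primitive (u k) (u (Suc k))"
    using Suc.prems by (intro is_primitiveI) auto
  ultimately show ?case
    by auto
qed

lemma cderiv_chain:
  assumes "\<And>s. s \<in> unit_ival \<Longrightarrow> u 0 s = f s"
    and "\<And>i s. i < k \<Longrightarrow> s \<in> unit_ival \<Longrightarrow> (u i has_vector_derivative u (Suc i) s) (at s)"
    and "s \<in> unit_ival"
  shows "cderiv k f s = u k s"
  using assms(2,3)
proof (induction k arbitrary: s)
  case 0
  then show ?case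
    using assms(1) by simp
next
  case (Suc k)
  have "(cderiv k f has_vector_derivative u (Suc k) s) (at s)"
    by (rule has_vector_derivative_transform_within_open[where S = unit_ival and f = "u k"])
       (use Suc in auto)
  then show ?case
    by (simp add: cderiv_Suc vector_derivative_at)
qed

lemma has_weak_deriv_weak_deriv:
  "has_weak_deriv k f g \<Longrightarrow> has_weak_deriv k f (weak_deriv k f)"
  unfolding weak_deriv_def by (rule someI[of "has_weak_deriv k f"])

text \<open>Norms are defined through the chosen \<open>weak_deriv\<close>; by this lemma any
  explicit weak derivative may take its place under an integral.\<close>

lemma weak_deriv_ae_eq:
  assumes "has_weak_deriv k f g"
  shows "negligible {s \<in> unit_ival. weak_deriv k f s \<noteq> g s}"
proof -
  have w: "has_weak_deriv k f (weak_deriv k f)"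
    using assms by (rule has_weak_deriv_weak_deriv)
  show ?thesis
  proof (cases k)
    case 0
    then have "{s \<in> unit_ival. weak_deriv k f s \<noteq> g s} = {}"
      using w assms by auto
    then show ?thesis
      by (metis negligible_empty)
  next
    case (Suc l)
    show ?thesis
      using w assms unfolding Suc
      by (intro is_primitive_unique[of "cderiv l f"] has_weak_deriv_SucD) auto
  qed
qed

lemma has_weak_deriv_measurable:
  fixes f :: "real \<Rightarrow> real ^ 'n"
  assumes "has_weak_deriv k f g" "continuous_on {-1..1} f"
  shows "(\<lambda>s. if s \<in> unit_ival then g s else 0) \<in> borel_measurable lebesgue"
proof (cases k)
  case 0
  have "continuous_on unit_ival g"
    by (rule continuous_on_eq[OF continuous_on_subset[OF assms(2)]])
       (use assms(1) 0 in auto)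
  then have "g \<in> borel_measurable (lebesgue_on unit_ival)"
    by (intro continuous_imp_measurable_on_sets_lebesgue) auto
  then show ?thesis
    by (subst borel_measurable_if) auto
next
  case (Suc l)
  then show ?thesis
    using assms(1) has_weak_deriv_SucD(1) is_primitive_measurable by blast
qed

subsection \<open>The weighted spaces\<close>

lemma integrable_mult_real:
  fixes f :: "real \<Rightarrow> real"
  assumes "f integrable_on S"
  shows "(\<lambda>x. c * f x) integrable_on S"
  using integrable_cmul[OF assms, of c] by simp

lemma wdensity_nonneg: "0 \<le> wdensity j k f s" if "s \<in> {-1..1}"
  using that by (auto simp: wdensity_def abs_square_le_1 abs_le_iff)

lemma wdensity_ae_eq:
  fixes f :: "real \<Rightarrow> real ^ 'n"
  assumes "has_weak_deriv k f g"
  obtains N where "negligible N"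
    "\<And>s. s \<in> {-1..1} - N \<Longrightarrow> s \<in> unit_ival"
    "\<And>s. s \<in> {-1..1} - N \<Longrightarrow> (1 - s\<^sup>2) ^ j * (norm (g s))\<^sup>2 = wdensity j k f s"
proof
  show "negligible ({s \<in> unit_ival. weak_deriv k f s \<noteq> g s} \<union> {-1, 1})"
    using weak_deriv_ae_eq[OF assms] by simp
qed (auto simp: wdensity_def)

lemma wnorm_sq_eq:
  fixes f :: "real \<Rightarrow> real ^ 'n"
  assumes "has_weak_deriv k f g"
  shows "wnorm_sq j k f = integral {-1..1} (\<lambda>s. (1 - s\<^sup>2) ^ j * (norm (g s))\<^sup>2)"
proof -
  obtain N where N: "negligible N"
    "\<And>s. s \<in> {-1..1} - N \<Longrightarrow> (1 - s\<^sup>2) ^ j * (norm (g s))\<^sup>2 = wdensity j k f s"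
    using wdensity_ae_eq[OF assms] by metis
  then show ?thesis
    unfolding wnorm_sq_def by (intro integral_spike[of N]) auto
qed

text \<open>Measurability comes for free, since \<open>g\<close> is either continuous or the
  derivative of a primitive. Only a pointwise integrable bound is left to check.\<close>

lemma wdensity_integrableI:
  fixes f :: "real \<Rightarrow> real ^ 'n"
  assumes "has_weak_deriv k f g" "continuous_on {-1..1} f" "G integrable_on {-1..1}"
    and "\<And>s. s \<in> unit_ival \<Longrightarrow> (1 - s\<^sup>2) ^ j * (norm (g s))\<^sup>2 \<le> G s"
  shows "wdensity j k f integrable_on {-1..1}"
proof -
  define g' where "g' s = (if s \<in> unit_ival then g s else 0)" for s
  obtain N where N: "negligible N"
    "\<And>s. s \<in> {-1..1} - N \<Longrightarrow> s \<in> unit_ival"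
    "\<And>s. s \<in> {-1..1} - N \<Longrightarrow> (1 - s\<^sup>2) ^ j * (norm (g s))\<^sup>2 = wdensity j k f s"
    using wdensity_ae_eq[OF assms(1)] by metis
  have [measurable]: "g' \<in> borel_measurable lebesgue"
    using has_weak_deriv_measurable[OF assms(1,2)] unfolding g'_def .
  have [measurable]: "(\<lambda>s. (1 - s\<^sup>2) ^ j) \<in> borel_measurable (lebesgue :: real measure)"
    by (rule measurable_completion) measurable
  have "(\<lambda>s. (1 - s\<^sup>2) ^ j * (norm (g' s))\<^sup>2) \<in> borel_measurable lebesgue"
    by measurable
  then have meas: "(\<lambda>s. (1 - s\<^sup>2) ^ j * (norm (g' s))\<^sup>2) \<in> borel_measurable (lebesgue_on {-1..1})"
    by (rule measurable_restrict_space1)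
  \<comment> \<open>No bound is assumed at the endpoints, so the majorant is set to 0 there, as
    \<open>g'\<close> is.\<close>
  have int: "(\<lambda>s. if s \<in> unit_ival then G s else 0) integrable_on {-1..1}"
    by (rule integrable_spike[OF assms(3), of "{-1, 1}"]) auto
  have "(\<lambda>s. (1 - s\<^sup>2) ^ j * (norm (g' s))\<^sup>2) integrable_on {-1..1}"
  proof (rule measurable_bounded_by_integrable_imp_integrable[OF meas int])
    fix s :: real assume s: "s \<in> {-1..1}"
    then have "0 \<le> (1 - s\<^sup>2) ^ j"
      by (auto simp: abs_square_le_1 abs_le_iff)
    then show "norm ((1 - s\<^sup>2) ^ j * (norm (g' s))\<^sup>2) \<le> (if s \<in> unit_ival then G s else 0)"
      using assms(4)[of s] by (auto simp: g'_def abs_mult)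
  qed auto
  then show ?thesis
    by (rule integrable_spike[OF _ N(1)]) (use N in \<open>auto simp: g'_def\<close>)
qed

section \<open>Linear structure and norm of the weighted spaces\<close>

lemma KspaceD:
  assumes "f \<in> Kspace m"
  shows "s \<notin> {-1..1} \<Longrightarrow> f s = 0" "continuous_on {-1..1} f" "f (- s) = - f s"
    and "j \<le> m \<Longrightarrow> has_weak_deriv j f (weak_deriv j f)"
    and "j \<le> m \<Longrightarrow> wdensity j j f integrable_on {-1..1}"
  using assms has_weak_deriv_weak_deriv unfolding Kspace_def by blast+

lemma Kspace_mono: "m \<le> m' \<Longrightarrow> Kspace m' \<subseteq> Kspace m"
  unfolding Kspace_def by auto

lemma Kspace_add:
  fixes f g :: "real \<Rightarrow> real ^ 'n"
  assumes f: "f \<in> Kspace m" and g: "g \<in> Kspace m"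
  shows "(\<lambda>s. f s + g s) \<in> Kspace m"
  unfolding Kspace_def
proof (intro CollectI conjI allI impI)
  show "s \<notin> {-1..1} \<Longrightarrow> f s + g s = 0" for s
    using KspaceD(1)[OF f] KspaceD(1)[OF g] by simp
  show cont: "continuous_on {-1..1} (\<lambda>s. f s + g s)"
    using KspaceD(2)[OF f] KspaceD(2)[OF g] by (rule continuous_on_add)
  show "f (- s) + g (- s) = - (f s + g s)" for s
    using KspaceD(3)[OF f] KspaceD(3)[OF g] by simp
  fix j assume j: "j \<le> m"
  let ?u = "weak_deriv j f" and ?v = "weak_deriv j g"
  have w: "has_weak_deriv j (\<lambda>s. f s + g s) (\<lambda>s. ?u s + ?v s)"
    using KspaceD(4)[OF f j] KspaceD(4)[OF g j] by (rule has_weak_deriv_add)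
  then show "\<exists>h. has_weak_deriv j (\<lambda>s. f s + g s) h"
    by blast
  show "wdensity j j (\<lambda>s. f s + g s) integrable_on {-1..1}"
  proof (rule wdensity_integrableI[OF w cont])
    show "(\<lambda>s. 2 * wdensity j j f s + 2 * wdensity j j g s) integrable_on {-1..1}"
      using KspaceD(5)[OF f j] KspaceD(5)[OF g j]
      by (intro integrable_add integrable_mult_real)
    fix s :: real assume s: "s \<in> unit_ival"
    then have pos: "0 \<le> (1 - s\<^sup>2) ^ j"
      by (auto simp: abs_square_le_1 abs_le_iff)
    have "(norm (?u s + ?v s))\<^sup>2 \<le> (norm (?u s) + norm (?v s))\<^sup>2"
      by (intro power_mono norm_triangle_ineq) auto
    also have "\<dots> \<le> 2 * (norm (?u s))\<^sup>2 + 2 * (norm (?v s))\<^sup>2"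
      using sum_squares_bound[of "norm (?u s)" "norm (?v s)"] by (simp add: power2_sum)
    finally show "(1 - s\<^sup>2) ^ j * (norm (?u s + ?v s))\<^sup>2
        \<le> 2 * wdensity j j f s + 2 * wdensity j j g s"
      using mult_left_mono[OF _ pos] by (fastforce simp: wdensity_def algebra_simps)
  qed
qed

lemma wdensity_scaleR:
  fixes f :: "real \<Rightarrow> real ^ 'n"
  assumes "has_weak_deriv k f g"
  obtains N where "negligible N"
    "\<And>s. s \<in> {-1..1} - N \<Longrightarrow> wdensity j k (\<lambda>s. c *\<^sub>R f s) s = c\<^sup>2 * wdensity j k f s"
proof -
  have w: "has_weak_deriv k f (weak_deriv k f)"
    using assms by (rule has_weak_deriv_weak_deriv)
  obtain N where N: "negligible N"
    "\<And>s. s \<in> {-1..1} - N \<Longrightarrow>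
      (1 - s\<^sup>2) ^ j * (norm (c *\<^sub>R weak_deriv k f s))\<^sup>2 = wdensity j k (\<lambda>s. c *\<^sub>R f s) s"
    using wdensity_ae_eq[OF has_weak_deriv_scaleR[OF w]] by metis
  show ?thesis
    by (rule that[OF N(1)], subst N(2)[symmetric])
       (simp_all add: wdensity_def power_mult_distrib)
qed

lemma Kspace_scaleR:
  fixes f :: "real \<Rightarrow> real ^ 'n"
  assumes f: "f \<in> Kspace m"
  shows "(\<lambda>s. c *\<^sub>R f s) \<in> Kspace m"
  unfolding Kspace_def
proof (intro CollectI conjI allI impI)
  show "s \<notin> {-1..1} \<Longrightarrow> c *\<^sub>R f s = 0" for s
    using KspaceD(1)[OF f] by simp
  show cont: "continuous_on {-1..1} (\<lambda>s. c *\<^sub>R f s)"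
    using KspaceD(2)[OF f] by (intro continuous_intros)
  show "c *\<^sub>R f (- s) = - (c *\<^sub>R f s)" for s
    using KspaceD(3)[OF f] by simp
  fix j assume j: "j \<le> m"
  show "\<exists>h. has_weak_deriv j (\<lambda>s. c *\<^sub>R f s) h"
    using has_weak_deriv_scaleR[OF KspaceD(4)[OF f j]] by blast
  obtain N where N: "negligible N"
    "\<And>s. s \<in> {-1..1} - N \<Longrightarrow> wdensity j j (\<lambda>s. c *\<^sub>R f s) s = c\<^sup>2 * wdensity j j f s"
    using wdensity_scaleR[OF KspaceD(4)[OF f j]] by metis
  show "wdensity j j (\<lambda>s. c *\<^sub>R f s) integrable_on {-1..1}"
    by (rule integrable_spike[OF integrable_mult_real[OF KspaceD(5)[OF f j]] N])
qed

lemma Kspace_diff: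
  fixes f g :: "real \<Rightarrow> real ^ 'n"
  assumes "f \<in> Kspace m" "g \<in> Kspace m"
  shows "(\<lambda>s. f s - g s) \<in> Kspace m"
  using Kspace_add[OF assms(1) Kspace_scaleR[OF assms(2), of "-1"]] by simp

lemma Knorm_scaleR:
  fixes f :: "real \<Rightarrow> real ^ 'n"
  assumes f: "f \<in> Kspace m"
  shows "Knorm m (\<lambda>s. c *\<^sub>R f s) = \<bar>c\<bar> * Knorm m f"
proof -
  have "wnorm_sq j j (\<lambda>s. c *\<^sub>R f s) = c\<^sup>2 * wnorm_sq j j f" if j: "j \<le> m" for j
  proof -
    obtain N where N: "negligible N"
      "\<And>s. s \<in> {-1..1} - N \<Longrightarrow> wdensity j j (\<lambda>s. c *\<^sub>R f s) s = c\<^sup>2 * wdensity j j f s"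
      using wdensity_scaleR[OF KspaceD(4)[OF f j]] by metis
    have "wnorm_sq j j (\<lambda>s. c *\<^sub>R f s) = integral {-1..1} (\<lambda>s. c\<^sup>2 * wdensity j j f s)"
      unfolding wnorm_sq_def by (rule integral_spike[OF N(1), symmetric]) (use N in auto)
    then show ?thesis
      by (simp add: wnorm_sq_def)
  qed
  then have "(\<Sum>j\<le>m. wnorm_sq j j (\<lambda>s. c *\<^sub>R f s)) = c\<^sup>2 * (\<Sum>j\<le>m. wnorm_sq j j f)"
    by (simp add: sum_distrib_left)
  then show ?thesis
    by (simp add: Knorm_def real_sqrt_mult)
qed

text \<open>Holds for every \<open>f\<close>, because the integral of a non-integrable function is 0
  by default.\<close>

lemma wnorm_sq_nonneg: "0 \<le> wnorm_sq j k f"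
  unfolding wnorm_sq_def
  by (cases "wdensity j k f integrable_on {-1..1}")
     (auto intro!: integral_nonneg wdensity_nonneg simp: not_integrable_integral)

lemma Knorm_nonneg: "0 \<le> Knorm m f"
  by (simp add: Knorm_def sum_nonneg wnorm_sq_nonneg)

lemma wnorm_sq_le_Knorm:
  assumes "j \<le> m"
  shows "wnorm_sq j j f \<le> (Knorm m f)\<^sup>2"
proof -
  have "wnorm_sq j j f \<le> (\<Sum>j\<le>m. wnorm_sq j j f)"
    using assms by (intro member_le_sum wnorm_sq_nonneg) auto
  then show ?thesis
    by (simp add: Knorm_def sum_nonneg wnorm_sq_nonneg)
qed

subsection \<open>Square-wave functionals\<close>

lemma Kspace_cderiv:
  assumes "f \<in> Kspace (Suc k)"
  shows "i < k \<Longrightarrow> s \<in> unit_ival \<Longrightarrow> (cderiv i f has_vector_derivative cderiv (Suc i) f s) (at s)"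
    and "is_primitive (cderiv k f) (weak_deriv (Suc k) f)"
  using has_weak_deriv_SucD KspaceD(4)[OF assms order_refl] by blast+

lemma cderiv_add:
  assumes f: "f \<in> Kspace (Suc k)" and g: "g \<in> Kspace (Suc k)" and "s \<in> unit_ival"
  shows "cderiv k (\<lambda>s. f s + g s) s = cderiv k f s + cderiv k g s"
  by (rule cderiv_chain[where u = "\<lambda>i s. cderiv i f s + cderiv i g s"])
     (use assms in \<open>auto intro!: has_vector_derivative_add Kspace_cderiv\<close>)

lemma cderiv_scaleR:
  assumes f: "f \<in> Kspace (Suc k)" and "s \<in> unit_ival"
  shows "cderiv k (\<lambda>s. c *\<^sub>R f s) s = c *\<^sub>R cderiv k f s"
  by (rule cderiv_chain[where u = "\<lambda>i s. c *\<^sub>R cderiv i f s"])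
     (use assms in \<open>auto intro!: bounded_linear.has_vector_derivative[OF bounded_linear_scaleR_right] Kspace_cderiv\<close>)

lemma Kspace_has_vector_derivative:
  assumes "f \<in> Kspace (Suc (Suc k))" "s \<in> unit_ival"
  shows "(f has_vector_derivative vector_derivative f (at s)) (at s)"
  using Kspace_cderiv(1)[OF assms(1), of 0 s] assms(2) by (simp add: cderiv_Suc)

text \<open>Young's inequality in place of Cauchy--Schwarz: the free parameter \<open>l\<close> is optimised in the
  applications.\<close>
lemma cderiv_increment_le:
  fixes f :: "real \<Rightarrow> real ^ 'n"
  assumes f: "f \<in> Kspace (Suc k)" and ab: "0 \<le> a" "a \<le> b" "b \<le> q" "q < 1" and l: "l > 0"
  defines "Y \<equiv> \<lambda>s. l / 2 + 1 / (2 * l * (1 - q\<^sup>2) ^ Suc k) * wdensity (Suc k) (Suc k) f s"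
  shows "Y integrable_on {a..b}"
    and "norm (cderiv k f b - cderiv k f a) \<le> integral {a..b} Y"
    and "integral {a..b} Y \<le> l * (b - a) / 2
          + wnorm_sq (Suc k) (Suc k) f / (2 * l * (1 - q\<^sup>2) ^ Suc k)"
proof -
  let ?g = "weak_deriv (Suc k) f" and ?D = "wdensity (Suc k) (Suc k) f"
  define w where "w = (1 - q\<^sup>2) ^ Suc k"
  have "q\<^sup>2 < 1"
    using ab by (simp add: abs_square_less_1)
  then have w: "w > 0"
    by (simp add: w_def del: power_Suc)
  have D: "?D integrable_on {-1..1}"
    by (rule KspaceD(5)[OF f order_refl])
  then have Dab: "?D integrable_on {a..b}"
    by (rule integrable_on_subinterval) (use ab in auto)
  then show Y: "Y integrable_on {a..b}"
    unfolding Y_def by (intro integrable_add integrable_mult_real) auto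
  have prim: "(?g has_integral (cderiv k f b - cderiv k f a)) {a..b}"
    using Kspace_cderiv(2)[OF f] ab unfolding is_primitive_def by auto
  have "norm (integral {a..b} ?g) \<le> integral {a..b} Y"
  proof (rule integral_norm_bound_integral[OF _ Y])
    show "?g integrable_on {a..b}"
      using prim by blast
    \<comment> \<open>The weight decreases on \<open>{0..<1}\<close>, so its value at
      \<open>q\<close> bounds it from below on the whole interval. For this reason the grids lie in
      \<open>{0..q}\<close>.\<close>
    fix s assume s: "s \<in> {a..b}"
    have "s\<^sup>2 \<le> q\<^sup>2"
      using s ab by (intro power_mono) auto
    then have "w \<le> (1 - s\<^sup>2) ^ Suc k"
      unfolding w_def using \<open>q\<^sup>2 < 1\<close> by (intro power_mono) auto
    then have "w * (norm (?g s))\<^sup>2 \<le> ?D s"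
      unfolding wdensity_def by (intro mult_right_mono) auto
    then have le: "(norm (?g s))\<^sup>2 \<le> ?D s / w"
      using w by (simp add: field_simps)
    have "2 * l * norm (?g s) \<le> l\<^sup>2 + (norm (?g s))\<^sup>2"
      using sum_squares_bound[of l "norm (?g s)"] by simp
    also have "\<dots> \<le> l\<^sup>2 + ?D s / w"
      using le by simp
    finally have "norm (?g s) \<le> (l\<^sup>2 + ?D s / w) / (2 * l)"
      using l by (simp add: field_simps)
    also have "\<dots> = Y s"
      using l w unfolding Y_def w_def[symmetric] by (simp add: field_simps power2_eq_square)
    finally show "norm (?g s) \<le> Y s" .
  qed
  then show "norm (cderiv k f b - cderiv k f a) \<le> integral {a..b} Y"
    using prim by (simp add: integral_unique)
  have "integral {a..b} ?D \<le> wnorm_sq (Suc k) (Suc k) f"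
    unfolding wnorm_sq_def
    by (rule integral_subset_le[OF _ Dab D]) (use ab in \<open>auto intro!: wdensity_nonneg\<close>)
  then have le: "1 / (2 * l * w) * integral {a..b} ?D \<le> 1 / (2 * l * w) * wnorm_sq (Suc k) (Suc k) f"
    using l w by (intro mult_left_mono) auto
  have "integral {a..b} Y = integral {a..b} (\<lambda>s. l / 2)
      + integral {a..b} (\<lambda>s. 1 / (2 * l * w) * ?D s)"
    unfolding Y_def w_def[symmetric] using Dab
    by (intro integral_add integrable_mult_real) auto
  also have "\<dots> = l * (b - a) / 2 + 1 / (2 * l * w) * integral {a..b} ?D"
    using ab by simp
  also have "\<dots> \<le> l * (b - a) / 2 + wnorm_sq (Suc k) (Suc k) f / (2 * l * w)"
    using le by simp
  finally show "integral {a..b} Y \<le> l * (b - a) / 2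
          + wnorm_sq (Suc k) (Suc k) f / (2 * l * (1 - q\<^sup>2) ^ Suc k)"
    unfolding w_def .
qed

text \<open>Up to normalisation, the pairing of the \<open>(k+1)\<close>-st derivative with a square wave of period \<open>2h\<close>.\<close>
definition osc :: "nat \<Rightarrow> 'n \<Rightarrow> real \<Rightarrow> real \<Rightarrow> nat \<Rightarrow> (real \<Rightarrow> real ^ 'n) \<Rightarrow> real" where
  "osc k i p h J f =
     (\<Sum>j<2 * J. (- 1) ^ j * ((cderiv k f (p + real (Suc j) * h) - cderiv k f (p + real j * h)) $ i))"

lemma grid_in_unit_ival:
  assumes "0 \<le> p" "p + real (2 * J) * h \<le> q" "q < 1" "h > 0" "j \<le> 2 * J"
  shows "p + real j * h \<in> unit_ival" "p \<le> p + real j * h" "p + real j * h \<le> q"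
proof -
  have "real j * h \<le> real (2 * J) * h" "0 \<le> real j * h"
    using assms by (auto intro!: mult_right_mono simp del: of_nat_mult)
  then show "p + real j * h \<in> unit_ival" "p \<le> p + real j * h" "p + real j * h \<le> q"
    using assms unfolding greaterThanLessThan_iff by linarith+
qed

lemma osc_add:
  assumes "f \<in> Kspace (Suc k)" "g \<in> Kspace (Suc k)"
    and "0 \<le> p" "p + real (2 * J) * h \<le> q" "q < 1" "h > 0"
  shows "osc k i p h J (\<lambda>s. f s + g s) = osc k i p h J f + osc k i p h J g"
proof -
  have eq: "cderiv k (\<lambda>s. f s + g s) (p + real j * h)
      = cderiv k f (p + real j * h) + cderiv k g (p + real j * h)" if "j \<le> 2 * J" for j
    by (rule cderiv_add[OF assms(1,2) grid_in_unit_ival(1)[OF assms(3-6) that]])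
  show ?thesis
    unfolding osc_def sum.distrib[symmetric]
  proof (rule sum.cong[OF refl], goal_cases)
    case (1 j)
    then have "j \<le> 2 * J" "Suc j \<le> 2 * J"
      by auto
    then show ?case
      by (simp only: eq vector_add_component vector_minus_component vector_scaleR_component)
         (simp add: algebra_simps)
  qed
qed

lemma osc_scaleR:
  assumes "f \<in> Kspace (Suc k)"
    and "0 \<le> p" "p + real (2 * J) * h \<le> q" "q < 1" "h > 0"
  shows "osc k i p h J (\<lambda>s. c *\<^sub>R f s) = c * osc k i p h J f"
proof -
  have eq: "cderiv k (\<lambda>s. c *\<^sub>R f s) (p + real j * h) = c *\<^sub>R cderiv k f (p + real j * h)"
    if "j \<le> 2 * J" for j
    by (rule cderiv_scaleR[OF assms(1) grid_in_unit_ival(1)[OF assms(2-5) that]])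
  show ?thesis
    unfolding osc_def sum_distrib_left
  proof (rule sum.cong[OF refl], goal_cases)
    case (1 j)
    then have "j \<le> 2 * J" "Suc j \<le> 2 * J"
      by auto
    then show ?case
      by (simp only: eq vector_add_component vector_minus_component vector_scaleR_component)
         (simp add: algebra_simps)
  qed
qed

text \<open>The absolute increments over neighbouring grid intervals are bounded by integrals of one
  function \<open>Y\<close>, which add up to a single integral over the whole grid. The bound is
  therefore independent of the step \<open>h\<close> and of the number of steps.\<close>

lemma osc_bound:
  fixes f :: "real \<Rightarrow> real ^ 'n"
  assumes f: "f \<in> Kspace (Suc k)"
    and pq: "0 \<le> p" "p + real (2 * J) * h \<le> q" "q < 1" "h > 0"
  shows "\<bar>osc k i p h J f\<bar> \<le> (1 + 1 / (2 * (1 - q\<^sup>2) ^ Suc k)) * Knorm (Suc k) f"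
proof -
  define w where "w = (1 - q\<^sup>2) ^ Suc k"
  have "0 \<le> q"
    using grid_in_unit_ival(2,3)[OF pq, of 0] pq by simp
  then have "q\<^sup>2 < 1"
    using pq by (simp add: abs_square_less_1)
  then have w: "w > 0"
    by (simp add: w_def del: power_Suc)
  define K where "K = Knorm (Suc k) f"
  have K: "0 \<le> K" "wnorm_sq (Suc k) (Suc k) f \<le> K\<^sup>2"
    by (auto simp: K_def Knorm_nonneg wnorm_sq_le_Knorm)
  let ?G = "cderiv k f"
  have main: "\<bar>osc k i p h J f\<bar> \<le> l + K\<^sup>2 / (2 * l * w)" if l: "l > 0" for l
  proof -
    define Y where "Y = (\<lambda>s. l / 2 + 1 / (2 * l * (1 - q\<^sup>2) ^ Suc k) * wdensity (Suc k) (Suc k) f s)"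
    define x where "x j = p + real j * h" for j
    have x: "0 \<le> x j" "x j \<le> x (Suc j)" "x 0 \<le> x j" "x j \<le> q" if "j \<le> 2 * J" for j
      using grid_in_unit_ival(2,3)[OF pq that] pq by (auto simp: x_def algebra_simps)
    have "\<bar>osc k i p h J f\<bar> \<le> (\<Sum>j<2*J. norm (?G (x (Suc j)) - ?G (x j)))"
      unfolding osc_def x_def
      by (rule order_trans[OF sum_abs sum_mono]) (simp add: abs_mult component_le_norm_cart flip: vector_minus_component)
    also have "\<dots> \<le> (\<Sum>j<2*J. integral {x j..x (Suc j)} Y)"
    proof (rule sum_mono)
      fix j assume "j \<in> {..<2 * J}"
      then show "norm (?G (x (Suc j)) - ?G (x j)) \<le> integral {x j..x (Suc j)} Y"
        unfolding Y_def by (intro cderiv_increment_le(2)[OF f] x \<open>q < 1\<close> l) auto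
    qed
    also have "\<dots> = integral {x 0..x (2 * J)} Y"
    proof -
      have "n \<le> 2 * J \<Longrightarrow> (\<Sum>j<n. integral {x j..x (Suc j)} Y) = integral {x 0..x n} Y" for n
      proof (induction n)
        case (Suc n)
        have "integral {x 0..x n} Y + integral {x n..x (Suc n)} Y = integral {x 0..x (Suc n)} Y"
        proof (rule Henstock_Kurzweil_Integration.integral_combine)
          show "Y integrable_on {x 0..x (Suc n)}"
            unfolding Y_def by (intro cderiv_increment_le(1)[OF f] x \<open>q < 1\<close> l Suc.prems) auto
        qed (use x Suc.prems in auto)
        then show ?case
          using Suc by simp
      qed simp
      then show ?thesis
        by simp
    qed
    also have "\<dots> \<le> l * (x (2 * J) - x 0) / 2 + wnorm_sq (Suc k) (Suc k) f / (2 * l * w)"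
      unfolding Y_def w_def by (intro cderiv_increment_le(3)[OF f] x \<open>q < 1\<close> l) auto
    also have "\<dots> \<le> l + K\<^sup>2 / (2 * l * w)"
    proof (rule add_mono)
      have "x (2 * J) - x 0 \<le> 1"
        using x(4)[of "2 * J"] x(1)[of 0] \<open>q < 1\<close> by simp
      then have "l * (x (2 * J) - x 0) \<le> l * 1"
        using l by (intro mult_left_mono) auto
      then show "l * (x (2 * J) - x 0) / 2 \<le> l"
        using l by simp
      show "wnorm_sq (Suc k) (Suc k) f / (2 * l * w) \<le> K\<^sup>2 / (2 * l * w)"
        using K l w by (intro divide_right_mono) auto
    qed
    finally show ?thesis .
  qed
  show ?thesis
  \<comment> \<open>The parameter \<open>l = K\<close> makes both terms proportional to
    \<open>K\<close>. If \<open>K\<close> is 0, this choice is not allowed and \<open>l\<close>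
    tends to 0 instead.\<close>
  proof (cases "K = 0")
    case True
    then have "\<bar>osc k i p h J f\<bar> \<le> 0 + l" if "l > 0" for l
      using main[OF that] by simp
    then have "\<bar>osc k i p h J f\<bar> \<le> 0"
      by (rule field_le_epsilon)
    then show ?thesis
      using True by (simp add: K_def)
  next
    case False
    then have "\<bar>osc k i p h J f\<bar> \<le> K + K\<^sup>2 / (2 * K * w)"
      using main[of K] K by simp
    also have "\<dots> = (1 + 1 / (2 * w)) * K"
      using False w by (simp add: field_simps power2_eq_square)
    finally show ?thesis
      by (simp add: K_def w_def)
  qed
qed

lemma sum_alternating_pairs:
  fixes d :: "nat \<Rightarrow> real"
  shows "(\<Sum>j<2 * J. (- 1) ^ j * d j) = (\<Sum>j<J. d (2 * j) - d (Suc (2 * j)))"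
  by (induction J) auto

text \<open>With one more derivative, two consecutive increments nearly cancel: by the mean value
  theorem, applied to one component, their difference is \<open>h\<close> times the difference of a
  derivative at two points at most \<open>2 * h\<close> apart. That derivative is Hoelder continuous
  with exponent 1/2, and there are at most \<open>1 / h\<close> pairs. The constant depends on
  \<open>f\<close> and \<open>q\<close>, not on the grid.\<close>

lemma osc_smooth_bound:
  fixes f :: "real \<Rightarrow> real ^ 'n"
  assumes f: "f \<in> Kspace (Suc (Suc k))" and "q < 1"
  obtains C where "\<And>i p h J. 0 \<le> p \<Longrightarrow> p + real (2 * J) * h \<le> q \<Longrightarrow> h > 0 \<Longrightarrow>
    \<bar>osc k i p h J f\<bar> \<le> C * sqrt h"
proof -
  define W where "W = wnorm_sq (Suc (Suc k)) (Suc (Suc k)) f / (2 * (1 - q\<^sup>2) ^ Suc (Suc k))"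
  have "\<bar>osc k i p h J f\<bar> \<le> (1 + W) * sqrt h"
    if pq: "0 \<le> p" "p + real (2 * J) * h \<le> q" and h: "h > 0" for i p h J
  proof -
    note grid = grid_in_unit_ival[OF pq \<open>q < 1\<close> h]
    have "0 \<le> q"
      using grid(2,3)[of 0] pq by simp
    then have "q\<^sup>2 < 1"
      using \<open>q < 1\<close> by (simp add: abs_square_less_1)
    then have W: "W \<ge> 0"
      by (simp add: W_def wnorm_sq_nonneg del: power_Suc)
    define x where "x j = p + real j * h" for j
    define G where "G s = cderiv k f s $ i" for s
    define G' where "G' s = cderiv (Suc k) f s $ i" for s
    have deriv: "(G has_real_derivative G' s) (at s)" if "s \<in> unit_ival" for s
      using bounded_linear.has_vector_derivative[OF bounded_linear_vec_nth Kspace_cderiv(1)[OF f lessI that]]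
      by (simp add: G_def[abs_def] G'_def has_real_derivative_iff_has_vector_derivative)
    define d where "d j = G (x (Suc j)) - G (x j)" for j
    have step: "\<exists>z. x j < z \<and> z < x (Suc j) \<and> d j = h * G' z" if "j < 2 * J" for j
    proof -
      have "x j < x (Suc j)"
        using h by (simp add: x_def algebra_simps)
      moreover have "(G has_real_derivative G' s) (at s)" if "x j \<le> s" "s \<le> x (Suc j)" for s
        using grid[of j] grid[of "Suc j"] \<open>j < 2 * J\<close> that by (intro deriv) (auto simp: x_def)
      ultimately obtain z where "x j < z" "z < x (Suc j)" "G (x (Suc j)) - G (x j) = (x (Suc j) - x j) * G' z"
        using MVT2[of "x j" "x (Suc j)" G G'] by blast
      then show ?thesis
        by (auto simp: d_def x_def algebra_simps)
    qed
    have pair: "\<bar>d (2 * j) - d (Suc (2 * j))\<bar> \<le> h * ((1 + W) * sqrt h)" if j: "j < J" for j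
    proof -
      obtain y z where y: "x (2 * j) < y" "y < x (Suc (2 * j))" "d (2 * j) = h * G' y"
        and z: "x (Suc (2 * j)) < z" "z < x (Suc (Suc (2 * j)))" "d (Suc (2 * j)) = h * G' z"
        using step[of "2 * j"] step[of "Suc (2 * j)"] j by auto
      \<comment> \<open>This balances the two Young terms, which are of order \<open>l * h\<close>
        and \<open>1 / l\<close>.\<close>
      define l where "l = 1 / sqrt h"
      have l: "l > 0"
        using h by (simp add: l_def)
      have "p \<le> x (2 * j)" "x (Suc (Suc (2 * j))) \<le> q"
        using grid(2)[of "2 * j"] grid(3)[of "Suc (Suc (2 * j))"] j unfolding x_def by auto
      moreover have "x (Suc (Suc (2 * j))) = x (2 * j) + 2 * h"
        by (simp add: x_def algebra_simps)
      ultimately have yz: "0 \<le> y" "y \<le> z" "z \<le> q" "z - y \<le> 2 * h"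
        using y(1,2) z(1,2) pq(1) by linarith+
      have "\<bar>G' z - G' y\<bar> \<le> norm (cderiv (Suc k) f z - cderiv (Suc k) f y)"
        unfolding G'_def vector_minus_component[symmetric] by (rule component_le_norm_cart)
      also have "\<dots> \<le> l * (z - y) / 2 + wnorm_sq (Suc (Suc k)) (Suc (Suc k)) f / (2 * l * (1 - q\<^sup>2) ^ Suc (Suc k))"
        using cderiv_increment_le(2,3)[OF f yz(1-3) \<open>q < 1\<close> l] by linarith
      also have "\<dots> = l * (z - y) / 2 + W / l"
        by (simp add: W_def field_simps)
      also have "\<dots> \<le> l * (2 * h) / 2 + W / l"
        using yz l by (intro add_right_mono divide_right_mono mult_left_mono) auto
      also have "\<dots> = (1 + W) * sqrt h"
        using h by (simp add: l_def field_simps real_div_sqrt)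
      finally have "\<bar>G' z - G' y\<bar> \<le> (1 + W) * sqrt h" .
      then have "h * \<bar>G' z - G' y\<bar> \<le> h * ((1 + W) * sqrt h)"
        using h by (intro mult_left_mono) auto
      moreover have "\<bar>d (2 * j) - d (Suc (2 * j))\<bar> = h * \<bar>G' z - G' y\<bar>"
        using h by (simp add: y z abs_mult abs_minus_commute flip: right_diff_distrib)
      ultimately show ?thesis
        by simp
    qed
    have eq: "osc k i p h J f = (\<Sum>j<J. d (2 * j) - d (Suc (2 * j)))"
      unfolding osc_def sum_alternating_pairs[symmetric] by (simp add: d_def x_def G_def)
    have "\<bar>osc k i p h J f\<bar> \<le> (\<Sum>j<J. h * ((1 + W) * sqrt h))"
      unfolding eq by (rule order_trans[OF sum_abs sum_mono]) (use pair in auto)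
    also have "\<dots> = (real J * h) * ((1 + W) * sqrt h)"
      by simp
    also have "\<dots> \<le> 1 * ((1 + W) * sqrt h)"
      using pq \<open>q < 1\<close> W h by (intro mult_right_mono) auto
    finally show ?thesis
      by simp
  qed
  then show ?thesis
    using that by blast
qed

subsection \<open>Tangent vectors with prescribed amplitude\<close>

lemma wdensity_integrable_eq:
  fixes f :: "real \<Rightarrow> real ^ 'n"
  assumes "has_weak_deriv k f g" "wdensity j k f integrable_on {-1..1}"
  shows "(\<lambda>s. (1 - s\<^sup>2) ^ j * (norm (g s))\<^sup>2) integrable_on {-1..1}"
proof -
  obtain N where N: "negligible N"
    "\<And>s. s \<in> {-1..1} - N \<Longrightarrow> (1 - s\<^sup>2) ^ j * (norm (g s))\<^sup>2 = wdensity j k f s"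
    using wdensity_ae_eq[OF assms(1)] by metis
  show ?thesis
    by (rule integrable_spike[OF assms(2) N])
qed

lemma wnorm_sq_dominated:
  fixes f :: "real \<Rightarrow> real ^ 'n"
  assumes "has_weak_deriv k f g" "continuous_on {-1..1} f" "G integrable_on {-1..1}"
    and "\<And>s. s \<in> unit_ival \<Longrightarrow> (1 - s\<^sup>2) ^ j * (norm (g s))\<^sup>2 \<le> G s"
  shows "wnorm_sq j k f \<le> integral {-1..1} G"
proof -
  have "(\<lambda>s. (1 - s\<^sup>2) ^ j * (norm (g s))\<^sup>2) integrable_on {-1..1}"
    by (rule wdensity_integrable_eq[OF assms(1) wdensity_integrableI[OF assms]])
  then have "integral {-1..1} (\<lambda>s. (1 - s\<^sup>2) ^ j * (norm (g s))\<^sup>2) \<le> integral {-1..1} G"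
    using assms(3,4) unfolding integral_open_interval_real
      integrable_on_open_interval_real[symmetric] by (intro integral_le) auto
  then show ?thesis
    by (simp add: wnorm_sq_eq[OF assms(1)])
qed

lemma Kspace_continuous_cderiv:
  fixes f :: "real \<Rightarrow> real ^ 'n"
  assumes f: "f \<in> Kspace (Suc k)" and "l \<le> k"
  shows "continuous_on unit_ival (cderiv l f)" "has_weak_deriv l f (cderiv l f)"
proof -
  have "f \<in> Kspace (Suc l)"
    using Kspace_mono[of "Suc l" "Suc k"] assms by auto
  note l = Kspace_cderiv[OF this]
  show "continuous_on unit_ival (cderiv l f)"
    by (rule is_primitive_continuous[OF l(2)])
  then show "has_weak_deriv l f (cderiv l f)"
    using l(1) by (intro has_weak_deriv_chain) auto
qed

text \<open>The product rule for the \<open>k\<close>-th derivative of \<open>\<phi> i\<close> times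
  \<open>b j\<close>, where a raised index means differentiation. The terms are not collected, so no
  binomial coefficients appear; only their number \<open>2 ^ k\<close> and the term in which all
  derivatives fall on \<phi> matter.\<close>

fun leibniz :: "(nat \<Rightarrow> real \<Rightarrow> real) \<Rightarrow> (nat \<Rightarrow> real \<Rightarrow> real ^ 'n) \<Rightarrow>
    nat \<Rightarrow> nat \<Rightarrow> nat \<Rightarrow> real \<Rightarrow> real ^ 'n" where
  "leibniz \<phi> b 0 i j s = \<phi> i s *\<^sub>R b j s"
| "leibniz \<phi> b (Suc k) i j s = leibniz \<phi> b k (Suc i) j s + leibniz \<phi> b k i (Suc j) s"

lemma has_vector_derivative_leibniz:
  assumes "\<And>l. i \<le> l \<Longrightarrow> l \<le> i + k \<Longrightarrow> (\<phi> l has_real_derivative \<phi> (Suc l) s) (at s)"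
    and "\<And>l. j \<le> l \<Longrightarrow> l \<le> j + k \<Longrightarrow> (b l has_vector_derivative b (Suc l) s) (at s)"
  shows "(leibniz \<phi> b k i j has_vector_derivative leibniz \<phi> b (Suc k) i j s) (at s)"
  using assms
proof (induction k arbitrary: i j)
  case 0
  have "((\<lambda>s. \<phi> i s *\<^sub>R b j s) has_vector_derivative
      (\<phi> i s *\<^sub>R b (Suc j) s + \<phi> (Suc i) s *\<^sub>R b j s)) (at s)"
    using 0 by (intro has_vector_derivative_scaleR) auto
  then show ?case
    by (simp add: add.commute fun_eq_iff[symmetric])
next
  case (Suc k)
  have "((\<lambda>s. leibniz \<phi> b k (Suc i) j s + leibniz \<phi> b k i (Suc j) s) has_vector_derivative
      (leibniz \<phi> b (Suc k) (Suc i) j s + leibniz \<phi> b (Suc k) i (Suc j) s)) (at s)"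
    using Suc.prems by (intro has_vector_derivative_add Suc.IH) auto
  then show ?case
    by simp
qed

lemma sum_shift_le:
  fixes a :: "nat \<Rightarrow> real"
  assumes "\<And>l. 0 \<le> a l"
  shows "(\<Sum>l=j..j+k. a l) \<le> (\<Sum>l=j..j+Suc k. a l)" "(\<Sum>l=Suc j..Suc j+k. a l) \<le> (\<Sum>l=j..j+Suc k. a l)"
  using assms by (auto intro!: sum_mono2)

text \<open>The full expansion has \<open>2 ^ k\<close> terms, each at most \<open>M\<close> times
  the norm of one \<open>b l\<close> with \<open>l\<close> between \<open>j\<close> and
  \<open>j + k\<close>.\<close>

lemma leibniz_bound:
  assumes "\<And>l. i \<le> l \<Longrightarrow> l \<le> i + k \<Longrightarrow> \<bar>\<phi> l s\<bar> \<le> M"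
  shows "norm (leibniz \<phi> b k i j s) \<le> 2 ^ k * M * (\<Sum>l=j..j+k. norm (b l s))"
  using assms
proof (induction k arbitrary: i j)
  case 0
  then show ?case
    by (auto intro: mult_right_mono)
next
  case (Suc k)
  have M: "0 \<le> M"
    using Suc.prems[of i] by force
  have "norm (leibniz \<phi> b (Suc k) i j s)
      \<le> 2 ^ k * M * (\<Sum>l=j..j+k. norm (b l s)) + 2 ^ k * M * (\<Sum>l=Suc j..Suc j+k. norm (b l s))"
    using Suc.prems
    by (simp only: leibniz.simps) (intro norm_triangle_mono Suc.IH; auto)
  also have "\<dots> \<le> 2 ^ k * M * (\<Sum>l=j..j+Suc k. norm (b l s)) + 2 ^ k * M * (\<Sum>l=j..j+Suc k. norm (b l s))"
    using M by (intro add_mono mult_left_mono sum_shift_le) auto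
  also have "\<dots> = 2 ^ Suc k * M * (\<Sum>l=j..j+Suc k. norm (b l s))"
    by (simp only: power_Suc)
  finally show ?case .
qed

text \<open>The order \<open>i + k\<close> of \<phi> occurs in exactly one term, the one subtracted.
  The other terms contain lower orders only, and for an oscillating amplitude these are smaller by a
  factor of the frequency.\<close>

lemma leibniz_leading:
  assumes "\<And>l. i \<le> l \<Longrightarrow> l < i + k \<Longrightarrow> \<bar>\<phi> l s\<bar> \<le> M" "0 \<le> M"
  shows "norm (leibniz \<phi> b k i j s - \<phi> (i + k) s *\<^sub>R b j s) \<le> 2 ^ k * M * (\<Sum>l=j..j+k. norm (b l s))"
  using assms(1)
proof (induction k arbitrary: i j)
  case 0
  then show ?case
    using assms(2) by simp
next
  case (Suc k)
  have "leibniz \<phi> b (Suc k) i j s - \<phi> (i + Suc k) s *\<^sub>R b j s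
      = (leibniz \<phi> b k (Suc i) j s - \<phi> (Suc i + k) s *\<^sub>R b j s) + leibniz \<phi> b k i (Suc j) s"
    by simp
  also have "norm \<dots>
      \<le> 2 ^ k * M * (\<Sum>l=j..j+k. norm (b l s)) + 2 ^ k * M * (\<Sum>l=Suc j..Suc j+k. norm (b l s))"
    using Suc.prems by (intro norm_triangle_mono Suc.IH leibniz_bound) auto
  also have "\<dots> \<le> 2 ^ k * M * (\<Sum>l=j..j+Suc k. norm (b l s)) + 2 ^ k * M * (\<Sum>l=j..j+Suc k. norm (b l s))"
    using assms(2) by (intro add_mono mult_left_mono sum_shift_le) auto
  also have "\<dots> = 2 ^ Suc k * M * (\<Sum>l=j..j+Suc k. norm (b l s))"
    by (simp only: power_Suc)
  finally show ?case .
qed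

text \<open>The odd primitive of \<open>\<phi>\<^sub>0 b'\<close>, integrated by parts so that it is continuous up to \<open>\<plusminus>1\<close>,
  where \<open>b\<close> need not be differentiable.\<close>
definition twisted :: "(nat \<Rightarrow> real \<Rightarrow> real) \<Rightarrow> (real \<Rightarrow> real ^ 'n) \<Rightarrow> real \<Rightarrow> real ^ 'n" where
  "twisted \<phi> b s = (if s \<in> {-1..1} then \<phi> 0 s *\<^sub>R b s
     - (integral {-1..s} (\<lambda>r. \<phi> 1 r *\<^sub>R b r) - integral {-1..0} (\<lambda>r. \<phi> 1 r *\<^sub>R b r)) else 0)"

text \<open>The primitive is based at -1 and recentred at 0, because an integral over
  \<open>{0..s}\<close> would be 0 for negative \<open>s\<close>. Oddness then follows by reflecting
  the integral.\<close>

lemma even_primitive_odd: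
  fixes g :: "real \<Rightarrow> real ^ 'n"
  assumes g: "continuous_on {-1..1} g" "\<And>s. g (- s) = g s" and s: "s \<in> {-1..1}"
  defines "P \<equiv> \<lambda>s. integral {-1..s} g - integral {-1..0} g"
  shows "P (- s) = - P s"
proof -
  have int: "g integrable_on {c..d}" if "-1 \<le> c" "d \<le> 1" for c d
    using that by (intro integrable_continuous_real continuous_on_subset[OF g(1)]) auto
  have pos: "P (- s) = - P s" if s: "0 \<le> s" "s \<le> 1" for s
  proof -
    have A: "integral {-1..0} g + integral {0..s} g = integral {-1..s} g"
      using s by (intro Henstock_Kurzweil_Integration.integral_combine int) auto
    have A': "integral {-1..-s} g + integral {-s..0} g = integral {-1..0} g"
      using s by (intro Henstock_Kurzweil_Integration.integral_combine int) auto
    have "integral {-s..0} g = integral {0..s} g"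
      using Henstock_Kurzweil_Integration.integral_reflect_real[of s 0 g] by (simp add: g(2))
    moreover have "P s = integral {0..s} g"
      using A unfolding P_def by (metis add_diff_cancel_left')
    moreover have "P (- s) = - integral {-s..0} g"
      using A' unfolding P_def by (metis add_diff_cancel_left' minus_diff_eq)
    ultimately show ?thesis
      by simp
  qed
  show ?thesis
    using pos[of s] pos[of "- s"] s by (cases "0 \<le> s") auto
qed

text \<open>In the application \<open>k\<close> is \<open>m - 1\<close>, so \<gamma> has one order
  more than the curves to be built, and \<open>B\<close> is an infinitesimal rotation. Orthogonality
  enters only later; the norms of the constructed curves depend on linearity and boundedness of
  \<open>B\<close> alone.\<close>

locale twist =
  fixes \<gamma> :: "real \<Rightarrow> real ^ 'n" and k :: nat and B :: "real ^ 'n \<Rightarrow> real ^ 'n"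
  assumes \<gamma>: "\<gamma> \<in> Kspace (Suc (Suc k))" and k: "1 \<le> k"
    and B: "bounded_linear B" "\<And>x. norm (B x) \<le> 2 * norm x"
begin

abbreviation b :: "nat \<Rightarrow> real \<Rightarrow> real ^ 'n" where
  "b l s \<equiv> B (cderiv l \<gamma> s)"

text \<open>A scalar function given together with its derivatives up to order \<open>k\<close>, all
  bounded by \<open>M\<close>. Carrying the whole family gives explicit access to the derivatives of
  a trigonometric series.\<close>

definition amplitude :: "real \<Rightarrow> (nat \<Rightarrow> real \<Rightarrow> real) \<Rightarrow> bool" where
  "amplitude M \<phi> \<longleftrightarrow> (\<forall>l<k. \<forall>s. (\<phi> l has_real_derivative \<phi> (Suc l) s) (at s)) \<and>
     continuous_on UNIV (\<phi> k) \<and> (\<forall>s. \<phi> 0 (- s) = \<phi> 0 s) \<and> (\<forall>s. \<phi> 1 (- s) = - \<phi> 1 s) \<and>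
     (\<forall>l\<le>k. \<forall>s. \<bar>\<phi> l s\<bar> \<le> M)"

lemma amplitudeD:
  assumes "amplitude M \<phi>"
  shows "l < k \<Longrightarrow> (\<phi> l has_real_derivative \<phi> (Suc l) s) (at s)"
    and "l \<le> k \<Longrightarrow> continuous_on S (\<phi> l)"
    and "\<phi> 0 (- s) = \<phi> 0 s" "\<phi> 1 (- s) = - \<phi> 1 s" "l \<le> k \<Longrightarrow> \<bar>\<phi> l s\<bar> \<le> M" "0 \<le> M"
proof -
  show *: "l < k \<Longrightarrow> (\<phi> l has_real_derivative \<phi> (Suc l) s) (at s)" for l s
    using assms by (auto simp: amplitude_def)
  show "continuous_on S (\<phi> l)" if "l \<le> k"
  proof (cases "l = k")
    case True
    then show ?thesis
      using assms continuous_on_subset unfolding amplitude_def by blast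
  next
    case False
    then show ?thesis
      using *[of l] that
      by (intro continuous_at_imp_continuous_on ballI DERIV_isCont) auto
  qed
  show "\<phi> 0 (- s) = \<phi> 0 s" "\<phi> 1 (- s) = - \<phi> 1 s" "l \<le> k \<Longrightarrow> \<bar>\<phi> l s\<bar> \<le> M" for l s
    using assms by (auto simp: amplitude_def)
  from this(3)[of 0 0] show "0 \<le> M"
    by simp
qed

abbreviation V :: "(nat \<Rightarrow> real \<Rightarrow> real) \<Rightarrow> real \<Rightarrow> real ^ 'n" where
  "V \<phi> \<equiv> twisted \<phi> (b 0)"

lemma b_deriv:
  assumes "l \<le> k" "s \<in> unit_ival"
  shows "(b l has_vector_derivative b (Suc l) s) (at s)"
  using assms by (intro bounded_linear.has_vector_derivative[OF B(1)] Kspace_cderiv(1)[OF \<gamma>]) auto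

lemma b_continuous:
  assumes "l \<le> Suc k"
  shows "continuous_on unit_ival (b l)"
  using assms
  by (intro bounded_linear.continuous_on[OF B(1)] Kspace_continuous_cderiv(1)[OF \<gamma>]) auto

lemma b0_continuous: "continuous_on {-1..1} (b 0)"
  using bounded_linear.continuous_on[OF B(1) KspaceD(2)[OF \<gamma>]] by simp

lemma b0_odd: "b 0 (- s) = - b 0 s"
  by (simp add: KspaceD(3)[OF \<gamma>] bounded_linear.linear[OF B(1)] linear_neg)

lemma integrand_continuous:
  assumes "amplitude M \<phi>"
  shows "continuous_on {-1..1} (\<lambda>r. \<phi> 1 r *\<^sub>R b 0 r)"
  using b0_continuous amplitudeD(2)[OF assms, of 1] k by (intro continuous_intros) auto

text \<open>The term \<open>\<phi> 1 s\<close> times \<open>b 0 s\<close> of the product rule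
  cancels against the derivative of the integral. What remains is a multiple of \<open>B\<close>
  applied to the derivative of \<gamma>, hence tangent at \<gamma> when \<open>B\<close> is
  antisymmetric.\<close>

lemma V_deriv:
  assumes \<phi>: "amplitude M \<phi>" and s: "s \<in> unit_ival"
  shows "(V \<phi> has_vector_derivative \<phi> 0 s *\<^sub>R b 1 s) (at s)"
proof -
  let ?g = "\<lambda>r. \<phi> 1 r *\<^sub>R b 0 r"
  have "((\<lambda>u. integral {-1..u} ?g) has_vector_derivative ?g s) (at s within {-1..1})"
    using s by (intro integral_has_vector_derivative integrand_continuous[OF \<phi>]) auto
  moreover have "at s within {-1..1} = at s"
    using s by (intro at_within_interior) (auto simp: interior_atLeastAtMost_real)
  ultimately have int: "((\<lambda>u. integral {-1..u} ?g) has_vector_derivative ?g s) (at s)"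
    by (simp only:)
  have "((\<lambda>u. \<phi> 0 u *\<^sub>R b 0 u - (integral {-1..u} ?g - integral {-1..0} ?g)) has_vector_derivative
      ((\<phi> 0 s *\<^sub>R b 1 s + \<phi> 1 s *\<^sub>R b 0 s) - (?g s - 0))) (at s)"
    using amplitudeD(1)[OF \<phi>, of 0 s] b_deriv[of 0 s] k s
    by (intro has_vector_derivative_diff has_vector_derivative_scaleR has_vector_derivative_const int) auto
  then have "((\<lambda>u. \<phi> 0 u *\<^sub>R b 0 u - (integral {-1..u} ?g - integral {-1..0} ?g)) has_vector_derivative
      \<phi> 0 s *\<^sub>R b 1 s) (at s)"
    by simp
  then show ?thesis
    by (rule has_vector_derivative_transform_within_open[where S = unit_ival])
       (use s in \<open>auto simp: twisted_def\<close>)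
qed

text \<open>The successive derivatives of \<open>V \<phi>\<close>. From order 1 on,
  \<open>b 0\<close> no longer occurs, and order \<open>Suc i\<close> contains derivatives of the
  amplitude only up to \<open>i\<close>.\<close>

definition chain :: "(nat \<Rightarrow> real \<Rightarrow> real) \<Rightarrow> nat \<Rightarrow> real \<Rightarrow> real ^ 'n" where
  "chain \<phi> l = (case l of 0 \<Rightarrow> V \<phi> | Suc i \<Rightarrow> leibniz \<phi> b i 0 1)"

lemma chain_deriv:
  assumes \<phi>: "amplitude M \<phi>" and "l \<le> k" "s \<in> unit_ival"
  shows "(chain \<phi> l has_vector_derivative chain \<phi> (Suc l) s) (at s)"
proof (cases l)
  case 0
  then show ?thesis
    using V_deriv[OF \<phi> assms(3)] by (simp add: chain_def)
next
  case (Suc i)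
  have "(leibniz \<phi> b i 0 1 has_vector_derivative leibniz \<phi> b (Suc i) 0 1 s) (at s)"
    using assms Suc by (intro has_vector_derivative_leibniz amplitudeD(1)[OF \<phi>] b_deriv) auto
  then show ?thesis
    by (simp add: Suc chain_def del: leibniz.simps)
qed

lemma leibniz_continuous:
  assumes \<phi>: "amplitude M \<phi>" and "i + l \<le> k" "j + l \<le> Suc k"
  shows "continuous_on unit_ival (leibniz \<phi> b l i j)"
  using assms(2,3)
proof (induction l arbitrary: i j)
  case 0
  have "continuous_on unit_ival (\<lambda>s. \<phi> i s *\<^sub>R b j s)"
    using 0 by (intro continuous_on_scaleR amplitudeD(2)[OF \<phi>] b_continuous) auto
  then show ?case
    by (simp add: fun_eq_iff[symmetric])
next
  case (Suc l)
  have "continuous_on unit_ival (\<lambda>s. leibniz \<phi> b l (Suc i) j s + leibniz \<phi> b l i (Suc j) s)"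
    using Suc.prems by (intro continuous_on_add Suc.IH) auto
  then show ?case
    by simp
qed

lemma V_continuous:
  assumes \<phi>: "amplitude M \<phi>"
  shows "continuous_on {-1..1} (V \<phi>)"
proof -
  let ?g = "\<lambda>r. \<phi> 1 r *\<^sub>R b 0 r"
  have "continuous_on {-1..1} (\<lambda>s. \<phi> 0 s *\<^sub>R b 0 s - (integral {-1..s} ?g - integral {-1..0} ?g))"
    by (intro continuous_on_diff continuous_on_scaleR b0_continuous amplitudeD(2)[OF \<phi>]
        indefinite_integral_continuous_1 integrable_continuous_real integrand_continuous[OF \<phi>]
        continuous_on_const) simp
  then show ?thesis
    by (rule continuous_on_eq) (simp add: twisted_def)
qed

lemma V_weak_deriv:
  assumes \<phi>: "amplitude M \<phi>" and "l \<le> Suc k"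
  shows "has_weak_deriv l (V \<phi>) (chain \<phi> l)"
proof (rule has_weak_deriv_chain)
  show "continuous_on unit_ival (chain \<phi> l)"
  proof (cases l)
    case 0
    then show ?thesis
      unfolding 0 chain_def nat.case by (intro continuous_on_subset[OF V_continuous[OF \<phi>]]) auto
  next
    case (Suc i)
    then show ?thesis
      using leibniz_continuous[OF \<phi>, of 0 i 1] assms(2) by (simp add: chain_def)
  qed
qed (use assms in \<open>auto simp: chain_def[of _ 0] intro: chain_deriv[OF \<phi>]\<close>)

lemma V_cderiv:
  assumes \<phi>: "amplitude M \<phi>" and "l \<le> Suc k" "s \<in> unit_ival"
  shows "cderiv l (V \<phi>) s = chain \<phi> l s"
  by (rule cderiv_chain) (use assms in \<open>auto simp: chain_def[of _ 0] intro: chain_deriv[OF \<phi>]\<close>)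

lemma V_odd:
  assumes \<phi>: "amplitude M \<phi>"
  shows "V \<phi> (- s) = - V \<phi> s"
proof (cases "s \<in> {-1..1}")
  case True
  let ?g = "\<lambda>r. \<phi> 1 r *\<^sub>R b 0 r"
  let ?P = "\<lambda>s. integral {-1..s} ?g - integral {-1..0} ?g"
  have P: "?P (- s) = - ?P s"
    by (rule even_primitive_odd[OF integrand_continuous[OF \<phi>] _ True],
        simp only: b0_odd amplitudeD(4)[OF \<phi>]) simp
  have "- s \<in> {-1..1}"
    using True by auto
  then have "V \<phi> (- s) = \<phi> 0 (- s) *\<^sub>R b 0 (- s) - ?P (- s)"
    unfolding twisted_def by (rule if_P)
  also have "\<dots> = - (\<phi> 0 s *\<^sub>R b 0 s - ?P s)"
    unfolding P b0_odd amplitudeD(3)[OF \<phi>] by simp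
  also have "\<dots> = - V \<phi> s"
    unfolding twisted_def by (simp only: True if_True)
  finally show ?thesis .
qed (auto simp: twisted_def)

lemma V_bound:
  obtains c where "c \<ge> 0" "\<And>M \<phi> s. amplitude M \<phi> \<Longrightarrow> norm (V \<phi> s) \<le> c * M"
proof -
  have "bounded (b 0 ` {-1..1})"
    by (intro compact_imp_bounded compact_continuous_image b0_continuous) auto
  then obtain c where c: "c > 0" "\<And>s. s \<in> {-1..1} \<Longrightarrow> norm (b 0 s) \<le> c"
    by (auto simp: bounded_pos)
  \<comment> \<open>One \<open>c\<close> for the boundary term and two for each of the two
    integrals, whose intervals have length at most 2.\<close>
  have "norm (V \<phi> s) \<le> (5 * c) * M" if \<phi>: "amplitude M \<phi>" for M \<phi> s
  proof (cases "s \<in> {-1..1}")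
    case True
    let ?g = "\<lambda>r. \<phi> 1 r *\<^sub>R b 0 r"
    have int: "norm (integral {-1..d} ?g) \<le> 2 * (M * c)" if d: "d \<in> {-1..1}" for d
    proof -
      have "norm (integral {-1..d} ?g) \<le> (M * c) * (d - (-1))"
      proof (rule integral_bound)
        show "continuous_on {-1..d} ?g"
          by (rule continuous_on_subset[OF integrand_continuous[OF \<phi>]]) (use d in auto)
        fix t assume "t \<in> {-1..d}"
        then show "norm (?g t) \<le> M * c"
          using c(2)[of t] amplitudeD(5)[OF \<phi> k, of t] d by (auto intro!: mult_mono)
      qed (use d in auto)
      also have "\<dots> \<le> (M * c) * 2"
        using c amplitudeD(6)[OF \<phi>] d by (intro mult_left_mono) auto
      finally show ?thesis
        by simp
    qed
    have "norm (\<phi> 0 s *\<^sub>R b 0 s) \<le> M * c"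
      using c(2)[OF True] amplitudeD(5)[OF \<phi>, of 0 s] amplitudeD(6)[OF \<phi>] by (auto intro!: mult_mono)
    moreover have "norm (V \<phi> s) \<le> norm (\<phi> 0 s *\<^sub>R b 0 s)
        + (norm (integral {-1..s} ?g) + norm (integral {-1..0} ?g))"
      unfolding twisted_def if_P[OF True]
      by (intro order_trans[OF norm_triangle_ineq4] add_left_mono norm_triangle_ineq4)
    ultimately show ?thesis
      using int[OF True] int[of 0] by (simp add: mult.commute)
  next
    case False
    then show ?thesis
      using c amplitudeD(6)[OF \<phi>] by (auto simp: twisted_def)
  qed
  then show ?thesis
    using that[of "5 * c"] c by auto
qed

definition majorant :: "real \<Rightarrow> real" where
  "majorant s = (\<Sum>l=1..Suc k. (1 - s\<^sup>2) ^ l * (norm (cderiv l \<gamma> s))\<^sup>2)"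

lemma majorant_integrable: "majorant integrable_on {-1..1}"
  unfolding majorant_def[abs_def]
  by (intro integrable_sum wdensity_integrable_eq[OF Kspace_continuous_cderiv(2)[OF \<gamma>]]
      KspaceD(5)[OF \<gamma>]) auto

text \<open>By the product rule, order \<open>l\<close> of \<open>V \<phi>\<close> is controlled by
  the derivatives of \<gamma> of orders 1 to \<open>l\<close>. Cauchy-Schwarz turns the square of
  their sum into a sum of squares, for which the norms of \<gamma> supply weights.\<close>

lemma chain_majorant:
  assumes \<phi>: "amplitude M \<phi>" and l: "1 \<le> l" "l \<le> Suc k" and s: "s \<in> unit_ival"
  shows "(1 - s\<^sup>2) ^ l * (norm (chain \<phi> l s))\<^sup>2 \<le> (2 ^ Suc k)\<^sup>2 * real (Suc k) * M\<^sup>2 * majorant s"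
proof -
  obtain i where i: "l = Suc i"
    using l by (cases l) auto
  define r where "r = 1 - s\<^sup>2"
  have r: "0 \<le> r" "r \<le> 1"
    using s by (auto simp: r_def abs_square_le_1 abs_le_iff)
  note M = amplitudeD(6)[OF \<phi>]
  let ?c = "\<lambda>j. norm (cderiv j \<gamma> s)"
  have "norm (chain \<phi> l s) \<le> 2 ^ i * M * (\<Sum>j=1..1+i. norm (b j s))"
    unfolding i chain_def nat.case using l i by (intro leibniz_bound amplitudeD(5)[OF \<phi>]) auto
  also have "\<dots> \<le> 2 ^ i * M * (\<Sum>j=1..l. 2 * ?c j)"
    using M by (intro mult_left_mono) (auto simp: i intro!: sum_mono B(2) simp del: sum.cl_ivl_Suc)
  also have "\<dots> = 2 ^ l * M * (\<Sum>j=1..l. ?c j)"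
    by (simp add: i sum_distrib_left[symmetric] del: sum.cl_ivl_Suc)
  also have "\<dots> \<le> 2 ^ Suc k * M * (\<Sum>j=1..l. ?c j)"
    using M l by (intro mult_right_mono power_increasing sum_nonneg) auto
  finally have "(norm (chain \<phi> l s))\<^sup>2 \<le> (2 ^ Suc k * M * (\<Sum>j=1..l. ?c j))\<^sup>2"
    by (intro power_mono) auto
  also have "\<dots> = (2 ^ Suc k)\<^sup>2 * M\<^sup>2 * (\<Sum>j=1..l. ?c j)\<^sup>2"
    by (simp add: power_mult_distrib)
  also have "\<dots> \<le> (2 ^ Suc k)\<^sup>2 * M\<^sup>2 * (real (Suc k) * (\<Sum>j=1..l. (?c j)\<^sup>2))"
  proof (intro mult_left_mono)
    have "(\<Sum>j=1..l. ?c j)\<^sup>2 \<le> (\<Sum>j=1..l. (?c j)\<^sup>2) * (\<Sum>j=1..l. 1\<^sup>2)"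
      using Cauchy_Schwarz_ineq_sum[of ?c "\<lambda>_. 1" "{1..l}"] by simp
    also have "\<dots> \<le> (\<Sum>j=1..l. (?c j)\<^sup>2) * real (Suc k)"
      using l by (intro mult_left_mono sum_nonneg) auto
    finally show "(\<Sum>j=1..l. ?c j)\<^sup>2 \<le> real (Suc k) * (\<Sum>j=1..l. (?c j)\<^sup>2)"
      by (simp add: mult.commute)
  qed auto
  finally have "r ^ l * (norm (chain \<phi> l s))\<^sup>2
      \<le> r ^ l * ((2 ^ Suc k)\<^sup>2 * M\<^sup>2 * (real (Suc k) * (\<Sum>j=1..l. (?c j)\<^sup>2)))"
    using r by (intro mult_left_mono) auto
  also have "\<dots> = (2 ^ Suc k)\<^sup>2 * real (Suc k) * M\<^sup>2 * (\<Sum>j=1..l. r ^ l * (?c j)\<^sup>2)"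
    by (simp only: sum_distrib_left[symmetric] mult_ac)
  also have "\<dots> \<le> (2 ^ Suc k)\<^sup>2 * real (Suc k) * M\<^sup>2 * majorant s"
  proof (intro mult_left_mono)
    \<comment> \<open>Since \<open>r\<close> lies between 0 and 1, the weight of order
      \<open>l\<close> is at most the weight of each lower order \<open>j\<close>.\<close>
    have "(\<Sum>j=1..l. r ^ l * (?c j)\<^sup>2) \<le> (\<Sum>j=1..l. r ^ j * (?c j)\<^sup>2)"
      using r by (intro sum_mono mult_right_mono power_decreasing) auto
    also have "\<dots> \<le> majorant s"
      unfolding majorant_def r_def[symmetric] using r l by (intro sum_mono2) auto
    finally show "(\<Sum>j=1..l. r ^ l * (?c j)\<^sup>2) \<le> majorant s" .
  qed auto
  finally show ?thesis
    by (simp add: r_def)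
qed

lemma V_Kspace_Knorm:
  obtains A where "A > 0"
    "\<And>M \<phi>. amplitude M \<phi> \<Longrightarrow> V \<phi> \<in> Kspace (Suc k) \<and> Knorm (Suc k) (V \<phi>) \<le> A * M"
proof -
  obtain c where c: "c \<ge> 0" "\<And>M \<phi> s. amplitude M \<phi> \<Longrightarrow> norm (V \<phi> s) \<le> c * M"
    using V_bound by blast
  define E :: real where "E = (2 ^ Suc k)\<^sup>2 * real (Suc k)"
  define N where "N = integral {-1..1} majorant"
  have majorant_nonneg: "0 \<le> majorant s" if "s \<in> {-1..1}" for s
    unfolding majorant_def using that
    by (intro sum_nonneg mult_nonneg_nonneg zero_le_power) (auto simp: abs_square_le_1 abs_le_iff)
  have N: "N \<ge> 0"
    unfolding N_def by (intro integral_nonneg majorant_integrable majorant_nonneg)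
  define G where "G M s = (c * M)\<^sup>2 + E * M\<^sup>2 * majorant s" for M s
  have G_int: "G M integrable_on {-1..1}" for M
    unfolding G_def[abs_def] by (intro integrable_add integrable_mult_real majorant_integrable) auto
  have G: "(1 - s\<^sup>2) ^ l * (norm (chain \<phi> l s))\<^sup>2 \<le> G M s"
    if "amplitude M \<phi>" "l \<le> Suc k" "s \<in> unit_ival" for M \<phi> l s
  proof (cases "l = 0")
    case True
    have "(norm (V \<phi> s))\<^sup>2 \<le> (c * M)\<^sup>2"
      using c(2)[OF that(1)] by (intro power_mono) auto
    moreover have "0 \<le> E * M\<^sup>2 * majorant s"
      using majorant_nonneg[of s] that(3) by (auto simp: E_def)
    ultimately show ?thesis
      using True by (simp add: chain_def G_def)
  next
    case False
    then show ?thesis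
      using chain_majorant[OF that(1) _ that(2,3)] by (simp add: G_def E_def add_increasing)
  qed
  have G_val: "integral {-1..1} (G M) = M\<^sup>2 * (2 * c\<^sup>2 + E * N)" for M
  proof -
    have "integral {-1..1} (G M) = integral {-1..1::real} (\<lambda>s. (c * M)\<^sup>2)
        + integral {-1..1} (\<lambda>s. E * M\<^sup>2 * majorant s)"
      unfolding G_def[abs_def]
      by (rule Henstock_Kurzweil_Integration.integral_add[OF integrable_const_ivl
            integrable_mult_real[OF majorant_integrable]])
    then show ?thesis
      by (simp add: N_def algebra_simps power_mult_distrib)
  qed
  define A2 where "A2 = real (Suc (Suc k)) * (2 * c\<^sup>2 + E * N)"
  have A2: "A2 \<ge> 0"
    using N by (simp add: A2_def E_def)
  \<comment> \<open>The summand 1 makes the constant positive even if \<open>A2\<close> is 0; later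
    choices divide by it.\<close>
  have "V \<phi> \<in> Kspace (Suc k) \<and> Knorm (Suc k) (V \<phi>) \<le> (sqrt A2 + 1) * M"
    if \<phi>: "amplitude M \<phi>" for M \<phi>
  proof
    note weak = V_weak_deriv[OF \<phi>] and cont = V_continuous[OF \<phi>]
    show "V \<phi> \<in> Kspace (Suc k)"
      unfolding Kspace_def
    proof (intro CollectI conjI allI impI)
      show "s \<notin> {-1..1} \<Longrightarrow> V \<phi> s = 0" for s
        by (auto simp: twisted_def)
      show "\<exists>g. has_weak_deriv l (V \<phi>) g" if "l \<le> Suc k" for l
        using weak[OF that] by blast
      show "wdensity l l (V \<phi>) integrable_on {-1..1}" if "l \<le> Suc k" for l
        by (rule wdensity_integrableI[OF weak[OF that] cont G_int G[OF \<phi> that]])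
    qed (use cont V_odd[OF \<phi>] in auto)
    have "(\<Sum>l\<le>Suc k. wnorm_sq l l (V \<phi>)) \<le> (\<Sum>l\<le>Suc k. M\<^sup>2 * (2 * c\<^sup>2 + E * N))"
      using wnorm_sq_dominated[OF weak cont G_int G[OF \<phi>]] by (intro sum_mono) (auto simp: G_val)
    also have "\<dots> = M\<^sup>2 * A2"
      by (simp add: A2_def algebra_simps)
    finally have "Knorm (Suc k) (V \<phi>) \<le> sqrt (M\<^sup>2 * A2)"
      unfolding Knorm_def by (rule real_sqrt_le_mono)
    also have "\<dots> = sqrt A2 * M"
      using amplitudeD(6)[OF \<phi>] by (simp add: real_sqrt_mult)
    also have "\<dots> \<le> (sqrt A2 + 1) * M"
      using amplitudeD(6)[OF \<phi>] by (intro mult_right_mono) auto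
    finally show "Knorm (Suc k) (V \<phi>) \<le> (sqrt A2 + 1) * M" .
  qed
  moreover have "sqrt A2 + 1 > 0"
    using A2 by (simp add: add_nonneg_pos)
  ultimately show ?thesis
    using that by blast
qed

end

subsection \<open>The gliding hump\<close>

text \<open>\<open>R k\<close> is any real function of the coefficients that differs from the
  functional \<open>L k\<close> by a Lipschitz error with constant \<open>c / 4\<close>. Coefficient
  \<open>k\<close> is either 0 or \<open>a k\<close>. If the response \<open>R k\<close> is below
  \<open>c / 4 * a k\<close>, switching the coefficient on changes it by at least
  \<open>3 * c / 4 * a k\<close>, so that it becomes large. All later coefficients together are a
  small multiple of \<open>a k\<close> and spoil at most half of what was secured. The values of
  \<open>R k\<close> guide the construction, and no linearity of \<open>R k\<close> is used.\<close>

lemma gliding_hump: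
  fixes R L :: "nat \<Rightarrow> (nat \<Rightarrow> real) \<Rightarrow> real"
  assumes c: "c > 0" and A: "A \<ge> 0" and \<rho>: "\<rho> > 0"
    and L_bound: "\<And>k d. summable (\<lambda>n. \<bar>d n\<bar>) \<Longrightarrow> \<bar>L k d\<bar> \<le> A * (\<Sum>n. \<bar>d n\<bar>)"
    and L_single: "\<And>k a. a \<ge> 0 \<Longrightarrow> \<bar>L k (\<lambda>n. if n = k then a else 0)\<bar> \<ge> c * a"
    and R_approx: "\<And>k s s'. summable (\<lambda>n. \<bar>s n\<bar>) \<Longrightarrow> (\<Sum>n. \<bar>s n\<bar>) \<le> \<rho> \<Longrightarrow>
        summable (\<lambda>n. \<bar>s' n\<bar>) \<Longrightarrow> (\<Sum>n. \<bar>s' n\<bar>) \<le> \<rho> \<Longrightarrow>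
        \<bar>R k s' - R k s - L k (\<lambda>n. s' n - s n)\<bar> \<le> c / 4 * (\<Sum>n. \<bar>s' n - s n\<bar>)"
  defines "\<theta> \<equiv> c / (16 * (A + c))"
  shows "\<exists>s. summable (\<lambda>n. \<bar>s n\<bar>) \<and> (\<Sum>n. \<bar>s n\<bar>) \<le> \<rho> \<and>
    (\<forall>k. \<bar>R k s\<bar> \<ge> c / 16 * \<rho> * \<theta> ^ k)"
proof -
  have \<theta>: "0 < \<theta>" "\<theta> \<le> 1 / 16"
    using c A by (auto simp: \<theta>_def field_simps)
  \<comment> \<open>The factor 1/2 keeps the total of all humps, which is at most
    \<open>2 * a 0\<close>, within \<rho>.\<close>
  define a where "a k = \<rho> / 2 * \<theta> ^ k" for k
  have a_pos: "0 < a k" for k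
    using \<rho> \<theta> by (simp add: a_def)
  have a_sums: "(\<lambda>n. a (n + k)) sums (a k / (1 - \<theta>))" for k
  proof -
    have "(\<lambda>n. a k * \<theta> ^ n) sums (a k * (1 / (1 - \<theta>)))"
      using \<theta> by (intro sums_mult geometric_sums) auto
    moreover have "a k * \<theta> ^ n = a (n + k)" for n
      by (simp add: a_def power_add)
    ultimately show ?thesis
      by simp
  qed
  have a_sum_le: "(\<Sum>n. a (n + k)) \<le> 2 * a k" for k
  proof -
    have "a k / (1 - \<theta>) \<le> a k / (1 / 2)"
      using a_pos[of k] \<theta> by (intro divide_left_mono) auto
    then show ?thesis
      using sums_unique[OF a_sums[of k]] by simp
  qed
  have summ: "summable (\<lambda>n. \<bar>d n\<bar>)" "(\<Sum>n. \<bar>d n\<bar>) \<le> 2 * a k"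
    if "\<And>n. n < k \<Longrightarrow> d n = 0" "\<And>n. n \<ge> k \<Longrightarrow> \<bar>d n\<bar> \<le> a n" for d k
  proof -
    have sa: "summable (\<lambda>n. a (n + k))"
      using a_sums sums_summable by blast
    have "summable (\<lambda>n. \<bar>d (n + k)\<bar>)"
      by (rule summable_comparison_test'[OF sa]) (use that in auto)
    then show s: "summable (\<lambda>n. \<bar>d n\<bar>)"
      by (subst (asm) summable_iff_shift)
    have "(\<Sum>n. \<bar>d n\<bar>) = (\<Sum>n. \<bar>d (n + k)\<bar>)"
      using suminf_split_initial_segment[OF s, of k] that(1) by simp
    also have "\<dots> \<le> (\<Sum>n. a (n + k))"
      using that(2) \<open>summable (\<lambda>n. \<bar>d (n + k)\<bar>)\<close> sa by (intro suminf_le) auto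
    finally show "(\<Sum>n. \<bar>d n\<bar>) \<le> 2 * a k"
      using a_sum_le[of k] by linarith
  qed
  \<comment> \<open>Stage \<open>k\<close> fixes coefficient \<open>k\<close> for good, so the
    stages converge coordinatewise to \<open>s\<close>.\<close>
  define x where "x = rec_nat (\<lambda>_. 0)
    (\<lambda>k y. if \<bar>R k y\<bar> \<ge> c / 4 * a k then y else y(k := a k))"
  have x_0: "x 0 = (\<lambda>_. 0)"
    and x_Suc: "x (Suc k) = (if \<bar>R k (x k)\<bar> \<ge> c / 4 * a k then x k else (x k)(k := a k))" for k
    by (simp_all add: x_def)
  have x_zero: "x k n = 0" if "k \<le> n" for k n
    using that by (induction k) (auto simp: x_0 x_Suc)
  have x_le: "0 \<le> x k n" "x k n \<le> a n" for k n
    using a_pos[THEN less_imp_le] by (induction k) (auto simp: x_0 x_Suc)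
  define s where "s n = x (Suc n) n" for n
  have x_s: "x k n = s n" if "n < k" for k n
    using that by (induction k) (auto simp: s_def less_Suc_eq x_Suc[of "Suc _"] x_Suc)
  have ball: "summable (\<lambda>n. \<bar>d n\<bar>)" "(\<Sum>n. \<bar>d n\<bar>) \<le> \<rho>" if "\<And>n. 0 \<le> d n" "\<And>n. d n \<le> a n" for d
    using summ[of 0 d] that by (auto simp: a_def)
  have s_le: "0 \<le> s n" "s n \<le> a n" for n
    using x_le by (auto simp: s_def)
  have "\<bar>R k s\<bar> \<ge> c / 16 * \<rho> * \<theta> ^ k" for k
  proof -
    have hit: "\<bar>R k (x (Suc k))\<bar> \<ge> c / 4 * a k"
    proof (cases "\<bar>R k (x k)\<bar> \<ge> c / 4 * a k")
      case True
      then show ?thesis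
        by (simp add: x_Suc)
    next
      case False
      have diff: "x (Suc k) n - x k n = (if n = k then a k else 0)" for n
        using False x_zero[of k k] by (auto simp: x_Suc)
      have "(\<lambda>n. \<bar>if n = k then a k else 0\<bar>) sums a k"
        using sums_single[of k "\<lambda>_. a k"] a_pos[of k] by (simp add: if_distrib[of abs] cong: if_cong)
      then have "\<bar>R k (x (Suc k)) - R k (x k) - L k (\<lambda>n. if n = k then a k else 0)\<bar> \<le> c / 4 * a k"
        using R_approx[of "x k" "x (Suc k)" k, OF ball[OF x_le] ball[OF x_le]]
        unfolding diff by (simp add: sums_iff)
      moreover have "\<bar>L k (\<lambda>n. if n = k then a k else 0)\<bar> \<ge> c * a k"
        using L_single a_pos less_imp_le by blast
      moreover have "c * a k > 0"
        using c a_pos by simp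
      ultimately show ?thesis
        using False by (simp add: abs_if split: if_splits)
    qed
    let ?d = "\<lambda>n. s n - x (Suc k) n"
    have d: "summable (\<lambda>n. \<bar>?d n\<bar>)" "(\<Sum>n. \<bar>?d n\<bar>) \<le> 2 * a (Suc k)"
      using summ[of "Suc k" ?d] x_s x_zero s_le by auto
    have "\<bar>R k s - R k (x (Suc k))\<bar> \<le> \<bar>L k ?d\<bar> + c / 4 * (\<Sum>n. \<bar>?d n\<bar>)"
      using R_approx[of "x (Suc k)" s k, OF ball[OF x_le] ball[OF s_le]] by linarith
    also have "\<dots> \<le> A * (\<Sum>n. \<bar>?d n\<bar>) + c / 4 * (\<Sum>n. \<bar>?d n\<bar>)"
      using L_bound[OF d(1)] by simp
    also have "\<dots> = (A + c / 4) * (\<Sum>n. \<bar>?d n\<bar>)"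
      by (simp add: algebra_simps)
    also have "\<dots> \<le> (A + c) * (2 * a (Suc k))"
      using A c d(2) a_pos[of "Suc k"] suminf_nonneg[OF d(1)] by (intro mult_mono) auto
    also have "\<dots> = 2 * ((A + c) * \<theta>) * a k"
      by (simp add: a_def)
    \<comment> \<open>This equation is the origin of \<theta>: the tail costs at most
      \<open>c / 8 * a k\<close>, half of the \<open>c / 4 * a k\<close> reached at stage
      \<open>k\<close>.\<close>
    also have "(A + c) * \<theta> = c / 16"
      using A c by (simp add: \<theta>_def field_simps)
    finally have "\<bar>R k s\<bar> \<ge> c / 8 * a k"
      using hit by (simp add: abs_if split: if_splits)
    then show ?thesis
      by (simp add: a_def)
  qed
  then show ?thesis
    using ball[OF s_le] by blast
qed

subsection \<open>Trigonometric amplitudes\<close>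

text \<open>The \<open>l\<close>-th derivative of \<open>cos (\<nu> * x)\<close> divided by the
  \<open>k\<close>-th power of \<nu>: order \<open>k\<close> has size 1, and each lower order gains
  a factor \<open>1 / \<nu>\<close>. The quotient of powers expresses a negative exponent.\<close>

definition mode :: "nat \<Rightarrow> real \<Rightarrow> nat \<Rightarrow> real \<Rightarrow> real" where
  "mode k \<nu> l x = \<nu> ^ l / \<nu> ^ k * cos (\<nu> * x + real l * (pi / 2))"

lemma mode_deriv:
  "(mode k \<nu> l has_real_derivative mode k \<nu> (Suc l) x) (at x)"
proof -
  have "cos (\<nu> * x + real (Suc l) * (pi / 2)) = - sin (\<nu> * x + real l * (pi / 2))"
    using minus_sin_cos_eq[of "\<nu> * x + real l * (pi / 2)"] by (simp add: algebra_simps add_divide_distrib)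
  moreover have "(mode k \<nu> l has_real_derivative
      \<nu> ^ l / \<nu> ^ k * (- sin (\<nu> * x + real l * (pi / 2)) * \<nu>)) (at x)"
    unfolding mode_def[abs_def] by (rule derivative_eq_intros refl | simp)+
  ultimately show ?thesis
    by (simp add: mode_def mult_ac)
qed

lemma mode_bound:
  assumes "\<nu> \<ge> 1" "l + j \<le> k"
  shows "\<bar>mode k \<nu> l x\<bar> \<le> 1 / \<nu> ^ j"
proof -
  have "\<nu> ^ l / \<nu> ^ k = 1 / \<nu> ^ (k - l)"
    using assms by (simp add: power_diff)
  also have "\<dots> \<le> 1 / \<nu> ^ j"
    using assms by (intro divide_left_mono power_increasing mult_pos_pos zero_less_power) auto
  finally have "\<nu> ^ l / \<nu> ^ k * \<bar>cos (\<nu> * x + real l * (pi / 2))\<bar> \<le> 1 / \<nu> ^ j * 1"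
    using assms by (intro mult_mono) auto
  then show ?thesis
    using assms by (simp add: mode_def abs_mult)
qed

definition trig :: "nat \<Rightarrow> (nat \<Rightarrow> real) \<Rightarrow> (nat \<Rightarrow> real) \<Rightarrow> nat \<Rightarrow> real \<Rightarrow> real" where
  "trig k N a l x = (\<Sum>n. a n * mode k (N n) l x)"

lemma trig_term_bound:
  assumes "\<And>n. N n \<ge> 1" "l \<le> k"
  shows "\<bar>a n * mode k (N n) l x\<bar> \<le> \<bar>a n\<bar>"
  using mode_bound[OF assms(1), of l 0 k n x] assms(2)
  by (auto simp: abs_mult intro: mult_left_le)

lemma trig_term_summable:
  assumes "\<And>n. N n \<ge> 1" "l \<le> k" "summable (\<lambda>n. \<bar>a n\<bar>)"
  shows "summable (\<lambda>n. \<bar>a n * mode k (N n) l x\<bar>)" "summable (\<lambda>n. a n * mode k (N n) l x)"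
proof -
  show "summable (\<lambda>n. \<bar>a n * mode k (N n) l x\<bar>)"
    by (rule summable_comparison_test'[OF assms(3)]) (use trig_term_bound[OF assms(1,2)] in auto)
  then show "summable (\<lambda>n. a n * mode k (N n) l x)"
    by (rule summable_rabs_cancel)
qed

text \<open>Termwise differentiation. Up to order \<open>k\<close> the normalisation of the modes
  keeps every term below \<open>\<bar>a n\<bar>\<close> whatever the frequencies, so the Weierstrass
  test applies.\<close>

lemma trig_deriv:
  assumes "\<And>n. N n \<ge> 1" "l < k" "summable (\<lambda>n. \<bar>a n\<bar>)"
  shows "(trig k N a l has_real_derivative trig k N a (Suc l) x) (at x)"
  unfolding trig_def[abs_def]
proof (rule has_field_derivative_series'[where S = UNIV and ?x0.0 = 0])
  show "uniformly_convergent_on UNIV (\<lambda>n x. \<Sum>i<n. a i * mode k (N i) (Suc l) x)"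
    by (rule Weierstrass_m_test'[OF _ assms(3)]) (use assms trig_term_bound[of N "Suc l" k a] in auto)
qed (use assms in \<open>auto intro!: DERIV_cmult mode_deriv trig_term_summable\<close>)

lemma trig_continuous:
  assumes "\<And>n. N n \<ge> 1" "l \<le> k" "summable (\<lambda>n. \<bar>a n\<bar>)"
  shows "continuous_on UNIV (trig k N a l)"
  unfolding trig_def[abs_def]
proof (rule uniform_limit_theorem)
  show "uniform_limit UNIV (\<lambda>n x. \<Sum>i<n. a i * mode k (N i) l x)
      (\<lambda>x. \<Sum>n. a n * mode k (N n) l x) sequentially"
    by (rule Weierstrass_m_test[OF _ assms(3)]) (use assms trig_term_bound[of N l k a] in auto)
  show "\<forall>\<^sub>F n in sequentially. continuous_on UNIV (\<lambda>x. \<Sum>i<n. a i * mode k (N i) l x)"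
    unfolding mode_def by (intro always_eventually allI continuous_intros)
qed auto

lemma trig_bound:
  assumes "\<And>n. N n \<ge> 1" "l \<le> k" "summable (\<lambda>n. \<bar>a n\<bar>)"
  shows "\<bar>trig k N a l x\<bar> \<le> (\<Sum>n. \<bar>a n\<bar>)"
proof -
  have "\<bar>trig k N a l x\<bar> \<le> (\<Sum>n. \<bar>a n * mode k (N n) l x\<bar>)"
    unfolding trig_def by (rule summable_rabs[OF trig_term_summable(1)[OF assms]])
  also have "\<dots> \<le> (\<Sum>n. \<bar>a n\<bar>)"
    by (rule suminf_le[OF _ trig_term_summable(1)[OF assms] assms(3)])
       (rule trig_term_bound[OF assms(1,2)])
  finally show ?thesis .
qed

lemma trig_add:
  assumes "\<And>n. N n \<ge> 1" "l \<le> k" "summable (\<lambda>n. \<bar>a n\<bar>)" "summable (\<lambda>n. \<bar>a' n\<bar>)"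
  shows "trig k N (\<lambda>n. a n + a' n) l x = trig k N a l x + trig k N a' l x"
  unfolding trig_def
  by (subst suminf_add) (use assms in \<open>auto intro!: trig_term_summable simp: algebra_simps\<close>)

lemma trig_scale:
  assumes "\<And>n. N n \<ge> 1" "l \<le> k" "summable (\<lambda>n. \<bar>a n\<bar>)"
  shows "trig k N (\<lambda>n. c * a n) l x = c * trig k N a l x"
  unfolding trig_def
  by (subst suminf_mult[symmetric]) (use assms in \<open>auto intro!: trig_term_summable simp: algebra_simps\<close>)

lemma trig_single: "trig k N (\<lambda>n. if n = j then a else 0) l x = a * mode k (N j) l x"
proof -
  have "(\<lambda>n. if n = j then a * mode k (N n) l x else 0) sums (a * mode k (N j) l x)"
    using sums_single[of j "\<lambda>n. a * mode k (N n) l x"] .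
  then show ?thesis
    unfolding trig_def by (simp add: sums_iff if_distrib[of "\<lambda>y. y * _"] cong: if_cong)
qed

context twist
begin

text \<open>The bound is the sum of the absolute coefficients. Hence the norm of the resulting
  tangent vector is controlled uniformly in the frequencies, which leaves them free to be chosen
  later.\<close>

lemma amplitude_trig:
  assumes "\<And>n. N n \<ge> 1" "summable (\<lambda>n. \<bar>a n\<bar>)"
  shows "amplitude (\<Sum>n. \<bar>a n\<bar>) (trig k N a)"
  unfolding amplitude_def
proof (intro conjI allI impI)
  have "mode k \<nu> 0 (- s) = mode k \<nu> 0 s" for \<nu> s
    by (simp add: mode_def)
  then show "trig k N a 0 (- s) = trig k N a 0 s" for s
    by (simp add: trig_def)
  have "cos (pi / 2 - y) = - cos (y + pi / 2)" for y :: real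
    by (simp add: cos_add cos_diff)
  then have "mode k \<nu> 1 (- s) = - mode k \<nu> 1 s" for \<nu> s
    by (simp add: mode_def)
  then show "trig k N a 1 (- s) = - trig k N a 1 s" for s
    unfolding trig_def
    by (subst suminf_minus[symmetric]) (use assms k in \<open>auto intro!: trig_term_summable\<close>)
qed (use assms in \<open>auto intro!: trig_deriv trig_continuous trig_bound\<close>)

lemma amplitude_mode:
  assumes "\<nu> \<ge> 1"
  shows "amplitude 1 (mode k \<nu>)"
proof -
  have 1: "(\<lambda>n. \<bar>if n = 0 then 1 else 0 :: real\<bar>) sums 1"
    using sums_single[of 0 "\<lambda>_. 1 :: real"] by (simp add: if_distrib[of abs] cong: if_cong)
  have "trig k (\<lambda>_. \<nu>) (\<lambda>n. if n = 0 then 1 else 0) = mode k \<nu>"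
    by (intro ext) (simp add: trig_single)
  then show ?thesis
    using amplitude_trig[of "\<lambda>_. \<nu>" "\<lambda>n. if n = 0 then 1 else 0"] assms 1
    by (simp add: sums_iff)
qed

lemma V_add:
  assumes \<phi>: "amplitude M \<phi>" and \<psi>: "amplitude M' \<psi>"
    and sum: "\<And>l s. l \<le> k \<Longrightarrow> \<omega> l s = \<phi> l s + \<psi> l s"
  shows "V \<omega> = (\<lambda>s. V \<phi> s + V \<psi> s)"
proof
  fix s
  have int: "(\<lambda>r. \<phi> 1 r *\<^sub>R b 0 r) integrable_on {-1..d}" if "amplitude M \<phi>" "d \<in> {-1..1}" for M \<phi> d
    by (intro integrable_continuous_real continuous_on_subset[OF integrand_continuous[OF that(1)]])
       (use that(2) in auto)
  have "integral {-1..d} (\<lambda>r. \<omega> 1 r *\<^sub>R b 0 r)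
      = integral {-1..d} (\<lambda>r. \<phi> 1 r *\<^sub>R b 0 r) + integral {-1..d} (\<lambda>r. \<psi> 1 r *\<^sub>R b 0 r)"
    if "d \<in> {-1..1}" for d
    using Henstock_Kurzweil_Integration.integral_add[OF int[OF \<phi> that] int[OF \<psi> that]] k
    by (simp add: sum scaleR_add_left)
  from this[of s] this[of 0] show "V \<omega> s = V \<phi> s + V \<psi> s"
    by (auto simp: twisted_def sum algebra_simps)
qed

lemma V_scale:
  assumes scale: "\<And>l s. l \<le> k \<Longrightarrow> \<omega> l s = c * \<phi> l s"
  shows "V \<omega> = (\<lambda>s. c *\<^sub>R V \<phi> s)"
proof
  fix s
  have "integral {-1..d} (\<lambda>r. \<omega> 1 r *\<^sub>R b 0 r)
      = c *\<^sub>R integral {-1..d} (\<lambda>r. \<phi> 1 r *\<^sub>R b 0 r)" for d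
    using k by (simp add: scale flip: scaleR_scaleR)
  from this[of s] this[of 0] show "V \<omega> s = c *\<^sub>R V \<phi> s"
    by (auto simp: twisted_def scale algebra_simps)
qed

end

subsection \<open>Response of the functionals to a single frequency\<close>

text \<open>At the points \<open>\<pi>/8 + j\<pi>/\<nu>\<close> the top-order amplitude \<open>cos (\<nu>s + (k - 1)\<pi>/2)\<close> of a mode of
  this frequency equals \<open>\<plusminus>(-1)\<^sup>j\<close>.\<close>
definition freq :: "nat \<Rightarrow> nat \<Rightarrow> real" where
  "freq k r = 4 * (2 * real r + real k + 1)"

text \<open>The number of full periods \<open>2 * pi / \<nu>\<close> that fit between
  \<open>pi / 8\<close> and \<open>q\<close>.\<close>

definition steps :: "real \<Rightarrow> real \<Rightarrow> nat" where
  "steps q \<nu> = nat \<lfloor>\<nu> * (q - pi / 8) / (2 * pi)\<rfloor>"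

lemma freq_ge: "freq k r \<ge> 1" "freq k r \<ge> real r"
  by (auto simp: freq_def)

lemma steps_bounds:
  assumes "pi / 8 < q" "\<nu> \<ge> 1"
  shows "pi / 8 + real (2 * steps q \<nu>) * (pi / \<nu>) \<le> q"
    and "real (steps q \<nu>) \<ge> \<nu> * (q - pi / 8) / (2 * pi) - 1"
proof -
  define y where "y = \<nu> * (q - pi / 8) / (2 * pi)"
  have y: "0 \<le> y"
    using assms by (simp add: y_def)
  have J: "real (steps q \<nu>) = of_int \<lfloor>y\<rfloor>"
    using y by (simp add: steps_def y_def)
  then have "real (steps q \<nu>) * (2 * (pi / \<nu>)) \<le> y * (2 * (pi / \<nu>))"
    using assms by (intro mult_right_mono) auto
  also have "\<dots> = q - pi / 8"
    using assms by (simp add: y_def)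
  finally show "pi / 8 + real (2 * steps q \<nu>) * (pi / \<nu>) \<le> q"
    by (simp add: algebra_simps)
  show "real (steps q \<nu>) \<ge> \<nu> * (q - pi / 8) / (2 * pi) - 1"
    unfolding J y_def[symmetric] by linarith
qed

text \<open>The form of \<open>freq\<close> makes the phase at \<open>pi / 8\<close> equal to
  \<open>(2 * r + k + 1) * pi / 2\<close>. With the shift \<open>(k - 1) * pi / 2\<close> from
  differentiation this is \<open>(r + k) * pi\<close>, and each grid step adds \<pi>.\<close>

lemma mode_grid:
  fixes k r j :: nat
  assumes "k \<ge> 1"
  defines "\<nu> \<equiv> freq k r"
  shows "mode k \<nu> (k - 1) (pi / 8 + real j * (pi / \<nu>)) = (- 1) ^ (r + k + j) / \<nu>"
proof -
  have \<nu>: "\<nu> > 0"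
    using freq_ge(1)[of k r] by (simp add: \<nu>_def)
  have "\<nu> * (pi / 8 + real j * (pi / \<nu>)) + real (k - 1) * (pi / 2) = \<nu> * pi / 8 + real j * pi + real (k - 1) * (pi / 2)"
    using \<nu> by (simp add: field_simps)
  also have "\<dots> = real (r + k + j) * pi"
    using assms(1) by (simp add: \<nu>_def freq_def of_nat_diff field_simps)
  finally have "cos (\<nu> * (pi / 8 + real j * (pi / \<nu>)) + real (k - 1) * (pi / 2)) = (- 1) ^ (r + k + j)"
    by (simp only: cos_npi)
  moreover have "\<nu> ^ (k - 1) / \<nu> ^ k = 1 / \<nu>"
    using \<nu> assms(1) by (cases k) auto
  ultimately show ?thesis
    by (simp add: mode_def)
qed

context twist
begin

text \<open>At the grid points the \<open>k\<close>-th derivative of the curve is an alternating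
  sign times \<open>b 1\<close> divided by \<nu>, up to an error of order 1 over the square of
  \<nu>. As component \<open>i\<close> of \<open>b 1\<close> keeps its sign, the square wave adds up
  all increments without cancellation. Each contributes at least \<open>\<beta>0 / \<nu>\<close>,
  and their number is proportional to \<nu>, so the total stays bounded below.\<close>

lemma osc_mode_lower:
  assumes q: "pi / 8 < q" "q < 1" and \<beta>0: "\<beta>0 > 0" and sg: "\<bar>sg\<bar> = (1 :: real)"
    and \<beta>: "\<And>s. s \<in> {pi / 8..q} \<Longrightarrow> \<beta>0 \<le> sg * (b 1 s $ i)"
  obtains c r0 where "c > 0"
    "\<And>r. r \<ge> r0 \<Longrightarrow>
      c \<le> \<bar>osc k i (pi / 8) (pi / freq k r) (steps q (freq k r)) (V (mode k (freq k r)))\<bar>"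
proof -
  define p :: real where "p = pi / 8"
  have p: "0 < p" "p < q"
    using q by (auto simp: p_def)
  have "continuous_on {p..q} (\<lambda>s. \<Sum>l=1..k. norm (b l s))"
  proof (intro continuous_on_sum continuous_on_norm)
    fix l assume "l \<in> {1..k}"
    then show "continuous_on {p..q} (b l)"
      by (intro continuous_on_subset[OF b_continuous]) (use p q in auto)
  qed
  then have "bounded ((\<lambda>s. \<Sum>l=1..k. norm (b l s)) ` {p..q})"
    by (intro compact_imp_bounded compact_continuous_image) auto
  then obtain E0 where "E0 > 0" "\<forall>y \<in> (\<lambda>s. \<Sum>l=1..k. norm (b l s)) ` {p..q}. norm y \<le> E0"
    unfolding bounded_pos by blast
  then have E0: "E0 > 0" "\<And>s. s \<in> {p..q} \<Longrightarrow> (\<Sum>l=1..k. norm (b l s)) \<le> E0"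
    by (auto simp del: sum.cl_ivl_Suc intro: order_trans[OF abs_ge_self])
  define E where "E = 2 ^ (k - 1) * E0"
  have E: "E > 0"
    using E0 by (simp add: E_def)
  \<comment> \<open>The first entry makes the error terms at most half of the main term; the second
    ensures that rounding down in \<open>steps\<close> loses at most half of the periods.\<close>
  define r0 where "r0 = nat \<lceil>max (2 * E / \<beta>0) (4 * pi / (q - p))\<rceil>"
  define c where "c = \<beta>0 * (q - p) / (2 * pi)"
  have "c > 0"
    using p \<beta>0 by (simp add: c_def)
  moreover have "c \<le> \<bar>osc k i (pi / 8) (pi / freq k r) (steps q (freq k r)) (V (mode k (freq k r)))\<bar>"
    if r: "r \<ge> r0" for r
  proof -
    define \<nu> where "\<nu> = freq k r"
    define h where "h = pi / \<nu>"
    define J where "J = steps q \<nu>"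
    have \<nu>1: "\<nu> \<ge> 1"
      by (simp add: \<nu>_def freq_ge)
    have "max (2 * E / \<beta>0) (4 * pi / (q - p)) \<le> real r0"
      unfolding r0_def by (rule real_nat_ceiling_ge)
    also have "\<dots> \<le> \<nu>"
      using r freq_ge(2)[of r k] by (simp add: \<nu>_def)
    finally have \<nu>E: "2 * E \<le> \<nu> * \<beta>0" and \<nu>J: "4 * pi \<le> \<nu> * (q - p)"
      using \<beta>0 p by (auto simp: field_simps)
    have h: "h > 0"
      using \<nu>1 by (simp add: h_def)
    have J: "p + real (2 * J) * h \<le> q" "real J \<ge> \<nu> * (q - p) / (2 * pi) - 1"
      using steps_bounds[OF q(1) \<nu>1] by (auto simp: p_def h_def J_def)
    define x where "x j = p + real j * h" for j
    have x: "x j \<in> {p..q}" "x j \<in> unit_ival" if "j \<le> 2 * J" for j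
      using grid_in_unit_ival[OF less_imp_le[OF p(1)] J(1) q(2) h that] by (auto simp: x_def)
    note \<phi> = amplitude_mode[OF \<nu>1]
    let ?G = "\<lambda>j. cderiv k (V (mode k \<nu>)) (x j) $ i"
    define \<beta>' where "\<beta>' j = sg * (b 1 (x j) $ i)" for j
    define e where "e j = ?G j - (- 1) ^ (r + k + j) / \<nu> * (b 1 (x j) $ i)" for j
    have e: "\<bar>e j\<bar> \<le> E / \<nu>\<^sup>2" if j: "j \<le> 2 * J" for j
    proof -
      obtain k' where k': "k = Suc k'"
        using k by (cases k) auto
      have "cderiv k (V (mode k \<nu>)) (x j) = leibniz (mode k \<nu>) b (k - 1) 0 1 (x j)"
        using V_cderiv[OF \<phi>, of k "x j"] x(2)[OF j] by (simp add: chain_def k')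
      moreover have "(- 1) ^ (r + k + j) / \<nu> = mode k \<nu> (0 + (k - 1)) (x j)"
        using mode_grid[OF k, of r j] by (simp add: \<nu>_def x_def p_def h_def)
      ultimately have "e j = (leibniz (mode k \<nu>) b (k - 1) 0 1 (x j)
          - mode k \<nu> (0 + (k - 1)) (x j) *\<^sub>R b 1 (x j)) $ i"
        by (simp add: e_def)
      also have "\<bar>\<dots>\<bar> \<le> norm (leibniz (mode k \<nu>) b (k - 1) 0 1 (x j)
          - mode k \<nu> (0 + (k - 1)) (x j) *\<^sub>R b 1 (x j))"
        by (rule component_le_norm_cart)
      also have "\<dots> \<le> 2 ^ (k - 1) * (1 / \<nu>\<^sup>2) * (\<Sum>l=1..1 + (k - 1). norm (b l (x j)))"
        using \<nu>1 by (intro leibniz_leading mode_bound) auto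
      also have "\<dots> \<le> 2 ^ (k - 1) * (1 / \<nu>\<^sup>2) * E0"
        using E0(2)[OF x(1)[OF j]] k by (intro mult_left_mono) auto
      finally show ?thesis
        by (simp add: E_def)
    qed
    \<comment> \<open>The common sign of all terms of the alternating sum. The minus arises because
      an increment starts at the sign \<open>(- 1) ^ j\<close> and ends at the opposite one.\<close>
    define \<tau> where "\<tau> = - ((- 1) ^ (r + k)) * sg"
    have \<tau>: "\<bar>\<tau>\<bar> = 1"
      using sg by (simp add: \<tau>_def abs_mult)
    have sg2: "sg * sg = 1"
      using sg by (metis abs_mult_self_eq mult_1)
    have "c \<le> 2 * real J * (\<beta>0 / \<nu>)"
    proof -
      have "\<nu> * (q - p) / (4 * pi) \<le> real J"
        using J(2) \<nu>J by (simp add: field_simps)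
      then have "2 * (\<nu> * (q - p) / (4 * pi)) * (\<beta>0 / \<nu>) \<le> 2 * real J * (\<beta>0 / \<nu>)"
        using \<beta>0 \<nu>1 by (intro mult_right_mono) auto
      then show ?thesis
        using \<nu>1 by (simp add: c_def mult.commute)
    qed
    also have "\<dots> = (\<Sum>j<2 * J. \<beta>0 / \<nu>)"
      by simp
    also have "\<dots> \<le> (\<Sum>j<2 * J. \<tau> * ((- 1) ^ j * (?G (Suc j) - ?G j)))"
    proof (rule sum_mono)
      fix j assume "j \<in> {..<2 * J}"
      then have j: "j \<le> 2 * J" "Suc j \<le> 2 * J"
        by auto
      have G: "?G j = (- 1) ^ (r + k + j) / \<nu> * (b 1 (x j) $ i) + e j" for j
        by (simp add: e_def)
      have sq: "(- 1 :: real) ^ n * (- 1) ^ n = 1" for n :: nat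
        by (metis mult.commute power_minus1_even power_even_eq power2_eq_square power_add mult_2)
      have "\<tau> * ((- 1) ^ j * (?G (Suc j) - ?G j))
          = ((- 1) ^ (r + k) * (- 1) ^ (r + k)) * ((- 1) ^ j * (- 1) ^ j) * (\<beta>' (Suc j) + \<beta>' j) / \<nu>
            + \<tau> * (- 1) ^ j * (e (Suc j) - e j)"
        unfolding G by (simp add: \<tau>_def \<beta>'_def power_add algebra_simps add_divide_distrib diff_divide_distrib)
      also have "\<dots> = (\<beta>' (Suc j) + \<beta>' j) / \<nu> + \<tau> * (- 1) ^ j * (e (Suc j) - e j)"
        unfolding sq by simp
      also have "\<dots> \<ge> (\<beta>0 + \<beta>0) / \<nu> - 2 * (E / \<nu>\<^sup>2)"
      proof -
        have "\<beta>0 \<le> \<beta>' j" "\<beta>0 \<le> \<beta>' (Suc j)"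
          using \<beta> x(1)[OF j(1)] x(1)[OF j(2)] by (auto simp: \<beta>'_def p_def)
        then have "(\<beta>0 + \<beta>0) / \<nu> \<le> (\<beta>' (Suc j) + \<beta>' j) / \<nu>"
          using \<nu>1 by (intro divide_right_mono) auto
        moreover have "\<bar>\<tau> * (- 1) ^ j * (e (Suc j) - e j)\<bar> \<le> 2 * (E / \<nu>\<^sup>2)"
          using e[OF j(1)] e[OF j(2)] \<tau> by (simp add: abs_mult)
        ultimately show ?thesis
          by linarith
      qed
      finally have "(\<beta>0 + \<beta>0) / \<nu> - 2 * (E / \<nu>\<^sup>2) \<le> \<tau> * ((- 1) ^ j * (?G (Suc j) - ?G j))" .
      moreover have "2 * (E / \<nu>\<^sup>2) \<le> \<beta>0 / \<nu>"
        using \<nu>E \<nu>1 by (simp add: field_simps power2_eq_square)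
      ultimately show "\<beta>0 / \<nu> \<le> \<tau> * ((- 1) ^ j * (?G (Suc j) - ?G j))"
        by (simp add: add_divide_distrib)
    qed
    also have "\<dots> = \<tau> * osc k i p h J (V (mode k \<nu>))"
      by (simp add: osc_def sum_distrib_left x_def)
    also have "\<dots> \<le> \<bar>osc k i p h J (V (mode k \<nu>))\<bar>"
      using \<tau> by (metis abs_ge_self abs_mult mult_1)
    finally show ?thesis
      by (simp add: p_def h_def J_def \<nu>_def)
  qed
  ultimately show ?thesis
    using that by blast
qed

end

subsection \<open>Rescaling of solutions\<close>

lemma vector_derivative_scaleR_Kspace:
  assumes "f \<in> Kspace (Suc (Suc k))" "s \<in> unit_ival"
  shows "vector_derivative (\<lambda>s. c *\<^sub>R f s) (at s) = c *\<^sub>R vector_derivative f (at s)"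
  using bounded_linear.has_vector_derivative[OF bounded_linear_scaleR_right
      Kspace_has_vector_derivative[OF assms]]
  by (rule vector_derivative_at)

lemma tangent_scaleR:
  assumes "f \<in> tangent m \<gamma>" "m \<ge> 2"
  shows "(\<lambda>s. c *\<^sub>R f s) \<in> tangent m \<gamma>"
proof -
  obtain k where "m = Suc (Suc k)"
    using assms(2) by (metis Suc_le_D numeral_2_eq_2 Suc_le_mono)
  then show ?thesis
    using assms(1) vector_derivative_scaleR_Kspace[of f k _ c] Kspace_scaleR[of f m c]
    by (auto simp: tangent_def)
qed

lemma Knorm_zero:
  assumes "(0 :: real \<Rightarrow> real ^ 'n) \<in> Kspace m"
  shows "Knorm m (0 :: real \<Rightarrow> real ^ 'n) = 0"
  using Knorm_scaleR[OF assms, of 0] by (simp add: zero_fun_def)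

lemma filterlim_mult_at:
  fixes c t :: real
  assumes "c \<noteq> 0"
  shows "filterlim (\<lambda>r. c * r) (at (c * t)) (at t)"
  unfolding filterlim_at
proof
  show "((\<lambda>r. c * r) \<longlongrightarrow> c * t) (at t)"
    by (intro tendsto_intros)
  show "\<forall>\<^sub>F r in at t. c * r \<in> UNIV \<and> c * r \<noteq> c * t"
    using assms by (simp add: eventually_at_filter)
qed

text \<open>Both equations are invariant under rescaling of time if the velocity is multiplied by
  \<open>c\<close> and the tension by the square of \<open>c\<close>: acceleration and squared
  angular velocity carry this same factor.\<close>

lemma whip_solution_rescale:
  fixes \<gamma> w :: "real \<Rightarrow> real ^ 'n"
  assumes sol: "whip_solution m \<gamma> w T \<eta>" and c: "c > 0" and m: "m \<ge> 2"
  shows "whip_solution m \<gamma> (\<lambda>s. c *\<^sub>R w s) (T / c) (\<lambda>t. \<eta> (c * t))"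
proof -
  obtain k where k: "m = Suc (Suc k)"
    using m by (metis Suc_le_D numeral_2_eq_2 Suc_le_mono)
  obtain v \<sigma> where init: "\<eta> 0 = \<gamma>" "v 0 = w"
    and arcs: "\<And>t. t \<in> {-T<..<T} \<Longrightarrow> \<eta> t \<in> arcs (m + 1)"
    and tang: "\<And>t. t \<in> {-T<..<T} \<Longrightarrow> v t \<in> tangent m (\<eta> t)"
    and cont: "\<And>t. t \<in> {-T<..<T} \<Longrightarrow> ((\<lambda>r. Knorm (m + 1) (\<eta> r - \<eta> t)) \<longlongrightarrow> 0) (at t)"
    and diff: "\<And>t. t \<in> {-T<..<T} \<Longrightarrow>
      ((\<lambda>h. Knorm m (\<lambda>s. (\<eta> (t + h) s - \<eta> t s) /\<^sub>R h - v t s)) \<longlongrightarrow> 0) (at 0)"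
    and vcont: "\<And>t. t \<in> {-T<..<T} \<Longrightarrow> ((\<lambda>r. Knorm m (v r - v t)) \<longlongrightarrow> 0) (at t)"
    and tens: "\<And>t. t \<in> {-T<..<T} \<Longrightarrow> is_tension (\<eta> t) (v t) (\<sigma> t)"
    and wave: "\<And>t s. t \<in> {-T<..<T} \<Longrightarrow> s \<in> unit_ival \<Longrightarrow> \<exists>a.
      ((\<lambda>r. v r s) has_vector_derivative a) (at t) \<and>
      ((\<lambda>r. \<sigma> t r *\<^sub>R vector_derivative (\<eta> t) (at r)) has_vector_derivative a) (at s)"
    using sol unfolding whip_solution_def by blast
  have K: "\<eta> t \<in> Kspace m" "v t \<in> Kspace m" if "t \<in> {-T<..<T}" for t
    using arcs[OF that] tang[OF that] Kspace_mono[of m "m + 1"]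
    by (auto simp: arcs_def tangent_def)
  define v' where "v' t s = c *\<^sub>R v (c * t) s" for t s
  define \<sigma>' where "\<sigma>' t s = c\<^sup>2 * \<sigma> (c * t) s" for t s
  have "\<eta> (c * t) \<in> arcs (m + 1) \<and> v' t \<in> tangent m (\<eta> (c * t)) \<and>
      ((\<lambda>r. Knorm (m + 1) (\<eta> (c * r) - \<eta> (c * t))) \<longlongrightarrow> 0) (at t) \<and>
      ((\<lambda>h. Knorm m (\<lambda>s. (\<eta> (c * (t + h)) s - \<eta> (c * t) s) /\<^sub>R h - v' t s)) \<longlongrightarrow> 0) (at 0) \<and>
      ((\<lambda>r. Knorm m (v' r - v' t)) \<longlongrightarrow> 0) (at t) \<and>
      is_tension (\<eta> (c * t)) (v' t) (\<sigma>' t) \<and>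
      (\<forall>s\<in>unit_ival. \<exists>a.
         ((\<lambda>r. v' r s) has_vector_derivative a) (at t) \<and>
         ((\<lambda>r. \<sigma>' t r *\<^sub>R vector_derivative (\<eta> (c * t)) (at r)) has_vector_derivative a) (at s))"
    if t: "t \<in> {- (T / c)<..<T / c}" for t
  proof (intro conjI ballI)
    define u where "u = c * t"
    have u: "u \<in> {-T<..<T}"
      using t c by (auto simp: u_def field_simps)
    show "\<eta> (c * t) \<in> arcs (m + 1)"
      using arcs[OF u] by (simp add: u_def)
    show "v' t \<in> tangent m (\<eta> (c * t))"
      using tangent_scaleR[OF tang[OF u] m, of c] by (simp add: u_def v'_def[abs_def])
    show "((\<lambda>r. Knorm (m + 1) (\<eta> (c * r) - \<eta> (c * t))) \<longlongrightarrow> 0) (at t)"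
      using filterlim_compose[OF cont[OF u, unfolded u_def] filterlim_mult_at[of c t]] c by simp
    \<comment> \<open>\<open>Knorm_scaleR\<close> needs membership in \<open>Kspace\<close>, which
      is known only for times at which the solution exists; hence the norms are compared eventually
      rather than everywhere.\<close>
    have near_t: "\<forall>\<^sub>F r in at t. c * r \<in> {-T<..<T}"
    proof (rule eventually_at_in_open'[where A = "{- (T / c)<..<T / c}", THEN eventually_mono])
      show "c * r \<in> {-T<..<T}" if "r \<in> {- (T / c)<..<T / c}" for r
        using that c by (auto simp: field_simps)
    qed (use t in auto)
    have "((\<lambda>r. Knorm m (v (c * r) - v u)) \<longlongrightarrow> 0) (at t)"
      using filterlim_compose[OF vcont[OF u, unfolded u_def] filterlim_mult_at[of c t]] c
      by (simp add: u_def)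
    then have "((\<lambda>r. c * Knorm m (v (c * r) - v u)) \<longlongrightarrow> c * 0) (at t)"
      by (rule tendsto_mult_left)
    moreover have "\<forall>\<^sub>F r in at t. c * Knorm m (v (c * r) - v u) = Knorm m (v' r - v' t)"
      using near_t
    proof eventually_elim
      case (elim r)
      have "v' r - v' t = (\<lambda>s. c *\<^sub>R (v (c * r) s - v u s))"
        by (auto simp: v'_def u_def algebra_simps)
      then show ?case
        using Knorm_scaleR[OF Kspace_diff[OF K(2)[OF elim] K(2)[OF u]], of c] c
        by (simp add: fun_diff_def)
    qed
    ultimately show "((\<lambda>r. Knorm m (v' r - v' t)) \<longlongrightarrow> 0) (at t)"
      using tendsto_cong by force
    have near_0: "\<forall>\<^sub>F h in at 0. c * (t + h) \<in> {-T<..<T}"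
    proof (rule eventually_at_in_open'[where A = "{- (T / c) - t<..<T / c - t}", THEN eventually_mono])
      show "c * (t + r) \<in> {-T<..<T}" if "r \<in> {- (T / c) - t<..<T / c - t}" for r
        using that c by (auto simp: field_simps)
    qed (use t in auto)
    let ?q = "\<lambda>h s. (\<eta> (u + h) s - \<eta> u s) /\<^sub>R h - v u s"
    have "((\<lambda>h. Knorm m (?q (c * h))) \<longlongrightarrow> 0) (at 0)"
      by (rule filterlim_compose[OF diff[OF u]]) (use filterlim_mult_at[of c 0] c in simp)
    then have "((\<lambda>h. c * Knorm m (?q (c * h))) \<longlongrightarrow> c * 0) (at 0)"
      by (rule tendsto_mult_left)
    moreover have "\<forall>\<^sub>F h in at 0. c * Knorm m (?q (c * h))
        = Knorm m (\<lambda>s. (\<eta> (c * (t + h)) s - \<eta> (c * t) s) /\<^sub>R h - v' t s)"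
      using near_0
    proof eventually_elim
      case (elim h)
      have "u + c * h \<in> {-T<..<T}"
        using elim by (simp add: u_def algebra_simps)
      then have "?q (c * h) \<in> Kspace m"
        using K u by (intro Kspace_diff Kspace_scaleR) auto
      moreover have ci: "c * (inverse c * inverse h) = inverse h"
        using c by (simp flip: mult.assoc)
      have "(\<lambda>s. (\<eta> (c * (t + h)) s - \<eta> (c * t) s) /\<^sub>R h - v' t s)
          = (\<lambda>s. c *\<^sub>R ?q (c * h) s)"
        by (simp add: v'_def u_def algebra_simps ci)
      ultimately show ?case
        using Knorm_scaleR[of "?q (c * h)" m c] c by simp
    qed
    ultimately show "((\<lambda>h. Knorm m (\<lambda>s. (\<eta> (c * (t + h)) s - \<eta> (c * t) s) /\<^sub>R h - v' t s)) \<longlongrightarrow> 0) (at 0)"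
      using tendsto_cong by force
    show "is_tension (\<eta> (c * t)) (v' t) (\<sigma>' t)"
    proof -
      obtain \<rho> where "continuous_on {-1..1} (\<sigma> u)" "\<sigma> u (-1) = 0" "\<sigma> u 1 = 0"
        and \<rho>: "\<And>s. s \<in> unit_ival \<Longrightarrow> (\<sigma> u has_real_derivative \<rho> s) (at s)"
        "\<And>s. s \<in> unit_ival \<Longrightarrow> (\<rho> has_real_derivative
           ((norm (vector_derivative (\<lambda>r. vector_derivative (\<eta> u) (at r)) (at s)))\<^sup>2 * \<sigma> u s
             - (norm (vector_derivative (v u) (at s)))\<^sup>2)) (at s)"
        using tens[OF u] unfolding is_tension_def by blast
      note tension = this
      have v's: "norm (vector_derivative (v' t) (at s)) = c * norm (vector_derivative (v u) (at s))"
        if "s \<in> unit_ival" for s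
        using vector_derivative_scaleR_Kspace[OF K(2)[OF u, unfolded k] that, of c] c
        by (simp add: v'_def[abs_def] u_def)
      show ?thesis
        unfolding is_tension_def u_def[symmetric]
      proof (intro conjI exI ballI)
        show "continuous_on {-1..1} (\<sigma>' t)"
          unfolding \<sigma>'_def[abs_def] u_def[symmetric] using tension by (intro continuous_intros)
        show "\<sigma>' t (- 1) = 0" "\<sigma>' t 1 = 0"
          using tension by (simp_all add: \<sigma>'_def u_def)
        fix s assume s: "s \<in> unit_ival"
        show "(\<sigma>' t has_real_derivative c\<^sup>2 * \<rho> s) (at s)"
          unfolding \<sigma>'_def[abs_def] u_def[symmetric] by (intro DERIV_cmult \<rho>(1) s)
        show "((\<lambda>s. c\<^sup>2 * \<rho> s) has_real_derivative
           ((norm (vector_derivative (\<lambda>r. vector_derivative (\<eta> u) (at r)) (at s)))\<^sup>2 * \<sigma>' t s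
             - (norm (vector_derivative (v' t) (at s)))\<^sup>2)) (at s)"
          using DERIV_cmult[OF \<rho>(2)[OF s], of "c\<^sup>2"]
          unfolding v's[OF s] \<sigma>'_def u_def[symmetric]
          by (simp add: algebra_simps power_mult_distrib)
      qed
    qed
    fix s assume s: "s \<in> unit_ival"
    obtain a where a: "((\<lambda>r. v r s) has_vector_derivative a) (at u)"
      "((\<lambda>r. \<sigma> u r *\<^sub>R vector_derivative (\<eta> u) (at r)) has_vector_derivative a) (at s)"
      using wave[OF u s] by blast
    have "((\<lambda>r. c * r) has_vector_derivative c) (at t)"
      using has_real_derivative_iff_has_vector_derivative by (auto intro!: derivative_eq_intros)
    then have "((\<lambda>r. v (c * r) s) has_vector_derivative c *\<^sub>R a) (at t)"
      using vector_diff_chain_at[of "\<lambda>r. c * r" c t "\<lambda>r. v r s" a] a(1)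
      by (simp add: u_def o_def)
    then have "((\<lambda>r. v' r s) has_vector_derivative c\<^sup>2 *\<^sub>R a) (at t)"
      using bounded_linear.has_vector_derivative[OF bounded_linear_scaleR_right, of _ _ _ c]
      by (force simp: v'_def power2_eq_square)
    moreover have "((\<lambda>r. \<sigma>' t r *\<^sub>R vector_derivative (\<eta> (c * t)) (at r)) has_vector_derivative c\<^sup>2 *\<^sub>R a) (at s)"
      using bounded_linear.has_vector_derivative[OF bounded_linear_scaleR_right a(2), of "c\<^sup>2"]
      by (simp add: \<sigma>'_def u_def)
    ultimately show "\<exists>a. ((\<lambda>r. v' r s) has_vector_derivative a) (at t) \<and>
         ((\<lambda>r. \<sigma>' t r *\<^sub>R vector_derivative (\<eta> (c * t)) (at r)) has_vector_derivative a) (at s)"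
      by blast
  qed
  moreover have "v' 0 = (\<lambda>s. c *\<^sub>R w s)" "\<eta> (c * 0) = \<gamma>"
    by (auto simp: v'_def init)
  ultimately show ?thesis
    unfolding whip_solution_def by blast
qed

text \<open>A whip at rest has zero tension, so both equations reduce to 0 = 0.\<close>

lemma whip_solution_const:
  fixes \<gamma> :: "real \<Rightarrow> real ^ 'n"
  assumes "\<gamma> \<in> arcs (m + 1)" "0 \<in> tangent m \<gamma>"
  shows "whip_solution m \<gamma> 0 T (\<lambda>_. \<gamma>)"
proof -
  have "\<gamma> \<in> Kspace (m + 1)"
    using assms(1) by (simp add: arcs_def)
  then have "(0 :: real \<Rightarrow> real ^ 'n) \<in> Kspace (m + 1)"
    using Kspace_scaleR[of \<gamma> "m + 1" 0] by (simp add: zero_fun_def)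
  moreover have "(0 :: real \<Rightarrow> real ^ 'n) \<in> Kspace m"
    using assms(2) by (simp add: tangent_def)
  ultimately have zero: "Knorm (m + 1) (0 :: real \<Rightarrow> real ^ 'n) = 0"
    "Knorm m (0 :: real \<Rightarrow> real ^ 'n) = 0"
    by (auto simp: Knorm_zero)
  have "is_tension \<gamma> 0 (\<lambda>_. 0)"
    unfolding is_tension_def by (auto simp: zero_fun_def intro!: exI[of _ "\<lambda>_. 0"])
  moreover have "(\<lambda>s. (\<gamma> s - \<gamma> s) /\<^sub>R h - (0 :: real \<Rightarrow> real ^ 'n) s) = 0" for h
    by (auto simp: zero_fun_def)
  ultimately show ?thesis
    unfolding whip_solution_def
    by (intro exI[of _ "\<lambda>_. 0"] conjI ballI exI[of _ "\<lambda>_ _. 0"] exI[of _ 0])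
       (simp_all only: assms zero diff_self tendsto_const zero_fun_apply scaleR_zero_left
         has_vector_derivative_const)
qed

section \<open>The exponential map at zero and along rays\<close>

lemma reduced_exp_eq:
  assumes "w \<in> exp_dom m \<gamma>" "reaches m \<gamma> w \<zeta>"
  shows "reduced_exp m \<gamma> w = \<zeta>"
  using assms unfolding exp_dom_def reduced_exp_def by (auto intro: the1_equality)

lemma reduced_exp_zero:
  assumes "\<gamma> \<in> arcs (m + 1)" "0 \<in> exp_dom m \<gamma>"
  shows "reduced_exp m \<gamma> 0 = \<gamma>"
proof -
  have "whip_solution m \<gamma> 0 2 (\<lambda>_. \<gamma>)"
    using assms by (intro whip_solution_const) (auto simp: exp_dom_def)
  then have "reaches m \<gamma> 0 \<gamma>"
    unfolding reaches_def by (intro exI[of _ 2] exI[of _ "\<lambda>_. \<gamma>"]) auto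
  then show ?thesis
    by (rule reduced_exp_eq[OF assms(2)])
qed

lemma reduced_exp_arcs:
  assumes "w \<in> exp_dom m \<gamma>"
  shows "reduced_exp m \<gamma> w \<in> arcs (m + 1)"
proof -
  obtain \<zeta> where "reaches m \<gamma> w \<zeta>"
    using assms by (auto simp: exp_dom_def)
  moreover from this obtain T \<eta> where "T > 1" "whip_solution m \<gamma> w T \<eta>" "\<eta> 1 = \<zeta>"
    by (auto simp: reaches_def)
  then have "\<zeta> \<in> arcs (m + 1)"
    unfolding whip_solution_def by auto
  ultimately show ?thesis
    using reduced_exp_eq[OF assms] by simp
qed

text \<open>Along the ray the exponential map traces the one solution \<eta> with velocity
  \<open>w\<close>, so the limit is the definition of its initial velocity. It is one-sided because
  the rescaling is stated for positive \<open>c\<close>.\<close>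

lemma reduced_exp_ray:
  fixes w :: "real \<Rightarrow> real ^ 'n"
  assumes m: "m \<ge> 2" and ray: "\<And>c. 0 < c \<Longrightarrow> c \<le> 1 \<Longrightarrow> (\<lambda>s. c *\<^sub>R w s) \<in> exp_dom m \<gamma>"
  shows "((\<lambda>c. Knorm m (\<lambda>s. (reduced_exp m \<gamma> (\<lambda>s. c *\<^sub>R w s) s - \<gamma> s) /\<^sub>R c - w s)) \<longlongrightarrow> 0)
    (at_right 0)"
proof -
  have w: "w \<in> exp_dom m \<gamma>"
    using ray[of 1] by simp
  then obtain T \<eta> where T: "T > 1" and sol: "whip_solution m \<gamma> w T \<eta>"
    by (auto simp: exp_dom_def reaches_def)
  have exp: "reduced_exp m \<gamma> (\<lambda>s. c *\<^sub>R w s) = \<eta> c" if c: "0 < c" "c \<le> 1" for c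
  proof (rule reduced_exp_eq[OF ray[OF c]])
    show "reaches m \<gamma> (\<lambda>s. c *\<^sub>R w s) (\<eta> c)"
      unfolding reaches_def
      using whip_solution_rescale[OF sol c(1) m] c T
      by (intro exI[of _ "T / c"] exI[of _ "\<lambda>t. \<eta> (c * t)"]) (auto simp: field_simps)
  qed
  have "0 \<in> {-T<..<T}"
    using T by auto
  then have "((\<lambda>h. Knorm m (\<lambda>s. (\<eta> (0 + h) s - \<gamma> s) /\<^sub>R h - w s)) \<longlongrightarrow> 0) (at 0)"
    using sol unfolding whip_solution_def by blast
  then have "((\<lambda>h. Knorm m (\<lambda>s. (\<eta> h s - \<gamma> s) /\<^sub>R h - w s)) \<longlongrightarrow> 0) (at_right 0)"
    by (simp add: filterlim_at_split)
  then show ?thesis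
  proof (rule Lim_transform_eventually)
    have "\<forall>\<^sub>F c in at_right 0. c \<in> {0<..<1::real}"
      by (rule eventually_at_right_real) simp
    then show "\<forall>\<^sub>F c in at_right 0. Knorm m (\<lambda>s. (\<eta> c s - \<gamma> s) /\<^sub>R c - w s)
        = Knorm m (\<lambda>s. (reduced_exp m \<gamma> (\<lambda>s. c *\<^sub>R w s) s - \<gamma> s) /\<^sub>R c - w s)"
      by eventually_elim (simp add: exp)
  qed
qed

subsection \<open>Differentiability tested on functionals\<close>

text \<open>Linearity and the bound are required on \<open>Kspace m\<close> only, since elsewhere
  the derivatives inside the functional may fail to exist.\<close>

locale Kfunctional =
  fixes m :: nat and \<Lambda> :: "(real \<Rightarrow> real ^ 'n) \<Rightarrow> real" and C :: real
  assumes add: "f \<in> Kspace m \<Longrightarrow> g \<in> Kspace m \<Longrightarrow> \<Lambda> (\<lambda>s. f s + g s) = \<Lambda> f + \<Lambda> g"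
    and scaleR: "f \<in> Kspace m \<Longrightarrow> \<Lambda> (\<lambda>s. c *\<^sub>R f s) = c * \<Lambda> f"
    and bound: "f \<in> Kspace m \<Longrightarrow> \<bar>\<Lambda> f\<bar> \<le> C * Knorm m f"
    and C: "C \<ge> 0"
begin

lemma diff: "f \<in> Kspace m \<Longrightarrow> g \<in> Kspace m \<Longrightarrow> \<Lambda> (\<lambda>s. f s - g s) = \<Lambda> f - \<Lambda> g"
  using add[of f "\<lambda>s. (-1) *\<^sub>R g s"] scaleR[of g "-1"] Kspace_scaleR[of g m "-1"] by simp

text \<open>The functional of the difference quotient of the exponential map along \<open>w\<close>
  tends to \<open>\<Lambda> (L w)\<close> by differentiability and to \<open>\<Lambda> w\<close> by
  the behaviour on rays.\<close>

lemma frechet_deriv_exp_zero: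
  fixes w :: "real \<Rightarrow> real ^ 'n"
  assumes m: "m \<ge> 2" and \<gamma>: "\<gamma> \<in> arcs (m + 1)" and \<Omega>: "\<Omega> \<subseteq> exp_dom m \<gamma>" "0 \<in> \<Omega>"
    and ray: "\<And>c. 0 < c \<Longrightarrow> c \<le> 1 \<Longrightarrow> (\<lambda>s. c *\<^sub>R w s) \<in> \<Omega>"
    and L: "frechet_deriv_K m (tangent m \<gamma>) \<Omega> (reduced_exp m \<gamma>) 0 L"
  shows "\<Lambda> (L w) = \<Lambda> w"
proof -
  let ?F = "reduced_exp m \<gamma>"
  have w: "w \<in> tangent m \<gamma>"
    using ray[of 1] \<Omega> by (auto simp: exp_dom_def)
  have K: "w \<in> Kspace m" "\<gamma> \<in> Kspace m" "L w \<in> Kspace m"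
    using w \<gamma> L Kspace_mono[of m "m + 1"]
    by (auto simp: tangent_def arcs_def frechet_deriv_K_def bounded_linear_K_def)
  have F0: "?F 0 = \<gamma>"
    using \<gamma> \<Omega> by (intro reduced_exp_zero) auto
  define k where "k = Knorm m w"
  have k: "k \<ge> 0"
    by (simp add: k_def Knorm_nonneg)
  have "\<bar>\<Lambda> w - \<Lambda> (L w)\<bar> \<le> 0 + e" if e: "e > 0" for e
  proof -
    \<comment> \<open>Differentiability contributes \<open>C * \<epsilon> * k\<close> and the ray
      limit \<open>C * \<epsilon>\<close>. The added ones keep the denominator positive when
      \<open>C\<close> or \<open>k\<close> is 0.\<close>
    define \<epsilon> where "\<epsilon> = e / ((C + 1) * (k + 1))"
    have \<epsilon>: "\<epsilon> > 0"
      using e C k by (simp add: \<epsilon>_def)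
    obtain \<delta> where \<delta>: "\<delta> > 0" "\<And>h. h \<in> tangent m \<gamma> \<Longrightarrow> 0 + h \<in> \<Omega> \<Longrightarrow> Knorm m h < \<delta> \<Longrightarrow>
        Knorm m (?F (0 + h) - ?F 0 - L h) \<le> \<epsilon> * Knorm m h"
      using L \<epsilon> unfolding frechet_deriv_K_def by blast
    have "\<forall>\<^sub>F c in at_right 0. Knorm m (\<lambda>s. (?F (\<lambda>s. c *\<^sub>R w s) s - \<gamma> s) /\<^sub>R c - w s) < \<epsilon>"
      using order_tendstoD(2)[OF reduced_exp_ray[OF m, of w \<gamma>] \<epsilon>] ray \<Omega> by blast
    moreover have "\<forall>\<^sub>F c in at_right 0. c \<in> {0<..<1::real}"
      by (rule eventually_at_right_real) simp
    moreover have "\<forall>\<^sub>F c in at_right 0. c \<in> {0<..<\<delta> / (k + 1)}"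
      using \<delta> k by (intro eventually_at_right_real) auto
    ultimately have "\<forall>\<^sub>F c in at_right (0 :: real). \<bar>\<Lambda> w - \<Lambda> (L w)\<bar> \<le> e"
    proof eventually_elim
      case (elim c)
      define h where "h = (\<lambda>s. c *\<^sub>R w s)"
      have c: "0 < c" "c \<le> 1" "c * (k + 1) < \<delta>"
        using elim k by (auto simp: field_simps)
      have h: "h \<in> \<Omega>" "h \<in> tangent m \<gamma>"
        using ray[OF c(1,2)] \<Omega> by (auto simp: h_def exp_dom_def)
      have "Knorm m h = c * k"
        using Knorm_scaleR[OF K(1), of c] c by (simp add: h_def k_def)
      moreover have "c * k < \<delta>"
        using c k by (simp add: algebra_simps)
      moreover have Lh: "L h = (\<lambda>s. c *\<^sub>R L w s)"
        using L w by (auto simp: h_def frechet_deriv_K_def bounded_linear_K_def)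
      moreover have "0 + h = h"
        by simp
      ultimately have est: "Knorm m (\<lambda>s. ?F h s - \<gamma> s - c *\<^sub>R L w s) \<le> \<epsilon> * (c * k)"
        using \<delta>(2)[OF h(2)] h(1) F0 by (simp add: fun_diff_def)
      have FK: "?F h \<in> Kspace m"
        using reduced_exp_arcs[of h m \<gamma>] h(1) \<Omega> Kspace_mono[of m "m + 1"] by (auto simp: arcs_def)
      have "\<bar>\<Lambda> (?F h) - \<Lambda> \<gamma> - c * \<Lambda> (L w)\<bar> = \<bar>\<Lambda> (\<lambda>s. ?F h s - \<gamma> s - c *\<^sub>R L w s)\<bar>"
        using FK K by (simp add: diff scaleR Kspace_diff Kspace_scaleR)
      also have "\<dots> \<le> C * Knorm m (\<lambda>s. ?F h s - \<gamma> s - c *\<^sub>R L w s)"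
        using FK K by (intro bound Kspace_diff Kspace_scaleR)
      also have "\<dots> \<le> C * (\<epsilon> * (c * k))"
        using est C by (rule mult_left_mono)
      finally have "inverse c * \<bar>\<Lambda> (?F h) - \<Lambda> \<gamma> - c * \<Lambda> (L w)\<bar> \<le> inverse c * (C * (\<epsilon> * (c * k)))"
        using c by (intro mult_left_mono) auto
      also have "\<dots> = C * \<epsilon> * k"
        using c by simp
      also have "inverse c * \<bar>\<Lambda> (?F h) - \<Lambda> \<gamma> - c * \<Lambda> (L w)\<bar>
          = \<bar>inverse c * (\<Lambda> (?F h) - \<Lambda> \<gamma>) - \<Lambda> (L w)\<bar>"
      proof -
        have "inverse c * (\<Lambda> (?F h) - \<Lambda> \<gamma>) - \<Lambda> (L w) = inverse c * (\<Lambda> (?F h) - \<Lambda> \<gamma> - c * \<Lambda> (L w))"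
          using c by (simp add: field_simps)
        then show ?thesis
          using c by (simp only: abs_mult) simp
      qed
      finally have 1: "\<bar>inverse c * (\<Lambda> (?F h) - \<Lambda> \<gamma>) - \<Lambda> (L w)\<bar> \<le> C * \<epsilon> * k" .
      have "\<bar>inverse c * (\<Lambda> (?F h) - \<Lambda> \<gamma>) - \<Lambda> w\<bar> = \<bar>\<Lambda> (\<lambda>s. (?F h s - \<gamma> s) /\<^sub>R c - w s)\<bar>"
        using FK K by (simp add: diff scaleR Kspace_diff Kspace_scaleR)
      also have "\<dots> \<le> C * Knorm m (\<lambda>s. (?F h s - \<gamma> s) /\<^sub>R c - w s)"
        using FK K by (intro bound Kspace_diff Kspace_scaleR)
      also have "\<dots> \<le> C * \<epsilon>"
        using elim C by (intro mult_left_mono) (auto simp: h_def)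
      finally have "\<bar>\<Lambda> w - \<Lambda> (L w)\<bar> \<le> C * \<epsilon> * k + C * \<epsilon>"
        using 1 by linarith
      also have "\<dots> = C * ((k + 1) * \<epsilon>)"
        by (simp add: algebra_simps)
      also have "\<dots> \<le> (C + 1) * ((k + 1) * \<epsilon>)"
        using k \<epsilon> by (intro mult_right_mono) auto
      also have "\<dots> = e"
        using C k by (simp add: \<epsilon>_def)
      finally show ?case .
    qed
    then show ?thesis
      using eventually_happens trivial_limit_at_right_real by fastforce
  qed
  then have "\<bar>\<Lambda> w - \<Lambda> (L w)\<bar> \<le> 0"
    by (rule field_le_epsilon)
  then show ?thesis
    by simp
qed

text \<open>The scalar mean value inequality for \<open>\<Lambda>\<close> of \<open>F\<close> along
  the segment, minus the linear function \<open>t * \<Lambda> d\<close>. The derivative of this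
  difference is exactly what \<open>near\<close> bounds.\<close>

lemma mean_value:
  assumes d: "d \<in> V" and V: "\<And>c. (\<lambda>s. c *\<^sub>R d s) \<in> V" "V \<subseteq> Kspace m"
    and F: "\<And>x. x \<in> \<Omega> \<Longrightarrow> F x \<in> Kspace m"
    and D: "\<And>x. x \<in> \<Omega> \<Longrightarrow> frechet_deriv_K m V \<Omega> F x (D x)"
    and seg: "\<And>t. 0 \<le> t \<Longrightarrow> t \<le> 1 \<Longrightarrow> (\<lambda>s. f s + t *\<^sub>R d s) \<in> \<Omega>"
    and near: "\<And>t. 0 \<le> t \<Longrightarrow> t \<le> 1 \<Longrightarrow> \<bar>\<Lambda> (D (\<lambda>s. f s + t *\<^sub>R d s) d) - \<Lambda> d\<bar> \<le> B"
  shows "\<bar>\<Lambda> (F (\<lambda>s. f s + d s)) - \<Lambda> (F f) - \<Lambda> d\<bar> \<le> B"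
proof -
  define x where "x t = (\<lambda>s. f s + t *\<^sub>R d s)" for t
  define r where "r t = \<Lambda> (F (x t))" for t
  define K where "K = Knorm m d"
  have K: "K \<ge> 0"
    by (simp add: K_def Knorm_nonneg)
  have dK: "d \<in> Kspace m"
    using d V by auto
  have deriv: "(r has_real_derivative \<Lambda> (D (x t) d)) (at t within {0..1})" if t: "t \<in> {0..1}" for t
    unfolding has_field_derivative_iff Lim_within
  proof (intro allI impI)
    fix e :: real assume e: "e > 0"
    have xt: "x t \<in> \<Omega>"
      using seg t by (simp add: x_def)
    note Dt = D[OF xt]
    have DK: "D (x t) d \<in> Kspace m"
      using Dt d by (auto simp: frechet_deriv_K_def bounded_linear_K_def)
    \<comment> \<open>The final halving yields the strict inequality that the limit demands.\<close>
    define \<epsilon> where "\<epsilon> = e / ((C + 1) * (K + 1)) / 2"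
    have \<epsilon>: "\<epsilon> > 0"
      using e C K by (simp add: \<epsilon>_def)
    obtain \<delta> where \<delta>: "\<delta> > 0" "\<And>h. h \<in> V \<Longrightarrow> x t + h \<in> \<Omega> \<Longrightarrow> Knorm m h < \<delta> \<Longrightarrow>
        Knorm m (F (x t + h) - F (x t) - D (x t) h) \<le> \<epsilon> * Knorm m h"
      using Dt \<epsilon> unfolding frechet_deriv_K_def by blast
    show "\<exists>d'>0. \<forall>y\<in>{0..1}. 0 < dist y t \<and> dist y t < d' \<longrightarrow>
        dist ((r y - r t) / (y - t)) (\<Lambda> (D (x t) d)) < e"
    proof (intro exI[of _ "\<delta> / (K + 1)"] conjI ballI impI)
      show "\<delta> / (K + 1) > 0"
        using \<delta> K by simp
      fix y :: real assume y: "y \<in> {0..1}" and "0 < dist y t \<and> dist y t < \<delta> / (K + 1)"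
      then have yt: "y \<noteq> t" "\<bar>y - t\<bar> * (K + 1) < \<delta>"
        using K by (auto simp: dist_real_def field_simps)
      define h where "h = (\<lambda>s. (y - t) *\<^sub>R d s)"
      have xy: "x t + h = x y" "x y \<in> \<Omega>"
        using seg y by (auto simp: x_def h_def algebra_simps)
      have hn: "Knorm m h = \<bar>y - t\<bar> * K"
        using Knorm_scaleR[OF dK] by (simp add: h_def K_def)
      have "\<bar>y - t\<bar> * K \<le> \<bar>y - t\<bar> * (K + 1)"
        by (intro mult_left_mono) auto
      then have "Knorm m h < \<delta>"
        using yt hn by linarith
      moreover have "D (x t) h = (\<lambda>s. (y - t) *\<^sub>R D (x t) d s)"
        using Dt d by (auto simp: h_def frechet_deriv_K_def bounded_linear_K_def)
      ultimately have est: "Knorm m (\<lambda>s. F (x y) s - F (x t) s - (y - t) *\<^sub>R D (x t) d s)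
          \<le> \<epsilon> * (\<bar>y - t\<bar> * K)"
        using \<delta>(2)[of h] V xy hn by (simp add: h_def fun_diff_def)
      have FK: "F (x y) \<in> Kspace m" "F (x t) \<in> Kspace m"
        using F xt xy by auto
      have "\<bar>r y - r t - (y - t) * \<Lambda> (D (x t) d)\<bar>
          = \<bar>\<Lambda> (\<lambda>s. F (x y) s - F (x t) s - (y - t) *\<^sub>R D (x t) d s)\<bar>"
        using FK DK by (simp add: r_def diff scaleR Kspace_diff Kspace_scaleR)
      also have "\<dots> \<le> C * Knorm m (\<lambda>s. F (x y) s - F (x t) s - (y - t) *\<^sub>R D (x t) d s)"
        using FK DK by (intro bound Kspace_diff Kspace_scaleR)
      also have "\<dots> \<le> C * (\<epsilon> * (\<bar>y - t\<bar> * K))"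
        using est C by (rule mult_left_mono)
      also have "\<dots> = (C * K * \<epsilon>) * \<bar>y - t\<bar>"
        by simp
      also have "\<dots> \<le> (e / 2) * \<bar>y - t\<bar>"
      proof (rule mult_right_mono)
        have "C * K * \<epsilon> \<le> ((C + 1) * (K + 1)) * \<epsilon>"
          using C K \<epsilon> by (intro mult_right_mono mult_mono) auto
        also have "\<dots> = e / 2"
          using C K by (simp add: \<epsilon>_def)
        finally show "C * K * \<epsilon> \<le> e / 2" .
      qed simp
      also have "\<dots> < e * \<bar>y - t\<bar>"
        using e yt by simp
      finally have "\<bar>r y - r t - (y - t) * \<Lambda> (D (x t) d)\<bar> / \<bar>y - t\<bar> < e"
        using yt by (simp add: divide_less_eq)
      moreover have "(r y - r t) / (y - t) - \<Lambda> (D (x t) d) = (r y - r t - (y - t) * \<Lambda> (D (x t) d)) / (y - t)"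
        using yt by (simp add: diff_divide_distrib)
      ultimately show "dist ((r y - r t) / (y - t)) (\<Lambda> (D (x t) d)) < e"
        by (simp only: dist_real_def abs_divide)
    qed
  qed
  have "norm ((r 1 - 1 * \<Lambda> d) - (r 0 - 0 * \<Lambda> d)) \<le> B * norm (1 - 0 :: real)"
  proof (rule field_differentiable_bound[where S = "{0..1}" and f = "\<lambda>t. r t - t * \<Lambda> d"])
    show "((\<lambda>t. r t - t * \<Lambda> d) has_real_derivative \<Lambda> (D (x t) d) - \<Lambda> d) (at t within {0..1})"
      if "t \<in> {0..1}" for t
      by (rule derivative_eq_intros deriv[OF that] refl | simp)+
    show "norm (\<Lambda> (D (x t) d) - \<Lambda> d) \<le> B" if "t \<in> {0..1}" for t
      using near[of t] that by (simp add: x_def)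
  qed auto
  then show ?thesis
    by (simp add: r_def x_def algebra_simps)
qed

end

text \<open>The bound depends on \<open>k\<close> and \<open>q\<close> but not on the grid, so one
  constant serves all frequencies.\<close>

lemma Kfunctional_osc:
  assumes "0 \<le> p" "p + real (2 * J) * h \<le> q" "q < 1" "h > 0"
  shows "Kfunctional (Suc k) (osc k i p h J) (1 + 1 / (2 * (1 - q\<^sup>2) ^ Suc k))"
proof
  have "0 \<le> q"
    using grid_in_unit_ival(2,3)[OF assms, of 0] assms by simp
  then have "q\<^sup>2 < 1"
    using assms by (simp add: abs_square_less_1)
  then show "0 \<le> 1 + 1 / (2 * (1 - q\<^sup>2) ^ Suc k)"
    by (simp add: add_nonneg_nonneg del: power_Suc)
qed (use assms in \<open>auto intro: osc_add osc_scaleR osc_bound simp del: power_Suc of_nat_mult\<close>)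

subsection \<open>Failure of continuous differentiability\<close>

text \<open>The generator of rotations in the plane of coordinates \<open>i\<close> and
  \<open>j\<close>. Its antisymmetry gives orthogonality of \<open>rot i j x\<close> and
  \<open>x\<close>.\<close>

definition rot :: "'n \<Rightarrow> 'n \<Rightarrow> real ^ 'n \<Rightarrow> real ^ ('n :: finite)" where
  "rot i j x = (x $ i) *\<^sub>R axis j 1 - (x $ j) *\<^sub>R axis i 1"

lemma bounded_linear_rot: "bounded_linear (rot i j)"
  unfolding rot_def[abs_def]
  by (intro bounded_linear_sub bounded_linear_compose[OF bounded_linear_scaleR_left] bounded_linear_vec_nth)

lemma norm_rot:
  fixes x :: "real ^ 'n"
  shows "norm (rot i j x) \<le> 2 * norm x"
proof -
  have "norm (rot i j x) \<le> norm ((x $ i) *\<^sub>R (axis j 1 :: real ^ 'n)) + norm ((x $ j) *\<^sub>R (axis i 1 :: real ^ 'n))"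
    unfolding rot_def by (rule norm_triangle_ineq4)
  also have "\<dots> = \<bar>x $ i\<bar> + \<bar>x $ j\<bar>"
    by (simp add: norm_axis_1)
  also have "\<dots> \<le> 2 * norm x"
    using component_le_norm_cart[of x i] component_le_norm_cart[of x j] by simp
  finally show ?thesis .
qed

lemma rot_orthogonal: "rot i j x \<bullet> x = 0"
  by (simp add: rot_def inner_diff_left inner_axis' mult.commute)

lemma rot_component: "i \<noteq> j \<Longrightarrow> rot i j x $ j = x $ i"
  by (simp add: rot_def axis_def)

text \<open>Convexity of the ball of radius \<rho> in the absolutely summable sequences: the segment
  needed for the mean value inequality stays among admissible coefficients.\<close>

lemma summable_abs_affine:
  fixes s s' :: "nat \<Rightarrow> real"
  assumes "summable (\<lambda>n. \<bar>s n\<bar>)" "summable (\<lambda>n. \<bar>s' n\<bar>)"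
  shows "summable (\<lambda>n. \<bar>s' n - s n\<bar>)" "summable (\<lambda>n. \<bar>s n + t * (s' n - s n)\<bar>)"
    and "0 \<le> t \<Longrightarrow> t \<le> 1 \<Longrightarrow> (\<Sum>n. \<bar>s n\<bar>) \<le> \<rho> \<Longrightarrow> (\<Sum>n. \<bar>s' n\<bar>) \<le> \<rho> \<Longrightarrow>
      (\<Sum>n. \<bar>s n + t * (s' n - s n)\<bar>) \<le> \<rho>"
proof -
  show d: "summable (\<lambda>n. \<bar>s' n - s n\<bar>)"
    by (rule summable_comparison_test'[OF summable_add[OF assms]]) auto
  show c: "summable (\<lambda>n. \<bar>s n + t * (s' n - s n)\<bar>)"
    by (rule summable_comparison_test'[OF summable_add[OF assms(1) summable_mult[OF d, of "\<bar>t\<bar>"]]])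
       (auto simp flip: abs_mult)
  assume t: "0 \<le> t" "t \<le> 1" and le: "(\<Sum>n. \<bar>s n\<bar>) \<le> \<rho>" "(\<Sum>n. \<bar>s' n\<bar>) \<le> \<rho>"
  note sm = summable_mult[OF assms(1), of "1 - t"] summable_mult[OF assms(2), of t]
  have "\<bar>s n + t * (s' n - s n)\<bar> \<le> (1 - t) * \<bar>s n\<bar> + t * \<bar>s' n\<bar>" for n
  proof -
    have "s n + t * (s' n - s n) = (1 - t) * s n + t * s' n"
      by (simp add: algebra_simps)
    also have "\<bar>\<dots>\<bar> \<le> \<bar>(1 - t) * s n\<bar> + \<bar>t * s' n\<bar>"
      by (rule abs_triangle_ineq)
    finally show ?thesis
      using t by (simp add: abs_mult)
  qed
  then have "(\<Sum>n. \<bar>s n + t * (s' n - s n)\<bar>) \<le> (\<Sum>n. (1 - t) * \<bar>s n\<bar> + t * \<bar>s' n\<bar>)"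
    by (intro suminf_le c summable_add sm)
  also have "\<dots> = (1 - t) * (\<Sum>n. \<bar>s n\<bar>) + t * (\<Sum>n. \<bar>s' n\<bar>)"
    using suminf_add[OF sm] suminf_mult[OF assms(1), of "1 - t"] suminf_mult[OF assms(2), of t] by simp
  also have "\<dots> \<le> (1 - t) * \<rho> + t * \<rho>"
    using t le by (intro add_mono mult_left_mono) auto
  finally show "(\<Sum>n. \<bar>s n + t * (s' n - s n)\<bar>) \<le> \<rho>"
    by (simp add: algebra_simps)
qed

text \<open>The derivative of \<gamma> is a unit vector at \<open>pi / 8\<close>, so one component
  is nonzero there and, by continuity, keeps its sign up to some \<open>q\<close>. A second
  coordinate \<open>j\<close> is available in dimension at least 2; the rotation moves that
  component into it.\<close>

lemma rot_direction:
  fixes \<gamma> :: "real \<Rightarrow> real ^ 'n"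
  assumes card: "CARD('n) \<ge> 2" and \<gamma>: "\<gamma> \<in> arcs (Suc (Suc k))"
  obtains i j :: 'n and q \<beta> sg where "i \<noteq> j" "pi / 8 < q" "q < 1" "\<beta> > 0" "\<bar>sg\<bar> = (1 :: real)"
    "\<And>s. s \<in> {pi / 8..q} \<Longrightarrow> \<beta> \<le> sg * (cderiv 1 \<gamma> s $ i)"
proof -
  define p :: real where "p = pi / 8"
  have p: "0 < p" "p < 1"
    using pi_less_4 by (auto simp: p_def)
  have \<gamma>K: "\<gamma> \<in> Kspace (Suc (Suc k))"
    using \<gamma> by (simp add: arcs_def)
  have "norm (cderiv 1 \<gamma> p) = 1"
    using \<gamma> p by (simp add: arcs_def cderiv_Suc)
  then have "cderiv 1 \<gamma> p \<noteq> 0"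
    by auto
  then obtain i where i: "cderiv 1 \<gamma> p $ i \<noteq> 0"
    by (auto simp: vec_eq_iff)
  have "\<exists>j. j \<noteq> i"
  proof (rule ccontr)
    assume "\<nexists>j. j \<noteq> i"
    then have "(UNIV :: 'n set) = {i}"
      by auto
    then have "CARD('n) = card {i}"
      by (simp only:)
    then show False
      using card by simp
  qed
  then obtain j where j: "i \<noteq> j"
    by metis
  define sg where "sg = sgn (cderiv 1 \<gamma> p $ i)"
  define g where "g s = sg * (cderiv 1 \<gamma> s $ i)" for s
  define \<beta> where "\<beta> = g p / 2"
  have gp: "g p > 0"
    using i by (simp add: g_def sg_def sgn_if)
  have "continuous_on unit_ival (cderiv 1 \<gamma>)"
    by (rule Kspace_continuous_cderiv(1)[OF \<gamma>K]) simp
  then have "continuous_on unit_ival g"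
    unfolding g_def by (intro continuous_intros bounded_linear.continuous_on[OF bounded_linear_vec_nth])
  then have "isCont g p"
    using p by (simp add: continuous_on_eq_continuous_at)
  then have "\<forall>\<^sub>F s in at p. g s > \<beta>"
    using gp order_tendstoD(1)[of g "g p" "at p" \<beta>] by (simp add: isCont_def \<beta>_def)
  then obtain e where e: "e > 0" "\<And>s. s \<noteq> p \<Longrightarrow> dist s p < e \<Longrightarrow> g s > \<beta>"
    by (auto simp: eventually_at)
  define q where "q = p + min e (1 - p) / 2"
  have q: "p < q" "q < 1" "q < p + e"
    using p e by (auto simp: q_def min_def field_simps)
  have "\<beta> \<le> g s" if "s \<in> {p..q}" for s
    using e(2)[of s] that q gp by (cases "s = p") (auto simp: \<beta>_def dist_real_def)
  then show ?thesis
    using that[OF j, of q \<beta> sg] q i gp by (auto simp: p_def g_def sg_def \<beta>_def abs_sgn_eq)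
qed

theorem theorem4p2:
  fixes \<gamma> :: "real \<Rightarrow> real ^ 'n" and \<Omega> :: "(real \<Rightarrow> real ^ 'n) set" and m :: nat
  assumes "CARD('n) \<ge> 2"
    and "m \<ge> 3"
    and "\<gamma> \<in> arcs (m + 1)"
    and "open_in_K m (tangent m \<gamma>) \<Omega>"
    and "0 \<in> \<Omega>"
    and "\<Omega> \<subseteq> exp_dom m \<gamma>"
  shows "\<not> C1_on_K m (tangent m \<gamma>) \<Omega> (reduced_exp m \<gamma>)"
proof
  let ?F = "reduced_exp m \<gamma>" and ?T = "tangent m \<gamma>"
  assume "C1_on_K m ?T \<Omega> ?F"
  then obtain D where D: "\<And>x. x \<in> \<Omega> \<Longrightarrow> frechet_deriv_K m ?T \<Omega> ?F x (D x)"
    and D_cont: "\<And>x \<epsilon>. x \<in> \<Omega> \<Longrightarrow> \<epsilon> > 0 \<Longrightarrow> \<exists>\<delta>>0. \<forall>y\<in>\<Omega>. Knorm m (y - x) < \<delta> \<longrightarrow>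
          (\<forall>h\<in>?T. Knorm m (D y h - D x h) \<le> \<epsilon> * Knorm m h)"
    unfolding C1_on_K_def by blast
  \<comment> \<open>The functionals evaluate the derivative of order \<open>m - 1\<close>, the last
    one that is classical for every element of \<open>Kspace m\<close>.\<close>
  define k where "k = m - 1"
  have m: "m = Suc k" "k \<ge> 2" "m \<ge> 2"
    using assms(2) by (auto simp: k_def)
  have \<gamma>: "\<gamma> \<in> arcs (Suc (Suc k))"
    using assms(3) m by simp
  then have \<gamma>K: "\<gamma> \<in> Kspace (Suc (Suc k))"
    by (simp add: arcs_def)
  obtain i j :: 'n and q \<beta> sg where ij: "i \<noteq> j" and q: "pi / 8 < q" "q < 1"
    and \<beta>: "\<beta> > 0" "\<bar>sg\<bar> = (1 :: real)" "\<And>s. s \<in> {pi / 8..q} \<Longrightarrow> \<beta> \<le> sg * (cderiv 1 \<gamma> s $ i)"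
    using rot_direction[OF assms(1) \<gamma>] by metis
  interpret twist \<gamma> k "rot i j"
    using \<gamma>K m by (intro twist.intro bounded_linear_rot norm_rot) auto
  obtain A where A: "A > 0"
    "\<And>M \<phi>. amplitude M \<phi> \<Longrightarrow> V \<phi> \<in> Kspace (Suc k) \<and> Knorm (Suc k) (V \<phi>) \<le> A * M"
    using V_Kspace_Knorm by metis
  obtain c r0 where c: "c > 0"
    "\<And>r. r \<ge> r0 \<Longrightarrow>
      c \<le> \<bar>osc k j (pi / 8) (pi / freq k r) (steps q (freq k r)) (V (mode k (freq k r)))\<bar>"
    using osc_mode_lower[OF q \<beta>(1,2), of j] \<beta>(3) rot_component[OF ij] by metis
  define C where "C = 1 + 1 / (2 * (1 - q\<^sup>2) ^ Suc k)"
  have "0 < q"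
    using q pi_gt_zero by linarith
  then have "q\<^sup>2 < 1"
    using q by (simp add: abs_square_less_1)
  then have C_pos: "C > 0"
    unfolding C_def by (intro add_pos_nonneg) (auto simp del: power_Suc)
  \<comment> \<open>Chosen so that \<open>C * \<epsilon> * A\<close> is \<open>c / 4\<close>, the
    error that the gliding hump tolerates.\<close>
  define \<epsilon> where "\<epsilon> = c / (4 * C * A)"
  have \<epsilon>: "\<epsilon> > 0"
    using A(1) C_pos c(1) by (simp add: \<epsilon>_def)
  obtain \<delta>1 where \<delta>1: "\<delta>1 > 0" "\<And>y. y \<in> ?T \<Longrightarrow> Knorm m y < \<delta>1 \<Longrightarrow> y \<in> \<Omega>"
    using assms(4,5) unfolding open_in_K_def by (metis diff_zero)
  obtain \<delta>2 where \<delta>2: "\<delta>2 > 0" "\<And>y h. y \<in> \<Omega> \<Longrightarrow> Knorm m y < \<delta>2 \<Longrightarrow> h \<in> ?T \<Longrightarrow>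
      Knorm m (D y h - D 0 h) \<le> \<epsilon> * Knorm m h"
    using D_cont[OF assms(5) \<epsilon>] by (metis diff_zero)
  \<comment> \<open>All \<open>S a\<close> with coefficient sum at most \<rho> then lie in \<Omega>
    and in the ball on which the derivative is close to \<open>D 0\<close>.\<close>
  define \<rho> where "\<rho> = min \<delta>1 \<delta>2 / (2 * A)"
  have \<rho>: "\<rho> > 0" "A * \<rho> < \<delta>1" "A * \<rho> < \<delta>2"
    using A(1) \<delta>1(1) \<delta>2(1) by (auto simp: \<rho>_def)
  \<comment> \<open>The ratio that \<open>gliding_hump\<close> will use with \<open>C * A\<close>
    for its \<open>A\<close>. It does not depend on the frequencies, so these can now be adapted to
    it.\<close>
  define \<theta> where "\<theta> = c / (16 * (C * A + c))"
  have \<theta>: "\<theta> > 0"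
    using A(1) C_pos c(1) by (simp add: \<theta>_def add_pos_pos)
  \<comment> \<open>Makes the square root of the grid width at most
    \<open>\<theta> ^ n / real (Suc n)\<close>; the factor \<open>real (Suc n)\<close> is what
    finally exceeds every constant.\<close>
  define r where "r n = r0 + nat \<lceil>pi * (real (Suc n) / \<theta> ^ n)\<^sup>2\<rceil>" for n
  define N where "N n = freq k (r n)" for n
  have N: "N n \<ge> 1" "pi / N n \<le> (\<theta> ^ n / real (Suc n))\<^sup>2" for n
  proof -
    show N1: "N n \<ge> 1"
      by (simp add: N_def freq_ge)
    have "pi * (real (Suc n) / \<theta> ^ n)\<^sup>2 \<le> real (r n)"
      using real_nat_ceiling_ge[of "pi * (real (Suc n) / \<theta> ^ n)\<^sup>2"]
      unfolding r_def of_nat_add by linarith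
    also have "\<dots> \<le> N n"
      by (simp add: N_def freq_ge)
    finally show "pi / N n \<le> (\<theta> ^ n / real (Suc n))\<^sup>2"
      using N1 \<theta> by (simp add: power_divide field_simps del: of_nat_Suc)
  qed
  define S where "S a = V (trig k N a)" for a
  define l where "l n = osc k j (pi / 8) (pi / N n) (steps q (N n))" for n
  have l: "Kfunctional m (l n) C" for n
    unfolding l_def m C_def using steps_bounds(1)[OF q(1) N(1)[of n]] N(1)[of n] q(2)
    by (intro Kfunctional_osc) (auto intro: divide_pos_pos)
  note amp = amplitude_trig[of N, OF N(1)]
  have S: "S a \<in> Kspace m" "Knorm m (S a) \<le> A * (\<Sum>n. \<bar>a n\<bar>)" if "summable (\<lambda>n. \<bar>a n\<bar>)" for a
    using A(2)[OF amp[OF that]] by (auto simp: S_def m)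
  have S_tangent: "S a \<in> ?T" if a: "summable (\<lambda>n. \<bar>a n\<bar>)" for a
    unfolding tangent_def
  proof (intro CollectI conjI ballI S(1)[OF a])
    fix s :: real assume s: "s \<in> unit_ival"
    have "vector_derivative (S a) (at s) = trig k N a 0 s *\<^sub>R b 1 s"
      using V_deriv[OF amp[OF a] s] unfolding S_def by (rule vector_derivative_at)
    then show "vector_derivative (S a) (at s) \<bullet> vector_derivative \<gamma> (at s) = 0"
      using rot_orthogonal[of i j "vector_derivative \<gamma> (at s)"] by (simp add: cderiv_Suc)
  qed
  have S_add: "S (\<lambda>n. a n + a' n) = (\<lambda>s. S a s + S a' s)"
    if "summable (\<lambda>n. \<bar>a n\<bar>)" "summable (\<lambda>n. \<bar>a' n\<bar>)" for a a'
    unfolding S_def using that by (intro V_add[OF amp amp] trig_add N(1))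
  have S_scale: "S (\<lambda>n. t * a n) = (\<lambda>s. t *\<^sub>R S a s)" if "summable (\<lambda>n. \<bar>a n\<bar>)" for a t
    unfolding S_def using that by (intro V_scale trig_scale N(1))
  have S_\<Omega>: "S a \<in> \<Omega>" "Knorm m (S a) < \<delta>2" if "summable (\<lambda>n. \<bar>a n\<bar>)" "(\<Sum>n. \<bar>a n\<bar>) \<le> \<rho>" for a
  proof -
    have "Knorm m (S a) \<le> A * \<rho>"
      using S(2)[OF that(1)] mult_left_mono[OF that(2), of A] A(1) by linarith
    then show "S a \<in> \<Omega>" "Knorm m (S a) < \<delta>2"
      using \<rho> by (auto intro: \<delta>1(2) S_tangent[OF that(1)])
  qed
  have F_arcs: "?F x \<in> arcs (m + 1)" if "x \<in> \<Omega>" for x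
    using reduced_exp_arcs assms(6) that by blast
  have D0: "l n (D 0 (S a)) = l n (S a)" if a: "summable (\<lambda>n. \<bar>a n\<bar>)" for a n
  proof -
    interpret Kfunctional m "l n" C
      by (rule l)
    \<comment> \<open>\<open>S a\<close> may lie outside \<Omega>. Scaling by \<open>t\<close> moves
      its ray into \<Omega>, and linearity of \<open>D 0\<close> and of the functional undoes the
      scaling.\<close>
    define t where "t = \<rho> / ((\<Sum>n. \<bar>a n\<bar>) + 1)"
    have sum: "(\<Sum>n. \<bar>a n\<bar>) \<ge> 0"
      by (rule suminf_nonneg[OF a]) simp
    then have t: "t > 0" "t * (\<Sum>n. \<bar>a n\<bar>) \<le> \<rho>"
      using \<rho>(1) by (auto simp: t_def field_simps)
    have ray: "(\<lambda>s. c' *\<^sub>R S (\<lambda>n. t * a n) s) \<in> \<Omega>" if "0 < c'" "c' \<le> 1" for c'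
    proof -
      have "(\<Sum>n. \<bar>(c' * t) * a n\<bar>) = (c' * t) * (\<Sum>n. \<bar>a n\<bar>)"
        using that t(1) suminf_mult[OF a, of "c' * t"] by (simp add: abs_mult)
      also have "\<dots> \<le> 1 * (t * (\<Sum>n. \<bar>a n\<bar>))"
        using that t(1) sum unfolding mult.assoc by (intro mult_right_mono) auto
      finally have "S (\<lambda>n. (c' * t) * a n) \<in> \<Omega>"
        using t(2) summable_mult[OF a, of "\<bar>c' * t\<bar>"] by (intro S_\<Omega>) (auto simp: abs_mult)
      then show ?thesis
        using a by (simp add: S_scale)
    qed
    have "l n (D 0 (S (\<lambda>n. t * a n))) = l n (S (\<lambda>n. t * a n))"
      by (rule frechet_deriv_exp_zero[OF m(3) assms(3,6,5) ray D[OF assms(5)]])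
    moreover have "D 0 (S (\<lambda>n. t * a n)) = (\<lambda>s. t *\<^sub>R D 0 (S a) s)" "D 0 (S a) \<in> Kspace m"
      using D[OF assms(5)] S_tangent[OF a]
      by (auto simp: S_scale[OF a] frechet_deriv_K_def bounded_linear_K_def)
    ultimately show ?thesis
      using t(1) scaleR[of "D 0 (S a)" t] scaleR[OF S(1)[OF a], of t] by (simp add: S_scale[OF a])
  qed
  have "\<exists>s. summable (\<lambda>n. \<bar>s n\<bar>) \<and> (\<Sum>n. \<bar>s n\<bar>) \<le> \<rho> \<and>
      (\<forall>n. \<bar>l n (?F (S s))\<bar> \<ge> c / 16 * \<rho> * (c / (16 * (C * A + c))) ^ n)"
  proof (rule gliding_hump[where L = "\<lambda>n a. l n (S a)"])
    show "c > 0" "C * A \<ge> 0" "\<rho> > 0"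
      using c(1) C_pos A(1) \<rho>(1) by auto
    show "\<bar>l n (S d)\<bar> \<le> C * A * (\<Sum>n. \<bar>d n\<bar>)" if d: "summable (\<lambda>n. \<bar>d n\<bar>)" for n d
    proof -
      have "\<bar>l n (S d)\<bar> \<le> C * Knorm m (S d)"
        by (rule Kfunctional.bound[OF l S(1)[OF d]])
      also have "\<dots> \<le> C * (A * (\<Sum>n. \<bar>d n\<bar>))"
        using S(2)[OF d] C_pos by (intro mult_left_mono) auto
      finally show ?thesis
        by simp
    qed
    show "\<bar>l n (S (\<lambda>n'. if n' = n then a else 0))\<bar> \<ge> c * a" if a: "a \<ge> 0" for n a
    proof -
      have "S (\<lambda>n'. if n' = n then a else 0) = (\<lambda>s. a *\<^sub>R V (mode k (N n)) s)"
        unfolding S_def by (rule V_scale) (simp add: trig_single)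
      moreover have "V (mode k (N n)) \<in> Kspace m"
        using A(2)[OF amplitude_mode[OF N(1)]] by (simp add: m)
      ultimately have "l n (S (\<lambda>n'. if n' = n then a else 0)) = a * l n (V (mode k (N n)))"
        using Kfunctional.scaleR[OF l] by simp
      moreover have "c \<le> \<bar>l n (V (mode k (N n)))\<bar>"
        using c(2)[of "r n"] by (simp add: l_def N_def r_def)
      ultimately show ?thesis
        using a by (simp add: abs_mult mult.commute mult_left_mono)
    qed
    fix n s s'
    assume s: "summable (\<lambda>n. \<bar>s n :: real\<bar>)" "(\<Sum>n. \<bar>s n\<bar>) \<le> \<rho>"
      and s': "summable (\<lambda>n. \<bar>s' n :: real\<bar>)" "(\<Sum>n. \<bar>s' n\<bar>) \<le> \<rho>"
    interpret Kfunctional m "l n" C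
      by (rule l)
    define d where "d = S (\<lambda>n. s' n - s n)"
    note sd = summable_abs_affine(1)[OF s(1) s'(1)]
    have dT: "d \<in> ?T"
      unfolding d_def by (rule S_tangent[OF sd])
    have seg_eq: "(\<lambda>z. S s z + t *\<^sub>R d z) = S (\<lambda>n. s n + t * (s' n - s n))" for t
    proof -
      have "summable (\<lambda>n. \<bar>t * (s' n - s n)\<bar>)"
        using summable_mult[OF sd, of "\<bar>t\<bar>"] by (simp add: abs_mult)
      then show ?thesis
        using S_add[OF s(1), of "\<lambda>n. t * (s' n - s n)"] S_scale[OF sd, of t] by (simp add: d_def)
    qed
    have seg: "(\<lambda>z. S s z + t *\<^sub>R d z) \<in> \<Omega>" "Knorm m (\<lambda>z. S s z + t *\<^sub>R d z) < \<delta>2"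
      if "0 \<le> t" "t \<le> 1" for t
      unfolding seg_eq using summable_abs_affine(2,3)[OF s(1) s'(1)] that s(2) s'(2)
      by (auto intro: S_\<Omega>)
    have "\<bar>l n (?F (\<lambda>z. S s z + d z)) - l n (?F (S s)) - l n d\<bar> \<le> C * (\<epsilon> * (A * (\<Sum>n. \<bar>s' n - s n\<bar>)))"
    proof (rule mean_value[where V = ?T and \<Omega> = \<Omega> and D = D])
      show "d \<in> ?T"
        by (rule dT)
      show "(\<lambda>s. c *\<^sub>R d s) \<in> ?T" for c
        by (rule tangent_scaleR[OF dT m(3)])
      show "?T \<subseteq> Kspace m"
        by (auto simp: tangent_def)
      show "?F x \<in> Kspace m" if "x \<in> \<Omega>" for x
        using F_arcs[OF that] Kspace_mono[of m "m + 1"] by (auto simp: arcs_def)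
      fix t :: real assume t: "0 \<le> t" "t \<le> 1"
      let ?x = "\<lambda>z. S s z + t *\<^sub>R d z"
      have K: "D ?x d \<in> Kspace m" "D 0 d \<in> Kspace m"
        using D[OF seg(1)[OF t]] D[OF assms(5)] dT
        by (auto simp: frechet_deriv_K_def bounded_linear_K_def)
      have "\<bar>l n (D ?x d) - l n d\<bar> = \<bar>l n (\<lambda>z. D ?x d z - D 0 d z)\<bar>"
        using diff[OF K] D0[OF sd] by (simp add: d_def)
      also have "\<dots> \<le> C * Knorm m (\<lambda>z. D ?x d z - D 0 d z)"
        by (intro bound Kspace_diff K)
      also have "\<dots> \<le> C * (\<epsilon> * Knorm m d)"
        using \<delta>2(2)[OF seg[OF t] dT] C_pos by (intro mult_left_mono) (auto simp: fun_diff_def)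
      also have "\<dots> \<le> C * (\<epsilon> * (A * (\<Sum>n. \<bar>s' n - s n\<bar>)))"
        using S(2)[OF sd] C_pos \<epsilon> by (intro mult_left_mono) (auto simp: d_def)
      finally show "\<bar>l n (D ?x d) - l n d\<bar> \<le> C * (\<epsilon> * (A * (\<Sum>n. \<bar>s' n - s n\<bar>)))" .
    qed (use D seg in auto)
    moreover have "C * (\<epsilon> * (A * (\<Sum>n. \<bar>s' n - s n\<bar>))) = c / 4 * (\<Sum>n. \<bar>s' n - s n\<bar>)"
      using C_pos A(1) by (simp add: \<epsilon>_def)
    moreover have "(\<lambda>z. S s z + d z) = S s'"
      using seg_eq[of 1] by simp
    ultimately show "\<bar>l n (?F (S s')) - l n (?F (S s)) - l n (S (\<lambda>n. s' n - s n))\<bar>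
        \<le> c / 4 * (\<Sum>n. \<bar>s' n - s n\<bar>)"
      by (simp add: d_def)
  qed
  then obtain s where s: "summable (\<lambda>n. \<bar>s n\<bar>)" "(\<Sum>n. \<bar>s n\<bar>) \<le> \<rho>"
    and lower: "\<And>n. \<bar>l n (?F (S s))\<bar> \<ge> c / 16 * \<rho> * \<theta> ^ n"
    unfolding \<theta>_def by blast
  \<comment> \<open>The regularity of the image enters here: one constant \<open>E\<close> bounds
    the response at all frequencies by the square root of the grid width.\<close>
  have "?F (S s) \<in> Kspace (Suc (Suc k))"
    using F_arcs[OF S_\<Omega>(1)[OF s]] by (simp add: arcs_def m)
  then obtain E where E: "\<And>i p h J. 0 \<le> p \<Longrightarrow> p + real (2 * J) * h \<le> q \<Longrightarrow> h > 0 \<Longrightarrow>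
      \<bar>osc k i p h J (?F (S s))\<bar> \<le> E * sqrt h"
    using osc_smooth_bound[OF _ q(2)] by metis
  \<comment> \<open>The lower bound decays like \<open>\<theta> ^ n\<close>, the upper bound like
    \<open>\<theta> ^ n / real (Suc n)\<close>; their quotient cannot stay bounded.\<close>
  have bound: "real (Suc n) * (c / 16 * \<rho>) \<le> \<bar>E\<bar>" for n
  proof -
    have "c / 16 * \<rho> * \<theta> ^ n \<le> E * sqrt (pi / N n)"
      using lower[of n] E[of "pi / 8" "steps q (N n)" "pi / N n" j] steps_bounds(1)[OF q(1) N(1)[of n]] N(1)[of n]
      unfolding l_def by (force intro: divide_pos_pos)
    also have "\<dots> \<le> \<bar>E\<bar> * sqrt ((\<theta> ^ n / real (Suc n))\<^sup>2)"
      using N(1)[of n] by (intro mult_mono real_sqrt_le_mono N(2)) auto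
    also have "\<dots> = \<bar>E\<bar> / real (Suc n) * \<theta> ^ n"
      using \<theta> by simp
    finally have "c / 16 * \<rho> \<le> \<bar>E\<bar> / real (Suc n)"
      by (rule mult_right_le_imp_le) (simp add: \<theta>)
    then show ?thesis
      by (simp add: field_simps del: of_nat_Suc)
  qed
  obtain n where "\<bar>E\<bar> < real n * (c / 16 * \<rho>)"
    using reals_Archimedean3[of "c / 16 * \<rho>"] c(1) \<rho>(1) by auto
  also have "\<dots> \<le> real (Suc n) * (c / 16 * \<rho>)"
    using c(1) \<rho>(1) by (intro mult_right_mono) auto
  finally show False
    using bound[of n] by simp
qed

end
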